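(* Let $\mathcal N\in\mathcal C(\mathcal H_A\otimes\mathcal H_J,\mathcal H_B)$. Then either $\overline{\mathcal A}_{d,CET}(\mathcal N)=\{(0,0)\}$ or $\overline{\mathcal A}_{d,CET}(\mathcal N)=\overline{\mathcal A}_{r,CET}(\mathcal N)$.
   Context: Finite-dimensional Hilbert spaces; $F(\rho,\sigma)=\|\sqrt\rho\sqrt\sigma\|_1^2$. For $\sigma\in\mathcal S(\mathcal H_J^{\otimes n})$, $\mathcal N_{n,\sigma}(\cdot):=\mathcal N^{\otimes n}(\cdot\otimes\sigma)$. An $(n,M_1,M_2)$ CET code $\mathcal C=(\mathcal P_m,\mathcal R_m)_{m=1}^{M_1}$: $\mathcal F_A\subset\mathcal F_B$, $\dim\mathcal F_A=M_2$, $\mathcal P_m$ CPTP $\mathcal L(\mathcal F_A)\to\mathcal L(\mathcal H_A^{\otimes n})$, $\mathcal R_m$ CP trace non-increasing $\mathcal L(\mathcal H_B^{\otimes n})\to\mathcal L(\mathcal F_B)$, $\sum_m\mathcal R_m$ trace preserving; $\mathcal R=\sum_m|m\rangle\langle m|\otimes\mathcal R_m$; $\overline P_{CET}(\mathcal C,\mathcal M)=\frac1{M_1}\sum_mF(|m\rangle\langle m|\otimes\Phi,(\mathrm{id}\otimes\mathcal R\circ\mathcal M\circ\mathcal P_m)(\Phi))$, $\Phi$ maximally entangled on $\mathcal F_A\otimes\mathcal F_A$. A random code is a probability measure $\mu_n$ on codes. $\overline{\mathcal A}_{r,CET}(\mathcal N)$ (resp. $\overline{\mathcal A}_{d,CET}(\mathcal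 N)$) is the set of $(R_1,R_2)\ge0$ for which there are random codes $\mu_n$ (resp. deterministic codes $\mathcal C_n$) with $\liminf_n\frac1n\log M_{i,n}\ge R_i$ and $\lim_n\inf_{\sigma\in\mathcal S(\mathcal H_J^{\otimes n})}\int\overline P_{CET}(\cdot,\mathcal N_{n,\sigma})d\mu_n=1$ (resp. $\lim_n\inf_\sigma\overline P_{CET}(\mathcal C_n,\mathcal N_{n,\sigma})=1$). *)

theory Defs
  imports "HOL-Probability.Probability"
begin

text \<open>An operator on the Hilbert space whose orthonormal basis is indexed by a finite set I
  is represented by its matrix: entries X i j for i, j in I (other entries are ignored).
  Tensor products of spaces correspond to products of index sets; the n-fold tensor power
  corresponds to the set of index lists of length n.\<close>

type_synonym 'i cop = "'i \<Rightarrow> 'i \<Rightarrow> complex"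

definition nlists :: "nat \<Rightarrow> 'x set \<Rightarrow> 'x list set" where
  "nlists n S = {xs. length xs = n \<and> set xs \<subseteq> S}"

definition opmult :: "'i set \<Rightarrow> 'i cop \<Rightarrow> 'i cop \<Rightarrow> 'i cop" where
  "opmult I X Y = (\<lambda>i k. \<Sum>j\<in>I. X i j * Y j k)"

definition adj :: "'i cop \<Rightarrow> 'i cop" where
  "adj X = (\<lambda>i j. cnj (X j i))"

definition tr :: "'i set \<Rightarrow> 'i cop \<Rightarrow> complex" where
  "tr I X = (\<Sum>i\<in>I. X i i)"

definition supported :: "'i set \<Rightarrow> 'i cop \<Rightarrow> bool" where
  "supported I X \<longleftrightarrow> (\<forall>i j. \<not> (i \<in> I \<and> j \<in> I) \<longrightarrow> X i j = 0)"

definition psd :: "'i set \<Rightarrow> 'i cop \<Rightarrow> bool" where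
  "psd I X \<longleftrightarrow> (\<forall>v :: 'i \<Rightarrow> complex.
      Im (\<Sum>i\<in>I. \<Sum>j\<in>I. cnj (v i) * X i j * v j) = 0 \<and>
      0 \<le> Re (\<Sum>i\<in>I. \<Sum>j\<in>I. cnj (v i) * X i j * v j))"

definition is_state :: "'i set \<Rightarrow> 'i cop \<Rightarrow> bool" where
  "is_state I \<rho> \<longleftrightarrow> psd I \<rho> \<and> tr I \<rho> = 1"

definition sqrt_op :: "'i set \<Rightarrow> 'i cop \<Rightarrow> 'i cop" where
  "sqrt_op I X = (THE Y. supported I Y \<and> psd I Y \<and>
       (\<forall>i\<in>I. \<forall>j\<in>I. opmult I Y Y i j = X i j))"

definition trace_norm :: "'i set \<Rightarrow> 'i cop \<Rightarrow> real" where
  "trace_norm I X = Re (tr I (sqrt_op I (opmult I (adj X) X)))"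

definition fidelity :: "'i set \<Rightarrow> 'i cop \<Rightarrow> 'i cop \<Rightarrow> real" where
  "fidelity I \<rho> \<sigma> = (trace_norm I (opmult I (sqrt_op I \<rho>) (sqrt_op I \<sigma>)))\<^sup>2"

definition eunit :: "'i \<Rightarrow> 'i \<Rightarrow> 'i cop" where
  "eunit i j = (\<lambda>a b. if a = i \<and> b = j then 1 else 0)"

definition linmap :: "'i set \<Rightarrow> 'k set \<Rightarrow> ('i cop \<Rightarrow> 'k cop) \<Rightarrow> bool" where
  "linmap I J \<Phi> \<longleftrightarrow> (\<forall>X k l. \<Phi> X k l =
      (if k \<in> J \<and> l \<in> J then (\<Sum>i\<in>I. \<Sum>j\<in>I. X i j * \<Phi> (eunit i j) k l) else 0))"

definition id_tensor :: "('i cop \<Rightarrow> 'k cop) \<Rightarrow> ('c \<times> 'i) cop \<Rightarrow> ('c \<times> 'k) cop" where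
  "id_tensor \<Phi> X = (\<lambda>(a, k) (b, l). \<Phi> (\<lambda>i j. X (a, i) (b, j)) k l)"

definition completely_positive :: "'i set \<Rightarrow> 'k set \<Rightarrow> ('i cop \<Rightarrow> 'k cop) \<Rightarrow> bool" where
  "completely_positive I J \<Phi> \<longleftrightarrow> linmap I J \<Phi> \<and>
     (\<forall>d::nat. \<forall>X. psd ({0..<d} \<times> I) X \<longrightarrow> psd ({0..<d} \<times> J) (id_tensor \<Phi> X))"

definition trace_preserving :: "'i set \<Rightarrow> 'k set \<Rightarrow> ('i cop \<Rightarrow> 'k cop) \<Rightarrow> bool" where
  "trace_preserving I J \<Phi> \<longleftrightarrow> (\<forall>X. tr J (\<Phi> X) = tr I X)"

definition trace_nonincreasing :: "'i set \<Rightarrow> 'k set \<Rightarrow> ('i cop \<Rightarrow> 'k cop) \<Rightarrow> bool" where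
  "trace_nonincreasing I J \<Phi> \<longleftrightarrow> (\<forall>X. psd I X \<longrightarrow> Re (tr J (\<Phi> X)) \<le> Re (tr I X))"

definition channel :: "'i set \<Rightarrow> 'k set \<Rightarrow> ('i cop \<Rightarrow> 'k cop) \<Rightarrow> bool" where
  "channel I J \<Phi> \<longleftrightarrow> completely_positive I J \<Phi> \<and> trace_preserving I J \<Phi>"

text \<open>\<open>\<Phi>\<^sup>\<otimes>\<^sup>n\<close>: the linear map acting on products of matrix units as the product.\<close>
definition tensor_power_map :: "nat \<Rightarrow> ('x::finite cop \<Rightarrow> 'y::finite cop) \<Rightarrow> 'x list cop \<Rightarrow> 'y list cop" where
  "tensor_power_map n \<Phi> Y = (\<lambda>ys ys'.
     if length ys = n \<and> length ys' = n then
       (\<Sum>xs\<in>nlists n UNIV. \<Sum>xs'\<in>nlists n UNIV.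
          Y xs xs' * (\<Prod>k<n. \<Phi> (eunit (xs ! k) (xs' ! k)) (ys ! k) (ys' ! k)))
     else 0)"

text \<open>\<open>\<N>_{n,\<sigma>}(X) = \<N>\<^sup>\<otimes>\<^sup>n(X \<otimes> \<sigma>)\<close>, using the canonical identification
  \<open>H_A\<^sup>\<otimes>\<^sup>n \<otimes> H_J\<^sup>\<otimes>\<^sup>n \<cong> (H_A \<otimes> H_J)\<^sup>\<otimes>\<^sup>n\<close>.\<close>
definition jammed_channel ::
  "(('a::finite \<times> 'j::finite) cop \<Rightarrow> 'b::finite cop) \<Rightarrow> nat \<Rightarrow> 'j list cop \<Rightarrow> 'a list cop \<Rightarrow> 'b list cop" where
  "jammed_channel N n \<sigma> X = tensor_power_map n N
      (\<lambda>xs xs'. X (map fst xs) (map fst xs') * \<sigma> (map snd xs) (map snd xs'))"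

text \<open>F_A has basis {0..<M2}, F_B has basis {0..<dimFB} (F_A \<subseteq> F_B via the first basis
  vectors), messages are {0..<M1}. enc m = P_m, dec m = R_m.\<close>
record ('a, 'b) cet_code =
  dimFB :: nat
  enc :: "nat \<Rightarrow> nat cop \<Rightarrow> 'a list cop"
  dec :: "nat \<Rightarrow> 'b list cop \<Rightarrow> nat cop"

definition is_cet_code :: "nat \<Rightarrow> nat \<Rightarrow> nat \<Rightarrow> ('a, 'b) cet_code \<Rightarrow> bool" where
  "is_cet_code n M1 M2 C \<longleftrightarrow> 1 \<le> M1 \<and> 1 \<le> M2 \<and> M2 \<le> dimFB C \<and>
     (\<forall>m<M1. channel {0..<M2} (nlists n UNIV) (enc C m)) \<and>
     (\<forall>m<M1. completely_positive (nlists n UNIV) {0..<dimFB C} (dec C m) \<and>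
              trace_nonincreasing (nlists n UNIV) {0..<dimFB C} (dec C m)) \<and>
     trace_preserving (nlists n UNIV) {0..<dimFB C} (\<lambda>Y k l. \<Sum>m<M1. dec C m Y k l)"

definition full_decoder :: "nat \<Rightarrow> ('a, 'b) cet_code \<Rightarrow> 'b list cop \<Rightarrow> (nat \<times> nat) cop" where
  "full_decoder M1 C Y = (\<lambda>(m, f) (m', f'). if m = m' \<and> m < M1 then dec C m Y f f' else 0)"

text \<open>Maximally entangled state \<Phi> on F_A \<otimes> F_A (viewed inside F_A \<otimes> F_B).\<close>
definition max_ent :: "nat \<Rightarrow> (nat \<times> nat) cop" where
  "max_ent M2 = (\<lambda>(a, f) (b, f'). if a < M2 \<and> b < M2 \<and> a = f \<and> b = f' then 1 / of_nat M2 else 0)"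

definition cet_success :: "nat \<Rightarrow> nat \<Rightarrow> ('a, 'b) cet_code \<Rightarrow> ('a list cop \<Rightarrow> 'b list cop) \<Rightarrow> real" where
  "cet_success M1 M2 C \<M> = (1 / real M1) * (\<Sum>m<M1.
     fidelity ({0..<M2} \<times> ({0..<M1} \<times> {0..<dimFB C}))
       (\<lambda>(a, (m1, f)) (b, (m2, f')). if m1 = m \<and> m2 = m then max_ent M2 (a, f) (b, f') else 0)
       (id_tensor (\<lambda>X. full_decoder M1 C (\<M> (enc C m X))) (max_ent M2)))"

definition det_cet_region :: "(('a::finite \<times> 'j::finite) cop \<Rightarrow> 'b::finite cop) \<Rightarrow> (real \<times> real) set" where
  "det_cet_region N = {(R1, R2). 0 \<le> R1 \<and> 0 \<le> R2 \<and>
     (\<exists>(M1 :: nat \<Rightarrow> nat) (M2 :: nat \<Rightarrow> nat) (C :: nat \<Rightarrow> ('a, 'b) cet_code).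
        (\<forall>n. is_cet_code n (M1 n) (M2 n) (C n)) \<and>
        ereal R1 \<le> liminf (\<lambda>n. ereal (log 2 (real (M1 n)) / real n)) \<and>
        ereal R2 \<le> liminf (\<lambda>n. ereal (log 2 (real (M2 n)) / real n)) \<and>
        (\<lambda>n. INF \<sigma>\<in>{\<sigma>. is_state (nlists n UNIV) \<sigma>}.
               cet_success (M1 n) (M2 n) (C n) (jammed_channel N n \<sigma>)) \<longlonglongrightarrow> 1)}"

definition rand_cet_region :: "(('a::finite \<times> 'j::finite) cop \<Rightarrow> 'b::finite cop) \<Rightarrow> (real \<times> real) set" where
  "rand_cet_region N = {(R1, R2). 0 \<le> R1 \<and> 0 \<le> R2 \<and>
     (\<exists>(M1 :: nat \<Rightarrow> nat) (M2 :: nat \<Rightarrow> nat) (\<mu> :: nat \<Rightarrow> ('a, 'b) cet_code measure).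
        (\<forall>n. prob_space (\<mu> n) \<and>
             (\<forall>C\<in>space (\<mu> n). is_cet_code n (M1 n) (M2 n) C) \<and>
             (\<forall>\<sigma>. is_state (nlists n UNIV) \<sigma> \<longrightarrow>
                 (\<lambda>C. cet_success (M1 n) (M2 n) C (jammed_channel N n \<sigma>)) \<in> borel_measurable (\<mu> n))) \<and>
        ereal R1 \<le> liminf (\<lambda>n. ereal (log 2 (real (M1 n)) / real n)) \<and>
        ereal R2 \<le> liminf (\<lambda>n. ereal (log 2 (real (M2 n)) / real n)) \<and>
        (\<lambda>n. INF \<sigma>\<in>{\<sigma>. is_state (nlists n UNIV) \<sigma>}.
               \<integral>C. cet_success (M1 n) (M2 n) C (jammed_channel N n \<sigma>) \<partial>\<mu> n) \<longlonglongrightarrow> 1)}"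

end

theory Submission
  imports Defs "HOL-Library.Complex_Order" "HOL-Real_Asymp.Real_Asymp"
begin

text \<open>Ahlswede's elimination technique. As the target state is pure, the success probability of a
  code against the jammer state \<open>\<sigma>\<close> is linear in \<open>\<sigma>\<close>: it is the pairing of \<open>\<sigma>\<close> with a kernel
  \<open>0 \<le> G \<le> 1\<close> on the jammer's space, of dimension exponential in \<open>n\<close>. For a random code a
  concentration bound in operator norm yields \<open>K\<close> codes, with \<open>K\<close> merely polynomial in \<open>n\<close>, whose
  average is almost as good as the random code uniformly in \<open>\<sigma>\<close>. If some nonzero rate pair is
  achievable deterministically, then a prefix of length about \<open>sqrt n\<close> suffices to tell the receiver
  which of the \<open>K\<close> codes is used; entanglement that is transmitted with high fidelity also carries
  classical messages, so it does not matter which of the two rates is positive. If \<open>F\<close> is the kernel of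
  the prefix, then \<open>F \<otimes> G \<ge> F \<otimes> 1 + 1 \<otimes> G - 1 \<otimes> 1\<close>, so the two failure probabilities add up
  even if the jammer entangles the two parts.\<close>

section \<open>Positive semidefinite kernels and their square roots\<close>

text \<open>Two obstacles shape the development. The fidelity is defined through operator square
  roots, so linearity in the jammer state becomes visible only after roots are shown to exist and to
  be unique; a power series and Cauchy-Schwarz achieve this without a spectral theorem. In the same
  spirit, concentration uses traces of powers instead of matrix exponentials: an entry of a power of
  a sum of samples is a polynomial in their entries, so independence enters through Fubini alone.
  Passing from trace to norm costs the factor \<open>card I\<close>, the dimension of the jammer's
  space, exponential in the block length. A moment of order \<open>2 * p\<close> with
  \<open>p\<close> at least that length absorbs it, since the p-th root of the dimension is then at
  most \<open>CARD('j)\<close>. With \<open>p \<le> 2 * n\<close> and accuracy \<open>1 / n\<close>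
  this produces the threshold \<open>16 * CARD('j) * n ^ 4\<close> for the number of codes. A
  misread prefix makes the decoder of one code act after the encoder of another. Such mixed kernels
  are never estimated; their positivity is enough to discard them, and this is why
  \<open>ent_ker\<close> takes two codes.\<close>

definition sesq :: "'i set \<Rightarrow> 'i cop \<Rightarrow> ('i \<Rightarrow> complex) \<Rightarrow> ('i \<Rightarrow> complex) \<Rightarrow> complex" where
  "sesq I X u v = (\<Sum>i\<in>I. \<Sum>j\<in>I. cnj (u i) * X i j * v j)"

text \<open>Partially applied, \<open>idop i\<close> also serves as the i-th standard basis
  vector.\<close>

definition idop :: "'i cop" where
  "idop = (\<lambda>i j. if i = j then 1 else 0)"

definition sqnorm :: "'i set \<Rightarrow> ('i \<Rightarrow> complex) \<Rightarrow> real" where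
  "sqnorm I v = (\<Sum>i\<in>I. (norm (v i))\<^sup>2)"

definition app_op :: "'i set \<Rightarrow> 'i cop \<Rightarrow> ('i \<Rightarrow> complex) \<Rightarrow> 'i \<Rightarrow> complex" where
  "app_op I X v = (\<lambda>i. \<Sum>j\<in>I. X i j * v j)"

lemma psd_iff_sesq: "psd I X \<longleftrightarrow> (\<forall>v. 0 \<le> sesq I X v v)"
  by (auto simp: psd_def sesq_def less_eq_complex_def)

lemma sesq_left: "sesq I X (\<lambda>i. u i + c * w i) v = sesq I X u v + cnj c * sesq I X w v"
  by (simp add: sesq_def algebra_simps sum.distrib sum_distrib_left)

lemma sesq_right: "sesq I X u (\<lambda>i. v i + c * w i) = sesq I X u v + c * sesq I X u w"
  by (simp add: sesq_def algebra_simps sum.distrib sum_distrib_left)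

lemma sesq_op_diff: "sesq I (\<lambda>i j. X i j - Y i j) u v = sesq I X u v - sesq I Y u v"
  by (simp add: sesq_def algebra_simps sum_subtractf)

lemma sesq_op_add: "sesq I (\<lambda>i j. X i j + Y i j) u v = sesq I X u v + sesq I Y u v"
  by (simp add: sesq_def algebra_simps sum.distrib)

lemma sesq_op_scale: "sesq I (\<lambda>i j. c * X i j) u v = c * sesq I X u v"
  by (simp add: sesq_def algebra_simps sum_distrib_left)

lemma sum_rotate:
  "(\<Sum>i\<in>I. \<Sum>j\<in>J. \<Sum>r\<in>R. f i j r) = (\<Sum>r\<in>R. \<Sum>i\<in>I. \<Sum>j\<in>J. f i j r)"
proof -
  have "(\<Sum>i\<in>I. \<Sum>j\<in>J. \<Sum>r\<in>R. f i j r) = (\<Sum>i\<in>I. \<Sum>r\<in>R. \<Sum>j\<in>J. f i j r)"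
    by (intro sum.cong refl sum.swap)
  then show ?thesis using sum.swap[of "\<lambda>i r. \<Sum>j\<in>J. f i j r" R I] by simp
qed

lemma sesq_op_sum: "sesq I (\<lambda>i j. \<Sum>r\<in>R. X r i j) u v = (\<Sum>r\<in>R. sesq I (X r) u v)"
  unfolding sesq_def sum_distrib_left sum_distrib_right by (rule sum_rotate)

lemma sesq_app: "sesq I X u v = (\<Sum>i\<in>I. cnj (u i) * app_op I X v i)"
  by (simp add: sesq_def app_op_def sum_distrib_left mult.assoc)

lemma app_idop: "finite I \<Longrightarrow> i \<in> I \<Longrightarrow> app_op I idop v i = v i"
  by (simp add: app_op_def idop_def if_distrib[of "\<lambda>x. x * _"] cong: if_cong)

lemma sesq_idop: "finite I \<Longrightarrow> sesq I idop u v = (\<Sum>i\<in>I. cnj (u i) * v i)"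
  by (auto simp: sesq_app app_idop intro: sum.cong)

lemma sesq_idop_self: "finite I \<Longrightarrow> sesq I idop v v = of_real (sqnorm I v)"
  by (auto simp: sesq_idop sqnorm_def complex_norm_square mult.commute intro: sum.cong simp del: of_real_power)

lemma sqnorm_nonneg: "0 \<le> sqnorm I v"
  by (simp add: sqnorm_def sum_nonneg)

lemma sesq_unit:
  assumes "finite I" "i \<in> I" "j \<in> I"
  shows "sesq I X (idop i) (idop j) = X i j"
  using assms by (simp add: sesq_def idop_def if_distrib[of "\<lambda>x. x * _"] if_distrib[of "\<lambda>x. _ * x"] if_distrib[of cnj] cong: if_cong)

lemma sqnorm_unit: "finite I \<Longrightarrow> i \<in> I \<Longrightarrow> sqnorm I (idop i) = 1"
  by (simp add: sqnorm_def idop_def if_distrib[of norm] if_distrib[of "\<lambda>x. x\<^sup>2"] cong: if_cong)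

lemma app_unit: "finite I \<Longrightarrow> j \<in> I \<Longrightarrow> app_op I X (idop j) i = X i j"
  by (simp add: app_op_def idop_def if_distrib[of "\<lambda>x. _ * x"] cong: if_cong)

lemma app_opmult: "app_op I (opmult I X Y) v = app_op I X (app_op I Y v)"
  unfolding app_op_def opmult_def sum_distrib_left sum_distrib_right
  by (rule ext, subst sum.swap) (simp add: mult.assoc)

lemma norm_sesq_idop_le:
  assumes "finite I"
  shows "(norm (\<Sum>i\<in>I. cnj (u i) * v i))\<^sup>2 \<le> sqnorm I u * sqnorm I v"
proof -
  have "norm (\<Sum>i\<in>I. cnj (u i) * v i) \<le> (\<Sum>i\<in>I. \<bar>norm (u i)\<bar> * \<bar>norm (v i)\<bar>)"
    by (rule order_trans[OF norm_sum]) (simp add: norm_mult)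
  also have "\<dots> \<le> L2_set (\<lambda>i. norm (u i)) I * L2_set (\<lambda>i. norm (v i)) I"
    by (rule L2_set_mult_ineq)
  finally have "(norm (\<Sum>i\<in>I. cnj (u i) * v i))\<^sup>2 \<le> (L2_set (\<lambda>i. norm (u i)) I * L2_set (\<lambda>i. norm (v i)) I)\<^sup>2"
    by (rule power_mono) simp
  then show ?thesis
    by (simp add: power_mult_distrib L2_set_def sqnorm_def sum_nonneg)
qed

text \<open>Polarization: the form is real at \<open>u + v\<close> and at
  \<open>u + \<i> * v\<close>, which determines the imaginary part of the sum and the real part of
  the difference of the two mixed terms.\<close>

lemma psd_sesq_sym:
  assumes "psd I X"
  shows "sesq I X v u = cnj (sesq I X u v)"
proof -
  have p: "0 \<le> sesq I X w w" for w
    using assms by (simp add: psd_iff_sesq)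
  have e: "sesq I X (\<lambda>i. u i + c * v i) (\<lambda>i. u i + c * v i)
      = sesq I X u u + c * sesq I X u v + cnj c * sesq I X v u + cnj c * c * sesq I X v v" for c
    by (simp add: sesq_left sesq_right algebra_simps)
  have "Im (sesq I X u v + sesq I X v u) = 0"
    using e[of 1] p[of u] p[of v] p[of "\<lambda>i. u i + 1 * v i"] by (simp add: less_eq_complex_def)
  moreover have "Re (sesq I X u v) = Re (sesq I X v u)"
    using e[of \<i>] p[of u] p[of v] p[of "\<lambda>i. u i + \<i> * v i"] by (simp add: less_eq_complex_def)
  ultimately show ?thesis by (simp add: complex_eq_iff)
qed

lemma psd_hermitian:
  assumes "psd I X" "finite I" "i \<in> I" "j \<in> I"
  shows "X j i = cnj (X i j)"
  using psd_sesq_sym[OF assms(1), of "idop j" "idop i"] assms by (simp add: sesq_unit)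

text \<open>The form at \<open>u - t * cnj z * v\<close> is a nonnegative polynomial in the real
  \<open>t\<close>. The factor \<open>cnj z\<close> removes the phase of the mixed term, and for
  \<open>b > 0\<close> the minimum is at \<open>t = 1 / b\<close>.\<close>

lemma psd_cauchy_schwarz:
  assumes "psd I X"
  shows "(norm (sesq I X u v))\<^sup>2 \<le> Re (sesq I X u u) * Re (sesq I X v v)"
proof -
  define a b z where "a = Re (sesq I X u u)" and "b = Re (sesq I X v v)" and "z = sesq I X u v"
  have p: "0 \<le> sesq I X w w" for w
    using assms by (simp add: psd_iff_sesq)
  have ab: "0 \<le> a" "0 \<le> b" using p by (auto simp: a_def b_def less_eq_complex_def)
  have q: "0 \<le> a - 2 * t * (norm z)\<^sup>2 + t\<^sup>2 * (norm z)\<^sup>2 * b" for t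
  proof -
    define c where "c = - (of_real t * cnj z)"
    have "sesq I X (\<lambda>i. u i + c * v i) (\<lambda>i. u i + c * v i)
      = sesq I X u u + c * z + cnj c * cnj z + cnj c * c * sesq I X v v"
      using psd_sesq_sym[OF assms, of v u] by (simp add: sesq_left sesq_right algebra_simps z_def)
    also have "Re \<dots> = a - 2 * t * (norm z)\<^sup>2 + t\<^sup>2 * (norm z)\<^sup>2 * b"
      using p[of v] by (simp add: a_def b_def c_def cmod_power2 less_eq_complex_def)
         (simp add: algebra_simps power2_eq_square)
    finally show ?thesis using p[of "\<lambda>i. u i + c * v i"] by (simp add: less_eq_complex_def)
  qed
  have "(norm z)\<^sup>2 \<le> a * b"
  proof (cases "b = 0")
    case True
    have "norm z = 0"
    proof (rule ccontr)
      assume "norm z \<noteq> 0"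
      \<comment> \<open>For \<open>b = 0\<close> the polynomial is linear in \<open>t\<close>, and
        this \<open>t\<close> gives it the value -1.\<close>
      then show False using q[of "(a + 1) / (2 * (norm z)\<^sup>2)"] True ab by simp
    qed
    then show ?thesis using True by simp
  next
    case False
    then have b: "0 < b" using ab by simp
    have "0 \<le> a - (norm z)\<^sup>2 / b"
      using q[of "1 / b"] b by (simp add: power2_eq_square field_simps)
    then show ?thesis using b by (simp add: field_simps)
  qed
  then show ?thesis by (simp add: a_def b_def z_def)
qed

lemma psd_kernel:
  assumes "psd I X" "finite I" "sesq I X v v = 0" "i \<in> I"
  shows "app_op I X v i = 0"
proof -
  have "(norm (sesq I X (idop i) v))\<^sup>2 \<le> 0"
    using psd_cauchy_schwarz[OF assms(1), of "idop i" v] assms(3) by simp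
  then have "sesq I X (idop i) v = 0" by simp
  moreover have "sesq I X (idop i) v = app_op I X v i"
    using assms by (simp add: sesq_app idop_def if_distrib[of "\<lambda>x. x * _"] if_distrib[of cnj] cong: if_cong)
  ultimately show ?thesis by simp
qed

lemma psd_idop: "finite I \<Longrightarrow> psd I idop"
  by (simp add: psd_iff_sesq sesq_idop_self less_eq_complex_def sqnorm_nonneg)

lemma sesq_le_sqnorm:
  assumes "psd I A" "psd I (\<lambda>i j. idop i j - A i j)" "finite I"
  shows "(norm (sesq I A u v))\<^sup>2 \<le> sqnorm I u * sqnorm I v"
proof -
  have le: "Re (sesq I A w w) \<le> sqnorm I w" "0 \<le> Re (sesq I A w w)" for w
    using assms(1,2) assms(3) by (auto simp: psd_iff_sesq sesq_op_diff sesq_idop_self less_eq_complex_def)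
  have "(norm (sesq I A u v))\<^sup>2 \<le> Re (sesq I A u u) * Re (sesq I A v v)"
    by (rule psd_cauchy_schwarz[OF assms(1)])
  also have "\<dots> \<le> sqnorm I u * sqnorm I v"
    using le by (intro mult_mono) (auto simp: sqnorm_nonneg)
  finally show ?thesis .
qed

text \<open>Testing the form with \<open>u = app_op I A v\<close> turns a bound on the form into a
  bound on the operator norm.\<close>

lemma sqnorm_app_le_of_sesq:
  assumes "finite I" "0 \<le> c" and le: "\<And>u v. norm (sesq I A u v) \<le> c * sqrt (sqnorm I u) * sqrt (sqnorm I v)"
  shows "sqnorm I (app_op I A v) \<le> c\<^sup>2 * sqnorm I v"
proof -
  let ?w = "app_op I A v"
  have "sesq I A ?w v = of_real (sqnorm I ?w)"
    using sesq_idop_self[OF assms(1), of ?w] unfolding sesq_app[of I A] sesq_idop[OF assms(1)] .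
  then have 1: "sqnorm I ?w \<le> c * sqrt (sqnorm I ?w) * sqrt (sqnorm I v)"
    using le[of ?w v] sqnorm_nonneg[of I ?w] by simp
  show ?thesis
  proof (cases "sqnorm I ?w = 0")
    case True
    then show ?thesis by (simp add: sqnorm_nonneg)
  next
    case False
    then have pos: "0 < sqrt (sqnorm I ?w)" using sqnorm_nonneg[of I ?w] by simp
    have "sqrt (sqnorm I ?w) * sqrt (sqnorm I ?w) \<le> sqrt (sqnorm I ?w) * (c * sqrt (sqnorm I v))"
      using 1 sqnorm_nonneg[of I ?w] by (simp add: ac_simps)
    then have "sqrt (sqnorm I ?w) \<le> c * sqrt (sqnorm I v)" using pos by (rule mult_left_le_imp_le)
    then have "(sqrt (sqnorm I ?w))\<^sup>2 \<le> (c * sqrt (sqnorm I v))\<^sup>2"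
      by (rule power_mono) (simp add: sqnorm_nonneg)
    then show ?thesis by (simp add: power_mult_distrib sqnorm_nonneg)
  qed
qed

lemma sesq_le_sqrt:
  assumes "psd I A" "psd I (\<lambda>i j. idop i j - A i j)" "finite I"
  shows "norm (sesq I A u v) \<le> sqrt (sqnorm I u) * sqrt (sqnorm I v)"
  using real_le_rsqrt[OF sesq_le_sqnorm[OF assms]] by (simp add: real_sqrt_mult)

section \<open>Powers of a contraction and the square root series\<close>

fun opow :: "'i set \<Rightarrow> 'i cop \<Rightarrow> nat \<Rightarrow> 'i cop" where
  "opow I B 0 = idop"
| "opow I B (Suc k) = opmult I B (opow I B k)"

lemma opmult_assoc: "opmult I (opmult I X Y) Z = opmult I X (opmult I Y Z)"
  unfolding opmult_def sum_distrib_left sum_distrib_right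
  by (intro ext, subst sum.swap) (simp add: mult.assoc)

lemma opmult_idop_left: "finite I \<Longrightarrow> i \<in> I \<Longrightarrow> opmult I idop X i j = X i j"
  by (simp add: opmult_def idop_def if_distrib[of "\<lambda>x. x * _"] cong: if_cong)

lemma opmult_idop_right: "finite I \<Longrightarrow> j \<in> I \<Longrightarrow> opmult I X idop i j = X i j"
  by (simp add: opmult_def idop_def if_distrib[of "\<lambda>x. _ * x"] cong: if_cong)

lemma opow_add:
  assumes "finite I" "i \<in> I"
  shows "opow I B (m + n) i j = opmult I (opow I B m) (opow I B n) i j"
  using assms(2)
proof (induction m arbitrary: i)
  case 0
  then show ?case using assms by (simp add: opmult_idop_left)
next
  case (Suc m)
  have "opow I B (Suc m + n) i j = (\<Sum>k\<in>I. B i k * opow I B (m + n) k j)"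
    by (simp add: opmult_def)
  also have "\<dots> = (\<Sum>k\<in>I. B i k * opmult I (opow I B m) (opow I B n) k j)"
    using Suc by auto
  also have "\<dots> = opmult I B (opmult I (opow I B m) (opow I B n)) i j"
    by (simp add: opmult_def[of I B])
  finally show ?case by (simp add: opmult_assoc)
qed

lemma opow_one: "finite I \<Longrightarrow> j \<in> I \<Longrightarrow> opow I B 1 i j = B i j"
  by (simp add: opmult_idop_right)

definition herm_on :: "'i set \<Rightarrow> 'i cop \<Rightarrow> bool" where
  "herm_on I X \<longleftrightarrow> (\<forall>i\<in>I. \<forall>j\<in>I. X j i = cnj (X i j))"

lemma herm_on_idop_diff:
  assumes "herm_on I X"
  shows "herm_on I (\<lambda>i j. idop i j - X i j)"
  unfolding herm_on_def
proof (intro ballI)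
  fix i j assume "i \<in> I" "j \<in> I"
  then have "X j i = cnj (X i j)" using assms unfolding herm_on_def by blast
  then show "idop j i - X j i = cnj (idop i j - X i j)"
    unfolding complex_cnj_diff by (simp add: idop_def)
qed

lemma herm_on_opow:
  assumes "finite I" "herm_on I B"
  shows "herm_on I (opow I B k)"
proof (induction k)
  case 0
  then show ?case by (simp add: herm_on_def idop_def)
next
  case (Suc k)
  show ?case unfolding herm_on_def
  proof (intro ballI)
    fix i j assume ij: "i \<in> I" "j \<in> I"
    have "cnj (opow I B (Suc k) i j) = (\<Sum>l\<in>I. cnj (B i l) * cnj (opow I B k l j))"
      by (simp add: opmult_def)
    also have "\<dots> = (\<Sum>l\<in>I. opow I B k j l * opow I B 1 l i)"
      unfolding opow_one[OF assms(1) ij(1)]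
    proof (rule sum.cong[OF refl])
      fix l assume l: "l \<in> I"
      have "B l i = cnj (B i l)" using assms(2) ij l unfolding herm_on_def by blast
      moreover have "opow I B k j l = cnj (opow I B k l j)" using Suc ij l unfolding herm_on_def by blast
      ultimately show "cnj (B i l) * cnj (opow I B k l j) = opow I B k j l * B l i"
        by (simp only: mult.commute)
    qed
    also have "\<dots> = opow I B (k + 1) j i"
      using ij by (subst opow_add[OF assms(1)]) (auto simp: opmult_def)
    finally show "opow I B (Suc k) j i = cnj (opow I B (Suc k) i j)" by simp
  qed
qed

lemma herm_on_sesq:
  assumes "herm_on I X"
  shows "sesq I X v u = cnj (sesq I X u v)"
proof -
  have "cnj (sesq I X u v) = (\<Sum>i\<in>I. \<Sum>j\<in>I. cnj (v j) * cnj (X i j) * u i)"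
    by (simp add: sesq_def mult_ac)
  also have "\<dots> = (\<Sum>i\<in>I. \<Sum>j\<in>I. cnj (v j) * X j i * u i)"
  proof (intro sum.cong refl)
    fix i j assume "i \<in> I" "j \<in> I"
    then have "X j i = cnj (X i j)" using assms unfolding herm_on_def by blast
    then show "cnj (v j) * cnj (X i j) * u i = cnj (v j) * X j i * u i" by (simp only:)
  qed
  finally show ?thesis unfolding sesq_def by (subst sum.swap) simp
qed

lemma psdI_herm:
  assumes "herm_on I X" "\<And>v. 0 \<le> Re (sesq I X v v)"
  shows "psd I X"
  using assms(2) herm_on_sesq[OF assms(1)] unfolding psd_iff_sesq less_eq_complex_def
  by (metis complex_cnj_cancel_iff complex_is_Real_iff Reals_cnj_iff zero_complex.simps)

lemma psd_herm_on: "psd I X \<Longrightarrow> finite I \<Longrightarrow> herm_on I X"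
  unfolding herm_on_def by (intro ballI psd_hermitian)

lemma sqnorm_opow_le:
  assumes "finite I" "\<And>v. sqnorm I (app_op I B v) \<le> sqnorm I v"
  shows "sqnorm I (app_op I (opow I B k) v) \<le> sqnorm I v"
proof (induction k)
  case 0
  show ?case by (simp add: sqnorm_def app_idop assms(1))
next
  case (Suc k)
  show ?case
    using assms(2)[of "app_op I (opow I B k) v"] Suc by (simp add: app_opmult)
qed

lemma opow_entry_le:
  assumes "finite I" "\<And>v. sqnorm I (app_op I B v) \<le> sqnorm I v" "i \<in> I" "j \<in> I"
  shows "norm (opow I B k i j) \<le> 1"
proof -
  have "(norm (app_op I (opow I B k) (idop j) i))\<^sup>2 \<le> sqnorm I (app_op I (opow I B k) (idop j))"
    unfolding sqnorm_def by (rule member_le_sum) (use assms in auto)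
  also have "\<dots> \<le> 1"
    using sqnorm_opow_le[OF assms(1,2), where v="idop j"] assms by (simp add: sqnorm_unit)
  finally have "(norm (opow I B k i j))\<^sup>2 \<le> 1" using assms by (simp add: app_unit)
  then show ?thesis by (simp add: power_le_one_iff abs_square_le_1)
qed

text \<open>The coefficients of \<open>1 - sqrt (1 - x) = (\<Sum>n. sqrt_coeff n * x ^ Suc n)\<close>, the solution of
  \<open>y = (x + y\<^sup>2) / 2\<close>.\<close>
fun sqrt_coeff :: "nat \<Rightarrow> real" where
  "sqrt_coeff 0 = 1 / 2"
| "sqrt_coeff (Suc n) = (\<Sum>i\<le>n. sqrt_coeff i * sqrt_coeff (n - i)) / 2"

lemma sqrt_coeff_nonneg: "0 \<le> sqrt_coeff n"
proof (induction n rule: less_induct)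
  case (less n)
  then show ?case by (cases n) (auto intro!: sum_nonneg mult_nonneg_nonneg)
qed

text \<open>By the recursion, the next partial sum is 1/2 plus half a triangle of products. The
  triangle lies inside a square, so a partial sum s is followed by at most (1 + s^2) / 2, which does
  not pass the fixed point 1.\<close>

lemma sum_sqrt_coeff_le: "(\<Sum>i<n. sqrt_coeff i) \<le> 1"
proof (induction n)
  case (Suc n)
  have "(\<Sum>i<Suc n. sqrt_coeff i) = 1 / 2 + (\<Sum>m<n. \<Sum>i\<le>m. sqrt_coeff i * sqrt_coeff (m - i)) / 2"
    by (subst sum.lessThan_Suc_shift) (simp add: sum_divide_distrib)
  also have "(\<Sum>m<n. \<Sum>i\<le>m. sqrt_coeff i * sqrt_coeff (m - i))
      = (\<Sum>(i,j)\<in>{(i,j). i + j < n}. sqrt_coeff i * sqrt_coeff j)"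
    by (rule sum.triangle_reindex[symmetric])
  also have "\<dots> \<le> (\<Sum>(i,j)\<in>{..<n} \<times> {..<n}. sqrt_coeff i * sqrt_coeff j)"
    by (rule sum_mono2) (auto simp: sqrt_coeff_nonneg)
  also have "\<dots> = (\<Sum>i<n. sqrt_coeff i)\<^sup>2"
    by (simp add: power2_eq_square sum_product sum.cartesian_product)
  also have "\<dots> \<le> 1"
    using Suc by (intro power_le_one sum_nonneg) (auto simp: sqrt_coeff_nonneg)
  finally show ?case by simp
qed simp

lemma summable_sqrt_coeff: "summable sqrt_coeff"
  by (rule summableI_nonneg_bounded[where x=1]) (auto simp: sqrt_coeff_nonneg sum_sqrt_coeff_le)

lemma suminf_sqrt_coeff_le: "suminf sqrt_coeff \<le> 1"
  by (rule suminf_le_const[OF summable_sqrt_coeff sum_sqrt_coeff_le])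

text \<open>The root is \<open>Y = 1 - C\<close>, where \<open>C\<close> is the series of
  \<open>1 - sqrt (1 - x)\<close> at \<open>B = 1 - A\<close>. Since \<open>B\<close> is a
  contraction, its powers have entries of modulus at most 1 and the series converges absolutely
  entry by entry. The recursion for \<open>sqrt_coeff\<close> and the Cauchy product give
  \<open>C * C = 2 * C - B\<close>, that is \<open>Y * Y = A\<close>. Positivity of \<open>Y\<close>
  holds because each power of \<open>B\<close> has form at most \<open>sqnorm I v\<close> and the
  coefficients sum to at most 1.\<close>

lemma psd_root_exists_bounded:
  assumes fin: "finite I" and A: "psd I A" "psd I (\<lambda>i j. idop i j - A i j)"
  shows "\<exists>Y. psd I Y \<and> (\<forall>i\<in>I. \<forall>j\<in>I. opmult I Y Y i j = A i j)"
proof -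
  define B where "B = (\<lambda>i j. idop i j - A i j)"
  have B: "psd I B" "psd I (\<lambda>i j. idop i j - B i j)"
    using A by (simp_all add: B_def)
  have Bc: "sqnorm I (app_op I B v) \<le> sqnorm I v" for v
    using sqnorm_app_le_of_sesq[OF fin, of 1 B v] sesq_le_sqrt[OF B fin] by simp
  have hB: "herm_on I (opow I B k)" for k
    by (rule herm_on_opow[OF fin psd_herm_on[OF B(1) fin]])
  define t where "t = (\<lambda>i j n. of_real (sqrt_coeff n) * opow I B (Suc n) i j)"
  define C where "C = (\<lambda>i j. suminf (t i j))"
  have sn: "summable (\<lambda>n. norm (t i j n))" if "i \<in> I" "j \<in> I" for i j
  proof (rule summable_comparison_test[OF _ summable_sqrt_coeff], intro exI allI impI)
    fix n show "norm (norm (t i j n)) \<le> sqrt_coeff n"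
      using mult_left_mono[OF opow_entry_le[OF fin Bc that, of "Suc n"] sqrt_coeff_nonneg[of n]]
      by (simp only: t_def norm_mult norm_of_real) (simp add: sqrt_coeff_nonneg)
  qed
  have tC: "t i j sums C i j" if "i \<in> I" "j \<in> I" for i j
    unfolding C_def using summable_norm_cancel[OF sn[OF that]] by (rule summable_sums)
  have CC: "opmult I C C i k = 2 * C i k - B i k" if ik: "i \<in> I" "k \<in> I" for i k
  proof -
    have "(\<lambda>n. \<Sum>j\<in>I. \<Sum>m\<le>n. t i j m * t j k (n - m)) sums (\<Sum>j\<in>I. C i j * C j k)"
      unfolding C_def by (intro sums_sum Cauchy_product_sums sn ik)
    moreover have "(\<Sum>j\<in>I. \<Sum>m\<le>n. t i j m * t j k (n - m)) = 2 * t i k (Suc n)" for n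
    proof -
      have "(\<Sum>j\<in>I. \<Sum>m\<le>n. t i j m * t j k (n - m)) =
        (\<Sum>m\<le>n. of_real (sqrt_coeff m * sqrt_coeff (n - m)) * (\<Sum>j\<in>I. opow I B (Suc m) i j * opow I B (Suc (n - m)) j k))"
        by (subst sum.swap) (simp add: t_def sum_distrib_left mult_ac)
      also have "\<dots> = (\<Sum>m\<le>n. of_real (sqrt_coeff m * sqrt_coeff (n - m)) * opow I B (Suc (Suc n)) i k)"
      proof (rule sum.cong[OF refl])
        fix m assume "m \<in> {..n}"
        then have "Suc (Suc n) = Suc m + Suc (n - m)" by simp
        then show "of_real (sqrt_coeff m * sqrt_coeff (n - m)) * (\<Sum>j\<in>I. opow I B (Suc m) i j * opow I B (Suc (n - m)) j k)
           = of_real (sqrt_coeff m * sqrt_coeff (n - m)) * opow I B (Suc (Suc n)) i k"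
          by (metis opow_add[OF fin ik(1)] opmult_def)
      qed
      also have "\<dots> = of_real (\<Sum>m\<le>n. sqrt_coeff m * sqrt_coeff (n - m)) * opow I B (Suc (Suc n)) i k"
        by (simp only: of_real_sum sum_distrib_right)
      also have "\<dots> = 2 * t i k (Suc n)"
        by (simp only: t_def sqrt_coeff.simps) simp
      finally show ?thesis .
    qed
    ultimately have "(\<lambda>n. 2 * t i k (Suc n)) sums (\<Sum>j\<in>I. C i j * C j k)" by simp
    moreover have "(\<lambda>n. 2 * t i k (Suc n)) sums (2 * (C i k - t i k 0))"
      using tC[OF ik] by (intro sums_mult) (simp add: sums_Suc_iff)
    ultimately have "opmult I C C i k = 2 * (C i k - t i k 0)"
      unfolding opmult_def by (rule sums_unique2)
    also have "t i k 0 = B i k / 2"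
      using ik fin by (simp add: t_def opmult_idop_right)
    finally show ?thesis by (simp add: algebra_simps)
  qed
  define Y where "Y = (\<lambda>i j. idop i j - C i j)"
  have "herm_on I C" unfolding herm_on_def
  proof (intro ballI)
    fix i j assume ij: "i \<in> I" "j \<in> I"
    have "(\<lambda>n. cnj (t i j n)) sums cnj (C i j)" using tC[OF ij] by (simp only: sums_cnj)
    moreover have "cnj (t i j n) = t j i n" for n
    proof -
      have "opow I B (Suc n) j i = cnj (opow I B (Suc n) i j)"
        using hB[of "Suc n"] ij unfolding herm_on_def by blast
      then show ?thesis unfolding t_def by (simp only: complex_cnj_mult complex_cnj_complex_of_real)
    qed
    ultimately show "C j i = cnj (C i j)" using tC[OF ij(2,1)] sums_unique2 by fastforce
  qed
  then have hY: "herm_on I Y" unfolding Y_def by (rule herm_on_idop_diff)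
  have pY: "psd I Y"
  proof (rule psdI_herm[OF hY])
    fix v
    have "(\<lambda>n. \<Sum>i\<in>I. \<Sum>j\<in>I. cnj (v i) * t i j n * v j) sums sesq I C v v"
      unfolding sesq_def by (intro sums_sum sums_mult sums_mult2 tC)
    then have "(\<lambda>n. Re (\<Sum>i\<in>I. \<Sum>j\<in>I. cnj (v i) * t i j n * v j)) sums Re (sesq I C v v)"
      by (rule sums_Re)
    moreover have "(\<Sum>i\<in>I. \<Sum>j\<in>I. cnj (v i) * t i j n * v j) = of_real (sqrt_coeff n) * sesq I (opow I B (Suc n)) v v" for n
      unfolding sesq_def t_def by (simp add: sum_distrib_left mult_ac)
    ultimately have s1: "(\<lambda>n. sqrt_coeff n * Re (sesq I (opow I B (Suc n)) v v)) sums Re (sesq I C v v)"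
      by (simp del: opow.simps)
    have s2: "(\<lambda>n. sqrt_coeff n * sqnorm I v) sums (suminf sqrt_coeff * sqnorm I v)"
      by (intro sums_mult2 summable_sums summable_sqrt_coeff)
    have le: "Re (sesq I (opow I B k) v v) \<le> sqnorm I v" for k
    proof -
      have "(norm (sesq I (opow I B k) v v))\<^sup>2 \<le> sqnorm I v * sqnorm I (app_op I (opow I B k) v)"
        unfolding sesq_app by (rule norm_sesq_idop_le[OF fin])
      also have "\<dots> \<le> sqnorm I v * sqnorm I v"
        by (intro mult_left_mono sqnorm_opow_le fin Bc sqnorm_nonneg)
      finally have "norm (sesq I (opow I B k) v v) \<le> sqnorm I v"
        using power2_le_imp_le sqnorm_nonneg by (metis power2_eq_square)
      then show ?thesis using complex_Re_le_cmod order_trans by blast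
    qed
    have "Re (sesq I C v v) \<le> suminf sqrt_coeff * sqnorm I v"
      by (rule sums_le[OF _ s1 s2]) (intro mult_left_mono le sqrt_coeff_nonneg)
    also have "\<dots> \<le> sqnorm I v"
      using suminf_sqrt_coeff_le sqnorm_nonneg[of I v] by (simp add: mult_left_le_one_le suminf_nonneg summable_sqrt_coeff sqrt_coeff_nonneg)
    finally show "0 \<le> Re (sesq I Y v v)"
      by (simp add: Y_def sesq_op_diff sesq_idop_self fin)
  qed
  have "opmult I Y Y i j = A i j" if ij: "i \<in> I" "j \<in> I" for i j
  proof -
    have "opmult I Y Y i j = opmult I idop idop i j - opmult I idop C i j - opmult I C idop i j + opmult I C C i j"
      by (simp add: Y_def opmult_def algebra_simps sum.distrib sum_subtractf)
    also have "\<dots> = A i j"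
      using ij by (simp add: opmult_idop_left opmult_idop_right fin CC B_def)
    finally show ?thesis .
  qed
  then show ?thesis using pY by blast
qed

lemma psd_scale: "psd I X \<Longrightarrow> 0 \<le> c \<Longrightarrow> psd I (\<lambda>i j. of_real c * X i j)"
  unfolding psd_iff_sesq sesq_op_scale by (simp add: less_eq_complex_def)

lemma psd_cong: "(\<And>i j. i \<in> I \<Longrightarrow> j \<in> I \<Longrightarrow> X i j = Y i j) \<Longrightarrow> psd I X = psd I Y"
  unfolding psd_def by (simp cong: sum.cong)

lemma psd_root_exists:
  assumes fin: "finite I" and X: "psd I X"
  shows "\<exists>Y. supported I Y \<and> psd I Y \<and> (\<forall>i\<in>I. \<forall>j\<in>I. opmult I Y Y i j = X i j)"
proof -
  \<comment> \<open>The sum of the moduli of the entries bounds the form of \<open>X\<close>; the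
    added 1 keeps \<open>c\<close> positive when \<open>X\<close> vanishes.\<close>
  define c where "c = 1 + (\<Sum>i\<in>I. \<Sum>j\<in>I. norm (X i j))"
  have c: "0 < c" unfolding c_def by (simp add: add_pos_nonneg sum_nonneg)
  define A where "A = (\<lambda>i j. of_real (1 / c) * X i j)"
  have A: "psd I A" unfolding A_def using X c by (intro psd_scale) auto
  have "psd I (\<lambda>i j. idop i j - A i j)"
  proof (rule psdI_herm)
    show "herm_on I (\<lambda>i j. idop i j - A i j)"
      by (rule herm_on_idop_diff[OF psd_herm_on[OF A fin]])
    fix v
    have le1: "norm (v i) * norm (v j) \<le> sqnorm I v" if "i \<in> I" "j \<in> I" for i j
    proof -
      have m: "(norm (v k))\<^sup>2 \<le> sqnorm I v" if "k \<in> I" for k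
        unfolding sqnorm_def by (rule member_le_sum) (use that fin in auto)
      have "2 * (norm (v i) * norm (v j)) \<le> (norm (v i))\<^sup>2 + (norm (v j))\<^sup>2"
        using sum_squares_bound[of "norm (v i)" "norm (v j)"] by simp
      then show ?thesis using m[OF that(1)] m[OF that(2)] by simp
    qed
    have "Re (sesq I X v v) \<le> norm (sesq I X v v)" by (rule complex_Re_le_cmod)
    also have "\<dots> \<le> (\<Sum>i\<in>I. \<Sum>j\<in>I. norm (cnj (v i) * X i j * v j))"
      unfolding sesq_def by (intro order_trans[OF norm_sum] sum_mono) auto
    also have "\<dots> \<le> (\<Sum>i\<in>I. \<Sum>j\<in>I. norm (X i j) * sqnorm I v)"
    proof (intro sum_mono)
      fix i j assume "i \<in> I" "j \<in> I"
      then have "norm (X i j) * (norm (v i) * norm (v j)) \<le> norm (X i j) * sqnorm I v"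
        by (intro mult_left_mono le1) auto
      then show "norm (cnj (v i) * X i j * v j) \<le> norm (X i j) * sqnorm I v"
        by (simp add: norm_mult ac_simps)
    qed
    also have "\<dots> \<le> c * sqnorm I v"
      by (simp add: c_def algebra_simps sum_distrib_left sqnorm_nonneg)
    finally have "Re (sesq I A v v) \<le> sqnorm I v"
      using c unfolding A_def sesq_op_scale by (simp add: field_simps)
    then show "0 \<le> Re (sesq I (\<lambda>i j. idop i j - A i j) v v)"
      by (simp add: sesq_op_diff sesq_idop_self fin)
  qed
  from psd_root_exists_bounded[OF fin A this] obtain Z where
    Z: "psd I Z" "\<forall>i\<in>I. \<forall>j\<in>I. opmult I Z Z i j = A i j" by blast
  \<comment> \<open>Cut off outside of \<open>I\<close>, since \<open>sqrt_op\<close> singles out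
    the root among supported matrices only.\<close>
  define Y where "Y = (\<lambda>i j. if i \<in> I \<and> j \<in> I then of_real (sqrt c) * Z i j else 0)"
  have "psd I Y"
    using psd_scale[OF Z(1), of "sqrt c"] c by (simp add: Y_def cong: psd_cong)
  moreover have "supported I Y" by (auto simp: supported_def Y_def)
  moreover have "opmult I Y Y i j = X i j" if "i \<in> I" "j \<in> I" for i j
  proof -
    have "opmult I Y Y i j = of_real (sqrt c * sqrt c) * opmult I Z Z i j"
      using that unfolding opmult_def Y_def sum_distrib_left by (intro sum.cong refl) (simp only: of_real_mult mult_ac if_True simp_thms)
    also have "\<dots> = X i j"
      using Z(2) that c by (simp add: A_def flip: of_real_mult)
    finally show ?thesis .
  qed
  ultimately show ?thesis by blast
qed

lemma psd_gram: "finite I \<Longrightarrow> finite R \<Longrightarrow> psd I (\<lambda>i j. \<Sum>r\<in>R. T r i * cnj (T r j))"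
proof -
  assume fin: "finite I" "finite R"
  have "sesq I (\<lambda>i j. \<Sum>r\<in>R. T r i * cnj (T r j)) v v = (\<Sum>r\<in>R. of_real ((norm (\<Sum>i\<in>I. cnj (v i) * T r i))\<^sup>2))" for v
    unfolding sesq_op_sum
  proof (rule sum.cong[OF refl])
    fix r
    have "of_real ((norm (\<Sum>i\<in>I. cnj (v i) * T r i))\<^sup>2) = (\<Sum>i\<in>I. cnj (v i) * T r i) * (\<Sum>j\<in>I. v j * cnj (T r j))"
      unfolding complex_norm_square by simp
    also have "\<dots> = sesq I (\<lambda>i j. T r i * cnj (T r j)) v v"
      unfolding sesq_def sum_product by (simp only: mult_ac)
    finally show "sesq I (\<lambda>i j. T r i * cnj (T r j)) v v = of_real ((norm (\<Sum>i\<in>I. cnj (v i) * T r i))\<^sup>2)" by simp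
  qed
  then show ?thesis
    by (auto simp: psd_iff_sesq less_eq_complex_def intro!: sum_nonneg simp flip: of_real_sum simp del: of_real_power)
qed

text \<open>The columns of a hermitian root of \<open>X\<close> are Gram vectors. With them,
  positivity of products and of reindexed kernels becomes plain algebra.\<close>

lemma psd_gram_exists:
  assumes "finite I" "psd I X"
  obtains T where "\<And>i j. i \<in> I \<Longrightarrow> j \<in> I \<Longrightarrow> X i j = (\<Sum>r\<in>I. T r i * cnj (T r j))"
proof -
  from psd_root_exists[OF assms] obtain Y where
    Y: "psd I Y" "\<forall>i\<in>I. \<forall>j\<in>I. opmult I Y Y i j = X i j" by blast
  have "X i j = (\<Sum>r\<in>I. Y i r * cnj (Y j r))" if "i \<in> I" "j \<in> I" for i j
  proof -
    have "X i j = (\<Sum>r\<in>I. Y i r * Y r j)" using Y that by (simp add: opmult_def)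
    also have "\<dots> = (\<Sum>r\<in>I. Y i r * cnj (Y j r))"
    proof (rule sum.cong[OF refl])
      fix r assume "r \<in> I"
      then show "Y i r * Y r j = Y i r * cnj (Y j r)"
        using psd_hermitian[OF Y(1) assms(1) that(2), of r] by (simp only: )
    qed
    finally show ?thesis .
  qed
  then show ?thesis by (intro that[of "\<lambda>r i. Y i r"])
qed

text \<open>Let \<open>D = Y - Z\<close>. Equal squares give \<open>Y D = - D Z\<close>, hence tr(D
  Y D) + tr(D Z D) = 0. Both traces are sums of nonnegative forms, so every column of
  \<open>D\<close> is a null vector of \<open>Y\<close> and of \<open>Z\<close>, and lies in both
  kernels. Then \<open>D D = Y D - Z D = 0\<close>, and \<open>D\<close> vanishes on
  \<open>I\<close> because it is hermitian.\<close>

lemma psd_root_unique: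
  assumes fin: "finite I" and Y: "psd I Y" "supported I Y" and Z: "psd I Z" "supported I Z"
    and eq: "\<And>i j. i \<in> I \<Longrightarrow> j \<in> I \<Longrightarrow> opmult I Y Y i j = opmult I Z Z i j"
  shows "Y = Z"
proof -
  define D where "D = (\<lambda>i j. Y i j - Z i j)"
  have hD: "cnj (D j i) = D i j" if "i \<in> I" "j \<in> I" for i j
    unfolding D_def complex_cnj_diff
    using psd_hermitian[OF Y(1) fin that(2,1)] psd_hermitian[OF Z(1) fin that(2,1)] by (simp only:)
  have anti: "opmult I Y D j k = - opmult I D Z j k" if "j \<in> I" "k \<in> I" for j k
    using eq[OF that] by (simp add: opmult_def D_def algebra_simps sum_subtractf)
  let ?d = "\<lambda>i k. D k i"
  have sq: "sesq I X (?d i) (?d i) = (\<Sum>j\<in>I. D i j * opmult I X D j i)" if "i \<in> I" for X i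
    unfolding sesq_def opmult_def sum_distrib_left
    by (intro sum.cong refl) (simp add: hD that mult_ac)
  have "(\<Sum>i\<in>I. sesq I Y (?d i) (?d i)) = (\<Sum>i\<in>I. \<Sum>j\<in>I. D i j * opmult I Y D j i)"
    by (intro sum.cong refl sq)
  also have "\<dots> = - (\<Sum>i\<in>I. \<Sum>j\<in>I. \<Sum>k\<in>I. D i j * D j k * Z k i)"
    unfolding sum_negf[symmetric] by (intro sum.cong refl) (simp only: anti, simp add: opmult_def sum_distrib_left mult.assoc sum_negf)
  also have "(\<Sum>i\<in>I. \<Sum>j\<in>I. \<Sum>k\<in>I. D i j * D j k * Z k i) = (\<Sum>j\<in>I. \<Sum>i\<in>I. \<Sum>k\<in>I. D i j * D j k * Z k i)"
    by (rule sum.swap)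
  also have "\<dots> = (\<Sum>j\<in>I. \<Sum>k\<in>I. \<Sum>i\<in>I. D i j * D j k * Z k i)"
    by (intro sum.cong refl sum.swap)
  also have "\<dots> = (\<Sum>j\<in>I. sesq I Z (?d j) (?d j))"
    by (intro sum.cong refl) (simp add: sq opmult_def sum_distrib_left mult_ac)
  finally have "(\<Sum>i\<in>I. sesq I Y (?d i) (?d i) + sesq I Z (?d i) (?d i)) = 0"
    by (simp add: sum.distrib)
  moreover have nn: "0 \<le> sesq I Y v v" "0 \<le> sesq I Z v v" for v
    using Y(1) Z(1) by (auto simp: psd_iff_sesq)
  ultimately have z: "sesq I Y (?d i) (?d i) + sesq I Z (?d i) (?d i) = 0" if "i \<in> I" for i
    using that fin by (subst (asm) sum_nonneg_eq_0_iff) (auto intro: add_nonneg_nonneg)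
  have z2: "sesq I Y (?d i) (?d i) = 0" "sesq I Z (?d i) (?d i) = 0" if "i \<in> I" for i
    using z[OF that] add_nonneg_eq_0_iff nn by blast+
  have "D k i = 0" if ik: "i \<in> I" "k \<in> I" for i k
  proof -
    have "(\<Sum>k\<in>I. D i k * D k i) = app_op I Y (?d i) i - app_op I Z (?d i) i"
      unfolding app_op_def sum_subtractf[symmetric]
      by (intro sum.cong refl) (simp add: D_def algebra_simps)
    also have "\<dots> = 0"
      using psd_kernel[OF Y(1) fin z2(1)] psd_kernel[OF Z(1) fin z2(2)] ik by simp
    also have "(\<Sum>k\<in>I. D i k * D k i) = (\<Sum>k\<in>I. of_real ((norm (D k i))\<^sup>2))"
      unfolding complex_norm_square using hD ik by (intro sum.cong refl) (simp add: mult.commute)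
    finally have "(\<Sum>k\<in>I. (norm (D k i))\<^sup>2) = 0"
      by (simp only: of_real_sum[symmetric] of_real_eq_0_iff)
    then show ?thesis using ik fin by (simp add: sum_nonneg_eq_0_iff)
  qed
  then have 1: "Y k i = Z k i" if "i \<in> I" "k \<in> I" for i k using that by (simp add: D_def)
  have 2: "Y k i = Z k i" if "\<not> (k \<in> I \<and> i \<in> I)" for i k
    using that Y(2) Z(2) by (simp add: supported_def)
  show ?thesis
  proof (intro ext)
    fix k i show "Y k i = Z k i" using 1[of i k] 2[of k i] by argo
  qed
qed

section \<open>Fidelity with a pure state\<close>

lemma sqrt_op_eqI:
  assumes "finite I" "supported I Y" "psd I Y" "\<And>i j. i \<in> I \<Longrightarrow> j \<in> I \<Longrightarrow> opmult I Y Y i j = X i j"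
  shows "sqrt_op I X = Y"
  unfolding sqrt_op_def
  using assms by (intro the_equality) (auto intro!: psd_root_unique[OF assms(1)])

lemma psd_rank_one: "finite I \<Longrightarrow> psd I (\<lambda>i j. w i * cnj (w j))"
  using psd_gram[of I "{()}" "\<lambda>_. w"] by simp

lemma sqrt_op_works:
  assumes "finite I" "psd I X"
  shows "supported I (sqrt_op I X)" "psd I (sqrt_op I X)"
    "\<And>i j. i \<in> I \<Longrightarrow> j \<in> I \<Longrightarrow> opmult I (sqrt_op I X) (sqrt_op I X) i j = X i j"
proof -
  from psd_root_exists[OF assms] obtain Y where
    Y: "supported I Y" "psd I Y" "\<And>i j. i \<in> I \<Longrightarrow> j \<in> I \<Longrightarrow> opmult I Y Y i j = X i j" by blast
  then have "sqrt_op I X = Y" by (intro sqrt_op_eqI assms)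
  then show "supported I (sqrt_op I X)" "psd I (sqrt_op I X)"
    "\<And>i j. i \<in> I \<Longrightarrow> j \<in> I \<Longrightarrow> opmult I (sqrt_op I X) (sqrt_op I X) i j = X i j"
    using Y by auto
qed

lemma opmult_rank_one:
  assumes "finite I"
  shows "opmult I (\<lambda>i j. w i * cnj (w j)) (\<lambda>i j. w i * cnj (w j)) i j = of_real (sqnorm I w) * (w i * cnj (w j))"
proof -
  have "opmult I (\<lambda>i j. w i * cnj (w j)) (\<lambda>i j. w i * cnj (w j)) i j = (\<Sum>k\<in>I. cnj (w k) * w k) * (w i * cnj (w j))"
    by (simp add: opmult_def sum_distrib_right sum_distrib_left mult_ac)
  then show ?thesis using sesq_idop_self[OF assms, of w] sesq_idop[OF assms, of w w] by simp
qed

lemma trace_sqrt_rank_one: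
  assumes fin: "finite I" and X: "\<And>i j. i \<in> I \<Longrightarrow> j \<in> I \<Longrightarrow> X i j = w i * cnj (w j)"
  shows "tr I (sqrt_op I X) = of_real (sqrt (sqnorm I w))"
proof -
  define s where "s = sqnorm I w"
  have s: "0 \<le> s" by (simp add: s_def sqnorm_nonneg)
  \<comment> \<open>The root of \<open>w w^*\<close> is \<open>w w^*\<close> divided by the norm of
    \<open>w\<close>. If \<open>s = 0\<close>, the quotient is 0 by convention, which is still right
    because \<open>w\<close> vanishes on \<open>I\<close>.\<close>
  define Y where "Y = (\<lambda>i j. if i \<in> I \<and> j \<in> I then of_real (1 / sqrt s) * (w i * cnj (w j)) else 0)"
  have "sqrt_op I X = Y"
  proof (rule sqrt_op_eqI[OF fin])
    show "supported I Y" by (auto simp: supported_def Y_def)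
    show "psd I Y"
      using psd_scale[OF psd_rank_one[OF fin, of w], of "1 / sqrt s"] s
      by (simp add: Y_def cong: psd_cong)
    fix i j assume ij: "i \<in> I" "j \<in> I"
    have "opmult I Y Y i j = of_real (1 / sqrt s * (1 / sqrt s)) * opmult I (\<lambda>i j. w i * cnj (w j)) (\<lambda>i j. w i * cnj (w j)) i j"
      unfolding opmult_def sum_distrib_left Y_def of_real_mult using ij by (intro sum.cong refl) (simp only: mult_ac if_True simp_thms)
    also have "\<dots> = of_real (1 / sqrt s * (1 / sqrt s) * s) * (w i * cnj (w j))"
      unfolding opmult_rank_one[OF fin] s_def by (simp only: of_real_mult mult_ac)
    also have "\<dots> = w i * cnj (w j)"
    proof (cases "s = 0")
      case True
      then have "w i = 0" using ij fin unfolding s_def sqnorm_def by (simp add: sum_nonneg_eq_0_iff)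
      then show ?thesis by simp
    next
      case False
      then show ?thesis using s by (simp add: field_simps flip: of_real_mult)
    qed
    finally show "opmult I Y Y i j = X i j" using X ij by simp
  qed
  then have "tr I (sqrt_op I X) = of_real (1 / sqrt s) * (\<Sum>i\<in>I. cnj (w i) * w i)"
    by (simp add: tr_def Y_def sum_distrib_left mult_ac)
  also have "(\<Sum>i\<in>I. cnj (w i) * w i) = of_real s"
    using sesq_idop_self[OF fin, of w] sesq_idop[OF fin, of w w] s_def by simp
  also have "of_real (1 / sqrt s) * of_real s = complex_of_real (sqrt s)"
    unfolding of_real_mult[symmetric] using s by (simp add: real_div_sqrt)
  finally show ?thesis by (simp add: s_def)
qed

text \<open>The projection onto \<open>\<phi>\<close> is its own root. With \<open>w\<close> the
  image of \<open>\<phi>\<close> under the root of \<open>\<sigma>\<close>, the product of the roots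
  is \<open>\<phi> w^*\<close>, whose trace norm is the norm of \<open>w\<close>; the square of that
  norm is the form of \<open>\<sigma>\<close> at \<open>\<phi>\<close>. The square roots disappear
  and linearity in \<open>\<sigma>\<close> remains.\<close>

lemma fidelity_pure:
  assumes fin: "finite I" and \<sigma>: "psd I \<sigma>" and \<phi>: "sqnorm I \<phi> = 1" "\<And>i. i \<notin> I \<Longrightarrow> \<phi> i = 0"
  shows "fidelity I (\<lambda>i j. \<phi> i * cnj (\<phi> j)) \<sigma> = Re (sesq I \<sigma> \<phi> \<phi>)"
proof -
  let ?\<rho> = "\<lambda>i j. \<phi> i * cnj (\<phi> j)"
  define S where "S = sqrt_op I \<sigma>"
  note S = sqrt_op_works[OF fin \<sigma>, folded S_def]
  have \<rho>: "sqrt_op I ?\<rho> = ?\<rho>"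
    by (rule sqrt_op_eqI[OF fin]) (auto simp: supported_def \<phi> psd_rank_one fin opmult_rank_one)
  define w where "w = app_op I S \<phi>"
  define X where "X = opmult I ?\<rho> S"
  have Xe: "X j k = \<phi> j * cnj (w k)" if "k \<in> I" for j k
  proof -
    have "cnj (w k) = (\<Sum>l\<in>I. cnj (S k l) * cnj (\<phi> l))" by (simp add: w_def app_op_def)
    also have "\<dots> = (\<Sum>l\<in>I. S l k * cnj (\<phi> l))"
    proof (intro sum.cong refl)
      fix l assume "l \<in> I"
      then have "S l k = cnj (S k l)" using psd_hermitian[OF S(2) fin that] by simp
      then show "cnj (S k l) * cnj (\<phi> l) = S l k * cnj (\<phi> l)" by (simp only:)
    qed
    finally show ?thesis by (simp add: X_def opmult_def sum_distrib_left mult_ac)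
  qed
  have XX: "opmult I (adj X) X i k = w i * cnj (w k)" if "i \<in> I" "k \<in> I" for i k
  proof -
    have "opmult I (adj X) X i k = w i * cnj (w k) * (\<Sum>j\<in>I. cnj (\<phi> j) * \<phi> j)"
      using that by (simp add: opmult_def adj_def Xe sum_distrib_left mult_ac)
    also have "(\<Sum>j\<in>I. cnj (\<phi> j) * \<phi> j) = 1"
      using sesq_idop_self[OF fin, of \<phi>] sesq_idop[OF fin, of \<phi> \<phi>] \<phi> by simp
    finally show ?thesis by simp
  qed
  have "fidelity I ?\<rho> \<sigma> = (Re (tr I (sqrt_op I (opmult I (adj X) X))))\<^sup>2"
    unfolding fidelity_def trace_norm_def \<rho> X_def S_def ..
  also have "\<dots> = sqnorm I w"
    using trace_sqrt_rank_one[of I "opmult I (adj X) X" w, OF fin XX] by (simp add: sqnorm_nonneg)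
  also have "of_real (sqnorm I w) = sesq I \<sigma> \<phi> \<phi>"
  proof -
    have "complex_of_real (sqnorm I w) = (\<Sum>k\<in>I. cnj (w k) * w k)"
      using sesq_idop_self[OF fin, of w] sesq_idop[OF fin, of w w] by simp
    also have "\<dots> = cnj (sesq I S w \<phi>)"
      by (simp add: sesq_app w_def[symmetric] mult.commute)
    also have "\<dots> = sesq I S \<phi> w" by (rule psd_sesq_sym[OF S(2), symmetric])
    also have "\<dots> = (\<Sum>i\<in>I. cnj (\<phi> i) * app_op I (opmult I S S) \<phi> i)"
      unfolding sesq_app app_opmult w_def ..
    also have "\<dots> = sesq I (opmult I S S) \<phi> \<phi>" by (simp add: sesq_app)
    also have "\<dots> = sesq I \<sigma> \<phi> \<phi>"
      unfolding sesq_def by (intro sum.cong refl) (simp add: S(3))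
    finally show ?thesis .
  qed
  then have "sqnorm I w = Re (sesq I \<sigma> \<phi> \<phi>)" by (metis Re_complex_of_real)
  finally show ?thesis .
qed

section \<open>Closure properties of positive kernels\<close>

lemma psd_sum:
  assumes "\<And>r. r \<in> R \<Longrightarrow> psd I (X r)"
  shows "psd I (\<lambda>i j. \<Sum>r\<in>R. X r i j)"
  using assms unfolding psd_iff_sesq sesq_op_sum by (auto intro: sum_nonneg)

text \<open>Gram vectors can be pulled back along any map, injective or not. Relabelling,
  restricting to a slice and ignoring some of the indices are all instances.\<close>

lemma psd_pullback:
  assumes "finite S" "finite T" "psd T K" "f ` S \<subseteq> T"
  shows "psd S (\<lambda>x y. K (f x) (f y))"
proof -
  from psd_gram_exists[OF assms(2,3)] obtain G where
    G: "\<And>i j. i \<in> T \<Longrightarrow> j \<in> T \<Longrightarrow> K i j = (\<Sum>r\<in>T. G r i * cnj (G r j))" by blast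
  have "psd S (\<lambda>x y. \<Sum>r\<in>T. G r (f x) * cnj (G r (f y)))"
    by (rule psd_gram[OF assms(1,2), where T="\<lambda>r x. G r (f x)"])
  moreover have "psd S (\<lambda>x y. \<Sum>r\<in>T. G r (f x) * cnj (G r (f y))) = psd S (\<lambda>x y. K (f x) (f y))"
  proof (rule psd_cong)
    fix i j assume "i \<in> S" "j \<in> S"
    then have "f i \<in> T" "f j \<in> T" using assms(4) by auto
    from G[OF this] show "(\<Sum>r\<in>T. G r (f i) * cnj (G r (f j))) = K (f i) (f j)" by simp
  qed
  ultimately show ?thesis by simp
qed

text \<open>Schur's product theorem: the products of the Gram vectors of the two factors are Gram
  vectors of the entrywise product.\<close>

lemma psd_schur:
  assumes "finite I" "psd I X" "psd I Y"
  shows "psd I (\<lambda>i j. X i j * Y i j)"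
proof -
  from psd_gram_exists[OF assms(1,2)] obtain G where
    G: "\<And>i j. i \<in> I \<Longrightarrow> j \<in> I \<Longrightarrow> X i j = (\<Sum>r\<in>I. G r i * cnj (G r j))" by blast
  from psd_gram_exists[OF assms(1,3)] obtain H where
    H: "\<And>i j. i \<in> I \<Longrightarrow> j \<in> I \<Longrightarrow> Y i j = (\<Sum>r\<in>I. H r i * cnj (H r j))" by blast
  have "psd I (\<lambda>i j. \<Sum>p\<in>I\<times>I. (G (fst p) i * H (snd p) i) * cnj (G (fst p) j * H (snd p) j))"
    using psd_gram[of I "I \<times> I" "\<lambda>p i. G (fst p) i * H (snd p) i"] assms(1) by simp
  moreover have "psd I (\<lambda>i j. \<Sum>p\<in>I\<times>I. (G (fst p) i * H (snd p) i) * cnj (G (fst p) j * H (snd p) j))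
     = psd I (\<lambda>i j. X i j * Y i j)"
    by (rule psd_cong) (simp add: G H sum_product sum.cartesian_product split_def mult_ac)
  ultimately show ?thesis by simp
qed

lemma psd_one: "finite I \<Longrightarrow> psd I (\<lambda>i j. 1)"
  using psd_rank_one[of I "\<lambda>_. 1"] by simp

lemma psd_prod:
  assumes "finite I" "finite R" "\<And>r. r \<in> R \<Longrightarrow> psd I (X r)"
  shows "psd I (\<lambda>i j. \<Prod>r\<in>R. X r i j)"
  using assms(2,3)
proof (induction R rule: finite_induct)
  case empty
  then show ?case by (simp add: psd_one assms(1))
next
  case (insert r R)
  then show ?case using psd_schur[OF assms(1), of "X r"] by simp
qed

text \<open>Summing out both copies of \<open>Q\<close> evaluates the form at vectors that are
  constant in \<open>Q\<close>. Combined with \<open>psd_schur\<close> this composes maps given by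
  their kernels.\<close>

lemma psd_contract:
  assumes "finite S" "finite Q" "psd (S \<times> Q) K"
  shows "psd S (\<lambda>x y. \<Sum>p\<in>Q. \<Sum>q\<in>Q. K (x, p) (y, q))"
proof -
  have "sesq S (\<lambda>x y. \<Sum>p\<in>Q. \<Sum>q\<in>Q. K (x, p) (y, q)) v v = sesq (S \<times> Q) K (v \<circ> fst) (v \<circ> fst)" for v
  proof -
    have "sesq S (\<lambda>x y. \<Sum>p\<in>Q. \<Sum>q\<in>Q. K (x, p) (y, q)) v v
      = (\<Sum>x\<in>S. \<Sum>y\<in>S. \<Sum>p\<in>Q. \<Sum>q\<in>Q. cnj (v x) * K (x, p) (y, q) * v y)"
      by (simp only: sesq_def sum_distrib_left sum_distrib_right)
    also have "\<dots> = (\<Sum>x\<in>S. \<Sum>p\<in>Q. \<Sum>y\<in>S. \<Sum>q\<in>Q. cnj (v x) * K (x, p) (y, q) * v y)"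
      by (intro sum.cong refl sum.swap)
    also have "\<dots> = sesq (S \<times> Q) K (v \<circ> fst) (v \<circ> fst)"
      by (simp add: sesq_def sum.cartesian_product')
    finally show ?thesis .
  qed
  then show ?thesis using assms(3) by (simp add: psd_iff_sesq)
qed

text \<open>Bilinear, so this is tr(\<sigma> X^T) rather than the trace of the product. It matches
  the way kernels are contracted here, and positivity is preserved by the transpose.\<close>

definition pairing :: "'i set \<Rightarrow> 'i cop \<Rightarrow> 'i cop \<Rightarrow> complex" where
  "pairing I \<sigma> X = (\<Sum>i\<in>I. \<Sum>j\<in>I. \<sigma> i j * X i j)"

lemma pairing_nonneg:
  assumes "finite I" "psd I \<sigma>" "psd I X"
  shows "0 \<le> pairing I \<sigma> X"
proof -
  have "pairing I \<sigma> X = sesq I (\<lambda>i j. \<sigma> i j * X i j) (\<lambda>_. 1) (\<lambda>_. 1)"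
    by (simp add: pairing_def sesq_def)
  then show ?thesis using psd_schur[OF assms] by (simp add: psd_iff_sesq)
qed

lemma pairing_idop: "finite I \<Longrightarrow> pairing I \<sigma> idop = tr I \<sigma>"
  by (simp add: pairing_def idop_def tr_def if_distrib[of "\<lambda>x. _ * x"] cong: if_cong)

lemma pairing_diff: "pairing I \<sigma> (\<lambda>i j. X i j - Y i j) = pairing I \<sigma> X - pairing I \<sigma> Y"
  by (simp add: pairing_def algebra_simps sum_subtractf)

lemma pairing_add: "pairing I \<sigma> (\<lambda>i j. X i j + Y i j) = pairing I \<sigma> X + pairing I \<sigma> Y"
  by (simp add: pairing_def algebra_simps sum.distrib)

lemma pairing_scale: "pairing I \<sigma> (\<lambda>i j. c * X i j) = c * pairing I \<sigma> X"
  by (simp add: pairing_def sum_distrib_left mult_ac)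

lemma pairing_sum: "pairing I \<sigma> (\<lambda>i j. \<Sum>r\<in>R. X r i j) = (\<Sum>r\<in>R. pairing I \<sigma> (X r))"
  unfolding pairing_def sum_distrib_left by (rule sum_rotate)

lemma sesq_eq_pairing: "sesq I X v v = pairing I (\<lambda>i j. cnj (v i) * v j) X"
  by (simp add: sesq_def pairing_def mult_ac)

lemma psd_rank_one_cnj: "finite I \<Longrightarrow> psd I (\<lambda>i j. cnj (v i) * v j)"
  using psd_rank_one[of I "\<lambda>i. cnj (v i)"] by simp

text \<open>Self-duality of the positive cone; rank-one kernels already recover the form.\<close>

lemma psd_of_pairing:
  assumes "finite I" "\<And>\<sigma>. psd I \<sigma> \<Longrightarrow> 0 \<le> pairing I \<sigma> X"
  shows "psd I X"
  unfolding psd_iff_sesq sesq_eq_pairing using assms by (auto intro: psd_rank_one_cnj)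

text \<open>The forms at the differences of two basis vectors are nonnegative; adding them over all
  pairs gives the claim. This is the inequality that compares the transmission of entanglement with
  the transmission of basis states.\<close>

lemma psd_sum_entries_le:
  assumes "psd I G" "finite I"
  shows "(\<Sum>i\<in>I. \<Sum>j\<in>I. G i j) \<le> of_nat (card I) * (\<Sum>i\<in>I. G i i)"
proof -
  have "0 \<le> (\<Sum>i\<in>I. \<Sum>j\<in>I. G i i - G i j - G j i + G j j)"
  proof (intro sum_nonneg)
    fix i j assume ij: "i \<in> I" "j \<in> I"
    have "sesq I G (\<lambda>k. idop i k + (-1) * idop j k) (\<lambda>k. idop i k + (-1) * idop j k) = G i i - G i j - G j i + G j j"
      unfolding sesq_left sesq_right using ij assms(2) by (simp add: sesq_unit)
    then show "0 \<le> G i i - G i j - G j i + G j j"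
      using assms(1)[unfolded psd_iff_sesq, rule_format, of "\<lambda>k. idop i k + (-1) * idop j k"] by (simp only:)
  qed
  also have "\<dots> = 2 * (of_nat (card I) * (\<Sum>i\<in>I. G i i) - (\<Sum>i\<in>I. \<Sum>j\<in>I. G i j))"
    using sum.swap[of "\<lambda>i j. G j i" I I]
    by (simp add: sum.distrib sum_subtractf sum_distrib_left[symmetric] algebra_simps)
      (simp add: sum_distrib_left mult.commute)
  finally show ?thesis by (simp add: less_eq_complex_def)
qed

section \<open>Choi matrices\<close>

definition choi :: "('i cop \<Rightarrow> 'k cop) \<Rightarrow> ('i \<times> 'k) cop" where
  "choi \<Phi> = (\<lambda>(i, k) (j, l). \<Phi> (eunit i j) k l)"

text \<open>Complete positivity is tested with ancillas \<open>{0..<d}\<close>. For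
  \<open>d = card I\<close> and an enumeration \<open>e\<close> of \<open>I\<close>, the
  unnormalized maximally entangled vector along \<open>e\<close> is mapped to the Choi matrix, up to
  relabelling by \<open>e\<close>.\<close>

lemma choi_psd:
  assumes cp: "completely_positive I J \<Phi>" and fin: "finite I" "finite J"
  shows "psd (I \<times> J) (choi \<Phi>)"
proof -
  obtain e where e: "bij_betw e {0..<card I} I"
    using ex_bij_betw_nat_finite[OF fin(1)] by blast
  define X :: "(nat \<times> 'a) cop" where "X = (\<lambda>p q. (if snd p = e (fst p) then 1 else 0) * cnj (if snd q = e (fst q) then 1 else 0))"
  have "psd ({0..<card I} \<times> I) X"
    unfolding X_def by (rule psd_rank_one) (use fin in auto)
  then have p: "psd ({0..<card I} \<times> J) (id_tensor \<Phi> X)"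
    using cp unfolding completely_positive_def by blast
  have X: "(\<lambda>i j. X (a, i) (b, j)) = eunit (e a) (e b)" for a b
    by (auto simp: X_def eunit_def fun_eq_iff)
  let ?f = "\<lambda>p. (inv_into {0..<card I} e (fst p), snd p)"
  have inv: "inv_into {0..<card I} e i < card I" "e (inv_into {0..<card I} e i) = i" if "i \<in> I" for i
    using that e by (metis atLeastLessThan_iff bij_betw_imp_surj_on inv_into_into, metis bij_betw_inv_into_right)
  have "psd (I \<times> J) (\<lambda>p q. id_tensor \<Phi> X (?f p) (?f q))"
    by (rule psd_pullback[OF _ _ p]) (use fin inv in auto)
  moreover have "psd (I \<times> J) (\<lambda>p q. id_tensor \<Phi> X (?f p) (?f q)) = psd (I \<times> J) (choi \<Phi>)"
    by (rule psd_cong) (auto simp: id_tensor_def choi_def X inv)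
  ultimately show ?thesis by simp
qed

lemma linmap_apply:
  assumes "linmap I J \<Phi>" "k \<in> J" "l \<in> J"
  shows "\<Phi> X k l = (\<Sum>i\<in>I. \<Sum>j\<in>I. X i j * \<Phi> (eunit i j) k l)"
  using assms(2,3) by (subst spec[OF spec[OF spec[OF assms(1)[unfolded linmap_def]]], of X k l]) (simp only: if_True simp_thms)

lemma linmap_outside:
  assumes "linmap I J \<Phi>" "\<not> (k \<in> J \<and> l \<in> J)"
  shows "\<Phi> X k l = 0"
  using assms(2) by (subst spec[OF spec[OF spec[OF assms(1)[unfolded linmap_def]]], of X k l]) (simp only: if_False)

text \<open>The output with an ancilla is the Schur product of the input and the Choi matrix, both
  pulled back to a common index set, contracted over the input index.\<close>

lemma completely_positive_of_choi:
  assumes lin: "linmap I J \<Phi>" and p: "psd (I \<times> J) (choi \<Phi>)" and fin: "finite I" "finite J"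
  shows "completely_positive I J \<Phi>"
  unfolding completely_positive_def
proof (intro conjI allI impI lin)
  fix d and X :: "(nat \<times> 'a) cop"
  assume X: "psd ({0..<d} \<times> I) X"
  let ?S = "{0..<d} \<times> J"
  let ?K = "\<lambda>p q. X (fst (fst p), snd p) (fst (fst q), snd q) * choi \<Phi> (snd p, snd (fst p)) (snd q, snd (fst q))"
  have "psd (?S \<times> I) ?K"
    by (intro psd_schur psd_pullback[OF _ _ X, where f="\<lambda>p. (fst (fst p), snd p)"]
        psd_pullback[OF _ _ p, where f="\<lambda>p. (snd p, snd (fst p))"]) (use fin in auto)
  then have "psd ?S (\<lambda>x y. \<Sum>p\<in>I. \<Sum>q\<in>I. ?K (x, p) (y, q))"
    by (rule psd_contract[rotated 2]) (use fin in auto)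
  moreover have "psd ?S (\<lambda>x y. \<Sum>p\<in>I. \<Sum>q\<in>I. ?K (x, p) (y, q)) = psd ?S (id_tensor \<Phi> X)"
  proof (rule psd_cong)
    fix x y assume "x \<in> ?S" "y \<in> ?S"
    then obtain a k b l where xy: "x = (a, k)" "y = (b, l)" "k \<in> J" "l \<in> J" by auto
    have "\<Phi> (\<lambda>i j. X (a, i) (b, j)) k l = (\<Sum>i\<in>I. \<Sum>j\<in>I. X (a, i) (b, j) * \<Phi> (eunit i j) k l)"
      by (rule linmap_apply[OF lin xy(3,4)])
    then show "(\<Sum>p\<in>I. \<Sum>q\<in>I. ?K (x, p) (y, q)) = id_tensor \<Phi> X x y"
      by (simp add: xy id_tensor_def choi_def)
  qed
  ultimately show "psd ({0..<d} \<times> J) (id_tensor \<Phi> X)" by simp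
qed

section \<open>Jammed channels\<close>

lemma finite_nlists: "finite S \<Longrightarrow> finite (nlists n S)"
  using finite_lists_length_eq[of S n] by (simp add: nlists_def conj_commute)

lemma nlists_0: "nlists 0 S = {[]}"
  by (auto simp: nlists_def)

lemma in_nlists_UNIV: "xs \<in> nlists n UNIV \<longleftrightarrow> length xs = n"
  by (simp add: nlists_def)

lemma sum_nlists_Suc:
  "(\<Sum>xs\<in>nlists (Suc n) S. f xs) = (\<Sum>x\<in>S. \<Sum>xs\<in>nlists n S. f (x # xs))"
proof -
  have "(\<Sum>xs\<in>nlists (Suc n) S. f xs) = (\<Sum>p\<in>S \<times> nlists n S. f (fst p # snd p))"
    by (rule sum.reindex_bij_witness[where i="\<lambda>p. fst p # snd p" and j="\<lambda>xs. (hd xs, tl xs)"])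
      (auto simp: nlists_def length_Suc_conv)
  then show ?thesis by (simp add: sum.cartesian_product')
qed

lemma sum_nlists_append:
  "(\<Sum>xs\<in>nlists (k + l) S. f xs) = (\<Sum>xs\<in>nlists k S. \<Sum>ys\<in>nlists l S. f (xs @ ys))"
proof -
  have "(\<Sum>xs\<in>nlists (k + l) S. f xs) = (\<Sum>p\<in>nlists k S \<times> nlists l S. f (fst p @ snd p))"
    by (rule sum.reindex_bij_witness[where i="\<lambda>p. fst p @ snd p" and j="\<lambda>xs. (take k xs, drop k xs)"])
      (auto simp: nlists_def dest: in_set_takeD in_set_dropD)
  then show ?thesis by (simp add: sum.cartesian_product')
qed

lemma sum_nlists_zip:
  "(\<Sum>zs\<in>nlists n UNIV. f zs) = (\<Sum>xs\<in>nlists n UNIV. \<Sum>ys\<in>nlists n UNIV. f (zip xs ys))"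
proof -
  have "(\<Sum>zs\<in>nlists n UNIV. f zs) = (\<Sum>p\<in>nlists n UNIV \<times> nlists n UNIV. f (zip (fst p) (snd p)))"
    by (rule sum.reindex_bij_witness[where i="\<lambda>p. zip (fst p) (snd p)" and j="\<lambda>zs. (map fst zs, map snd zs)"])
      (auto simp: in_nlists_UNIV zip_map_fst_snd)
  then show ?thesis by (simp add: sum.cartesian_product')
qed

lemma sum_prod_nlists:
  fixes f :: "nat \<Rightarrow> 'x \<Rightarrow> complex"
  assumes "finite S"
  shows "(\<Sum>ys\<in>nlists n S. \<Prod>k<n. f k (ys ! k)) = (\<Prod>k<n. \<Sum>y\<in>S. f k y)"
proof (induction n arbitrary: f)
  case 0
  then show ?case by (simp add: nlists_0)
next
  case (Suc n)
  have "(\<Sum>ys\<in>nlists (Suc n) S. \<Prod>k<Suc n. f k (ys ! k))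
      = (\<Sum>y\<in>S. \<Sum>ys\<in>nlists n S. f 0 y * (\<Prod>k<n. f (Suc k) (ys ! k)))"
    unfolding sum_nlists_Suc by (simp add: prod.lessThan_Suc_shift del: prod.lessThan_Suc)
  also have "\<dots> = (\<Sum>y\<in>S. f 0 y) * (\<Sum>ys\<in>nlists n S. \<Prod>k<n. f (Suc k) (ys ! k))"
    by (rule sum_product[symmetric])
  also have "\<dots> = (\<Prod>k<Suc n. \<Sum>y\<in>S. f k y)"
    unfolding Suc.IH[of "\<lambda>k. f (Suc k)"] by (simp add: prod.lessThan_Suc_shift del: prod.lessThan_Suc)
  finally show ?case .
qed

type_synonym ('a, 'j, 'b) jchannel = "('a \<times> 'j) cop \<Rightarrow> 'b cop"

abbreviation words :: "nat \<Rightarrow> 'x list set" where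
  "words n \<equiv> nlists n UNIV"

text \<open>The Choi matrix of the n-fold tensor power of \<open>N\<close>, its indices regrouped
  into a sender word, a jammer word and a receiver word, so that the jammer's part can be left open
  while the rest is contracted.\<close>

definition jam_ker :: "('a::finite, 'j::finite, 'b::finite) jchannel \<Rightarrow> nat \<Rightarrow> ('a list \<times> 'j list \<times> 'b list) cop" where
  "jam_ker N n = (\<lambda>(x, j, y) (x', j', y'). \<Prod>k<n. N (eunit (x ! k, j ! k) (x' ! k, j' ! k)) (y ! k) (y' ! k))"

lemma jammed_channel_apply:
  assumes "length y = n" "length y' = n"
  shows "jammed_channel N n \<sigma> X y y' =
    (\<Sum>x\<in>words n. \<Sum>j\<in>words n. \<Sum>x'\<in>words n. \<Sum>j'\<in>words n.
       X x x' * \<sigma> j j' * jam_ker N n (x, j, y) (x', j', y'))"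
  unfolding jammed_channel_def tensor_power_map_def sum_nlists_zip
  using assms by (auto simp: in_nlists_UNIV jam_ker_def intro!: sum.cong)

lemma jammed_channel_outside:
  "\<not> (length y = n \<and> length y' = n) \<Longrightarrow> jammed_channel N n \<sigma> X y y' = 0"
  unfolding jammed_channel_def tensor_power_map_def by (simp only: if_False)

lemma jam_ker_psd:
  fixes N :: "('a::finite, 'j::finite, 'b::finite) jchannel"
  assumes "channel UNIV UNIV N"
  shows "psd (words n \<times> words n \<times> words n) (jam_ker N n)"
proof -
  let ?W = "words n \<times> words n \<times> words n :: ('a list \<times> 'j list \<times> 'b list) set"
  let ?f = "\<lambda>k p. ((fst p ! k, fst (snd p) ! k), snd (snd p) ! k) :: ('a \<times> 'j) \<times> 'b"
  have fin: "finite ?W" by (simp add: finite_nlists)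
  have p: "psd (UNIV \<times> UNIV) (choi N)"
    using assms unfolding channel_def by (intro choi_psd) auto
  have "psd ?W (\<lambda>p q. \<Prod>k<n. choi N (?f k p) (?f k q))"
    by (intro psd_prod[OF fin] psd_pullback[OF fin _ p]) auto
  then show ?thesis by (simp add: jam_ker_def choi_def split_def)
qed

lemma prod_idop_nth:
  assumes "length x = n" "length x' = n"
  shows "(\<Prod>k<n. if x ! k = x' ! k then 1 else 0) = (idop x x' :: complex)"
proof (cases "x = x'")
  case True
  then show ?thesis by (simp add: idop_def)
next
  case False
  then obtain k where k: "k < n" "x ! k \<noteq> x' ! k" using assms by (auto simp: list_eq_iff_nth_eq)
  have "(\<Prod>k<n. if x ! k = x' ! k then 1 else 0) = (0 :: complex)"
    by (rule prod_zero) (use k in auto)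
  then show ?thesis using False by (simp add: idop_def)
qed

lemma jam_ker_trace:
  assumes N: "channel UNIV UNIV N" and len: "length x = n" "length x' = n" "length j = n" "length j' = n"
  shows "(\<Sum>y\<in>words n. jam_ker N n (x, j, y) (x', j', y)) = idop x x' * idop j j'"
proof -
  have t: "(\<Sum>y\<in>UNIV. N (eunit p q) y y) = (if p = q then 1 else 0)" for p q
  proof -
    have "(\<Sum>y\<in>UNIV. N (eunit p q) y y) = tr UNIV (eunit p q)"
      using N by (simp add: channel_def trace_preserving_def tr_def)
    also have "\<dots> = (\<Sum>i\<in>UNIV. if i = p then (if p = q then 1 else 0) else 0)"
      unfolding tr_def eunit_def by (intro sum.cong) auto
    finally show ?thesis by simp
  qed
  have "(\<Sum>y\<in>words n. jam_ker N n (x, j, y) (x', j', y))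
      = (\<Prod>k<n. \<Sum>y\<in>UNIV. N (eunit (x ! k, j ! k) (x' ! k, j' ! k)) y y)"
    unfolding jam_ker_def using sum_prod_nlists[of UNIV "\<lambda>k y. N (eunit (x ! k, j ! k) (x' ! k, j' ! k)) y y" n] by simp
  also have "\<dots> = (\<Prod>k<n. (if x ! k = x' ! k then 1 else 0) * (if j ! k = j' ! k then 1 else 0))"
    unfolding t by (intro prod.cong) auto
  also have "\<dots> = idop x x' * idop j j'"
    unfolding prod.distrib prod_idop_nth[OF len(1,2)] prod_idop_nth[OF len(3,4)] ..
  finally show ?thesis .
qed

lemma tr_jammed_channel:
  assumes N: "channel UNIV UNIV N"
  shows "tr (words n) (jammed_channel N n \<sigma> X) = tr (words n) X * tr (words n) \<sigma>"
proof -
  let ?L = "words n"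
  have "tr ?L (jammed_channel N n \<sigma> X) = (\<Sum>y\<in>?L. \<Sum>x\<in>?L. \<Sum>j\<in>?L. \<Sum>x'\<in>?L. \<Sum>j'\<in>?L.
       X x x' * \<sigma> j j' * jam_ker N n (x, j, y) (x', j', y))"
    unfolding tr_def by (intro sum.cong refl jammed_channel_apply) (simp_all add: in_nlists_UNIV)
  also have "\<dots> = (\<Sum>x\<in>?L. \<Sum>j\<in>?L. \<Sum>x'\<in>?L. \<Sum>j'\<in>?L. \<Sum>y\<in>?L.
       X x x' * \<sigma> j j' * jam_ker N n (x, j, y) (x', j', y))"
    unfolding sum.cartesian_product
    by (rule sum.reindex_bij_witness[where i="\<lambda>(x,j,x',j',y). (y,x,j,x',j')" and j="\<lambda>(y,x,j,x',j'). (x,j,x',j',y)"]) auto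
  also have "\<dots> = (\<Sum>x\<in>?L. \<Sum>j\<in>?L. \<Sum>x'\<in>?L. \<Sum>j'\<in>?L. X x x' * \<sigma> j j' * (idop x x' * idop j j'))"
    unfolding sum_distrib_left[symmetric]
    by (intro sum.cong refl arg_cong2[where f="(*)"] jam_ker_trace[OF N]) (simp_all add: in_nlists_UNIV)
  also have "\<dots> = (\<Sum>x\<in>?L. \<Sum>j\<in>?L. X x x * \<sigma> j j)"
    by (simp add: idop_def finite_nlists if_distrib[of "\<lambda>x. _ * x"] if_distrib[of "\<lambda>x. x * _"] cong: if_cong)
  also have "\<dots> = tr ?L X * tr ?L \<sigma>"
    by (simp add: tr_def sum_product)
  finally show ?thesis .
qed

text \<open>The kernel in the jammer's indices that remains after the encoder \<open>P\<close>, the channel and the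
  decoder \<open>D\<close> are contracted; \<open>Q\<close> indexes the reference system.\<close>
definition tker :: "('a::finite, 'j::finite, 'b::finite) jchannel \<Rightarrow> nat \<Rightarrow> 'q set \<Rightarrow> ('q \<Rightarrow> 'q \<Rightarrow> 'a list cop)
    \<Rightarrow> ('q \<Rightarrow> 'q \<Rightarrow> 'b list cop) \<Rightarrow> 'j list cop" where
  "tker N n Q P D = (\<lambda>j j'. \<Sum>p\<in>Q \<times> words n \<times> words n. \<Sum>q\<in>Q \<times> words n \<times> words n.
     P (fst p) (fst q) (fst (snd p)) (fst (snd q)) *
     jam_ker N n (fst (snd p), j, snd (snd p)) (fst (snd q), j', snd (snd q)) *
     D (fst p) (fst q) (snd (snd p)) (snd (snd q)))"

text \<open>A Schur product of three positive kernels, contracted over everything except the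
  jammer's indices. \<open>P\<close> and \<open>D\<close> may come from different codes.\<close>

lemma tker_psd:
  fixes N :: "('a::finite, 'j::finite, 'b::finite) jchannel"
  assumes N: "channel UNIV UNIV N" and Q: "finite Q"
    and P: "psd (Q \<times> words n) (\<lambda>p q. P (fst p) (fst q) (snd p) (snd q))"
    and D: "psd (Q \<times> words n) (\<lambda>p q. D (fst p) (fst q) (snd p) (snd q))"
  shows "psd (words n) (tker N n Q P D)"
proof -
  let ?L = "words n :: 'j list set"
  let ?W = "Q \<times> (words n :: 'a list set) \<times> (words n :: 'b list set)"
  have fin: "finite (?L \<times> ?W)" using Q by (simp add: finite_nlists)
  have "psd (?L \<times> ?W) (\<lambda>p q.
     (P (fst (snd p)) (fst (snd q)) (fst (snd (snd p))) (fst (snd (snd q))) *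
     jam_ker N n (fst (snd (snd p)), fst p, snd (snd (snd p))) (fst (snd (snd q)), fst q, snd (snd (snd q)))) *
     D (fst (snd p)) (fst (snd q)) (snd (snd (snd p))) (snd (snd (snd q))))"
  proof (intro psd_schur fin)
    show "psd (?L \<times> ?W) (\<lambda>p q. P (fst (snd p)) (fst (snd q)) (fst (snd (snd p))) (fst (snd (snd q))))"
      using psd_pullback[OF fin _ P, of "\<lambda>p. (fst (snd p), fst (snd (snd p)))"] Q
      by (force simp: finite_nlists)
    show "psd (?L \<times> ?W) (\<lambda>p q. D (fst (snd p)) (fst (snd q)) (snd (snd (snd p))) (snd (snd (snd q))))"
      using psd_pullback[OF fin _ D, of "\<lambda>p. (fst (snd p), snd (snd (snd p)))"] Q
      by (force simp: finite_nlists)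
    show "psd (?L \<times> ?W) (\<lambda>p q. jam_ker N n (fst (snd (snd p)), fst p, snd (snd (snd p))) (fst (snd (snd q)), fst q, snd (snd (snd q))))"
      using psd_pullback[OF fin _ jam_ker_psd[OF N, of n], of "\<lambda>p. (fst (snd (snd p)), fst p, snd (snd (snd p)))"]
      by (force simp: finite_nlists)
  qed
  from psd_contract[OF _ _ this] show ?thesis
    using Q by (simp add: tker_def finite_nlists)
qed

lemma tker_sum_left: "tker N n Q (\<lambda>a b x x'. \<Sum>r\<in>R. P r a b x x') D j j' = (\<Sum>r\<in>R. tker N n Q (P r) D j j')"
  unfolding tker_def sum_distrib_right by (rule sum_rotate)

lemma tker_sum_right: "tker N n Q P (\<lambda>a b y y'. \<Sum>r\<in>R. D r a b y y') j j' = (\<Sum>r\<in>R. tker N n Q P (D r) j j')"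
  unfolding tker_def sum_distrib_left by (rule sum_rotate)

lemma tker_scale_left: "tker N n Q (\<lambda>a b x x'. c * P a b x x') D j j' = c * tker N n Q P D j j'"
  by (simp add: tker_def sum_distrib_left mult.assoc)

lemma tker_cong:
  assumes "\<And>a b x x'. a \<in> Q \<Longrightarrow> b \<in> Q \<Longrightarrow> length x = n \<Longrightarrow> length x' = n \<Longrightarrow> P a b x x' = P' a b x x'"
    and "\<And>a b y y'. a \<in> Q \<Longrightarrow> b \<in> Q \<Longrightarrow> length y = n \<Longrightarrow> length y' = n \<Longrightarrow> D a b y y' = D' a b y y'"
  shows "tker N n Q P D j j' = tker N n Q P' D' j j'"
  unfolding tker_def using assms by (intro sum.cong refl) (auto simp: in_nlists_UNIV)

lemma jam_ker_append:
  assumes "length x1 = k" "length x1' = k" "length j1 = k" "length j1' = k" "length y1 = k" "length y1' = k"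
  shows "jam_ker N (k + l) (x1 @ x2, j1 @ j2, y1 @ y2) (x1' @ x2', j1' @ j2', y1' @ y2')
    = jam_ker N k (x1, j1, y1) (x1', j1', y1') * jam_ker N l (x2, j2, y2) (x2', j2', y2')"
proof -
  have "jam_ker N (k + l) (x1 @ x2, j1 @ j2, y1 @ y2) (x1' @ x2', j1' @ j2', y1' @ y2')
    = (\<Prod>i\<in>{..<k + l}. N (eunit ((x1 @ x2) ! i, (j1 @ j2) ! i) ((x1' @ x2') ! i, (j1' @ j2') ! i)) ((y1 @ y2) ! i) ((y1' @ y2') ! i))"
    (is "_ = prod ?g _") by (simp add: jam_ker_def)
  also have "\<dots> = prod ?g {..<k} * (\<Prod>i<l. ?g (k + i))"
  proof (induction l)
    case (Suc l)
    then show ?case by (simp add: mult.assoc)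
  qed simp
  finally show ?thesis using assms by (simp add: jam_ker_def nth_append)
qed

lemma sum_nlists_append_pair:
  "(\<Sum>p\<in>Q \<times> words (k + l) \<times> words (k + l). f p) =
   (\<Sum>p\<in>{()} \<times> words k \<times> words k. \<Sum>p'\<in>Q \<times> words l \<times> words l.
      f (fst p', fst (snd p) @ fst (snd p'), snd (snd p) @ snd (snd p')))"
  unfolding sum.cartesian_product
  by (rule sum.reindex_bij_witness[where i="\<lambda>(p, p'). (fst p', fst (snd p) @ fst (snd p'), snd (snd p) @ snd (snd p'))"
      and j="\<lambda>p. (((), take k (fst (snd p)), take k (snd (snd p))), (fst p, drop k (fst (snd p)), drop k (snd (snd p))))"])
    (auto simp: in_nlists_UNIV)

text \<open>\<open>jam_ker\<close> factors at a cut of the word, so strategies that factor there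
  have factoring kernels. The prefix carries classical information only and gets the one-point
  reference \<open>{()}\<close>; the whole reference \<open>Q\<close> belongs to the suffix.\<close>

lemma tker_append:
  assumes "length j1 = k" "length j1' = k"
  shows "tker N (k + l) Q (\<lambda>a b x x'. P1 (take k x) (take k x') * P2 a b (drop k x) (drop k x'))
      (\<lambda>a b y y'. D1 (take k y) (take k y') * D2 a b (drop k y) (drop k y')) (j1 @ j2) (j1' @ j2')
    = tker N k {()} (\<lambda>_ _. P1) (\<lambda>_ _. D1) j1 j1' * tker N l Q P2 D2 j2 j2'"
proof -
  let ?U = "{()} \<times> words k \<times> words k"
  let ?W = "Q \<times> words l \<times> words l"
  let ?f = "\<lambda>p q. P1 (fst (snd p)) (fst (snd q)) *
     jam_ker N k (fst (snd p), j1, snd (snd p)) (fst (snd q), j1', snd (snd q)) *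
     D1 (snd (snd p)) (snd (snd q))"
  let ?g = "\<lambda>p q. P2 (fst p) (fst q) (fst (snd p)) (fst (snd q)) *
     jam_ker N l (fst (snd p), j2, snd (snd p)) (fst (snd q), j2', snd (snd q)) *
     D2 (fst p) (fst q) (snd (snd p)) (snd (snd q))"
  have "tker N (k + l) Q (\<lambda>a b x x'. P1 (take k x) (take k x') * P2 a b (drop k x) (drop k x'))
      (\<lambda>a b y y'. D1 (take k y) (take k y') * D2 a b (drop k y) (drop k y')) (j1 @ j2) (j1' @ j2')
    = (\<Sum>p\<in>?U. \<Sum>p'\<in>?W. \<Sum>q\<in>?U. \<Sum>q'\<in>?W. ?f p q * ?g p' q')"
    unfolding tker_def sum_nlists_append_pair using assms
    by (intro sum.cong refl) (clarsimp simp: in_nlists_UNIV jam_ker_append)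
  also have "\<dots> = (\<Sum>p\<in>?U. \<Sum>q\<in>?U. \<Sum>p'\<in>?W. \<Sum>q'\<in>?W. ?f p q * ?g p' q')"
    by (intro sum.cong refl sum.swap)
  also have "\<dots> = tker N k {()} (\<lambda>_ _. P1) (\<lambda>_ _. D1) j1 j1' * tker N l Q P2 D2 j2 j2'"
    unfolding tker_def sum_distrib_right unfolding sum_distrib_left by (rule refl)
  finally show ?thesis .
qed

text \<open>Everything is linear in \<open>\<sigma>\<close>, so the sums can be reordered to put its
  entries outside. The map \<open>g\<close> selects the decoder entries: the inclusion of
  \<open>F_A\<close> into \<open>F_B\<close> for entanglement, a constant for a single classical
  outcome.\<close>

lemma sum_decoder_jammed:
  assumes D: "linmap (words n) F D" and g: "\<And>a. a \<in> Q \<Longrightarrow> g a \<in> F"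
  shows "(\<Sum>a\<in>Q. \<Sum>b\<in>Q. D (jammed_channel N n \<sigma> (P a b)) (g a) (g b)) =
    pairing (words n) \<sigma> (tker N n Q P (\<lambda>a b y y'. D (eunit y y') (g a) (g b)))"
proof -
  let ?L = "words n"
  have "(\<Sum>a\<in>Q. \<Sum>b\<in>Q. D (jammed_channel N n \<sigma> (P a b)) (g a) (g b)) =
    (\<Sum>a\<in>Q. \<Sum>b\<in>Q. \<Sum>y\<in>?L. \<Sum>y'\<in>?L. \<Sum>x\<in>?L. \<Sum>j\<in>?L. \<Sum>x'\<in>?L. \<Sum>j'\<in>?L.
       P a b x x' * \<sigma> j j' * jam_ker N n (x, j, y) (x', j', y') * D (eunit y y') (g a) (g b))"
  proof (intro sum.cong refl)
    fix a b assume "a \<in> Q" "b \<in> Q"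
    then have "D (jammed_channel N n \<sigma> (P a b)) (g a) (g b) =
       (\<Sum>y\<in>?L. \<Sum>y'\<in>?L. jammed_channel N n \<sigma> (P a b) y y' * D (eunit y y') (g a) (g b))"
      by (intro linmap_apply[OF D] g)
    also have "\<dots> = (\<Sum>y\<in>?L. \<Sum>y'\<in>?L. \<Sum>x\<in>?L. \<Sum>j\<in>?L. \<Sum>x'\<in>?L. \<Sum>j'\<in>?L.
       P a b x x' * \<sigma> j j' * jam_ker N n (x, j, y) (x', j', y') * D (eunit y y') (g a) (g b))"
      by (intro sum.cong refl) (simp only: jammed_channel_apply in_nlists_UNIV sum_distrib_right)
    finally show "D (jammed_channel N n \<sigma> (P a b)) (g a) (g b) = \<dots>" .
  qed
  also have "\<dots> = (\<Sum>j\<in>?L. \<Sum>j'\<in>?L. \<Sum>a\<in>Q. \<Sum>x\<in>?L. \<Sum>y\<in>?L. \<Sum>b\<in>Q. \<Sum>x'\<in>?L. \<Sum>y'\<in>?L.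
     \<sigma> j j' * (P a b x x' * jam_ker N n (x, j, y) (x', j', y') * D (eunit y y') (g a) (g b)))"
    unfolding sum.cartesian_product
    by (rule sum.reindex_bij_witness[where i="\<lambda>(j,j',a,x,y,b,x',y'). (a,b,y,y',x,j,x',j')"
          and j="\<lambda>(a,b,y,y',x,j,x',j'). (j,j',a,x,y,b,x',y')"]) (auto simp: mult_ac)
  also have "\<dots> = pairing ?L \<sigma> (tker N n Q P (\<lambda>a b y y'. D (eunit y y') (g a) (g b)))"
    unfolding pairing_def tker_def by (simp add: sum.cartesian_product' sum_distrib_left)
  finally show ?thesis .
qed

section \<open>The success probability of a code\<close>

lemma linmap_scale:
  assumes "linmap I J \<Phi>"
  shows "\<Phi> (\<lambda>i j. c * X i j) k l = c * \<Phi> X k l"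
proof (cases "k \<in> J \<and> l \<in> J")
  case True
  then show ?thesis
    using linmap_apply[OF assms, of k l "\<lambda>i j. c * X i j"] linmap_apply[OF assms, of k l X]
    by (simp add: sum_distrib_left mult.assoc)
next
  case False
  then show ?thesis using linmap_outside[OF assms False] by simp
qed

lemma jammed_channel_scale:
  shows "jammed_channel N n \<sigma> (\<lambda>x x'. c * X x x') y y' = c * jammed_channel N n \<sigma> X y y'"
proof (cases "length y = n \<and> length y' = n")
  case True
  then show ?thesis by (simp add: jammed_channel_apply sum_distrib_left mult.assoc)
next
  case False
  then show ?thesis by (simp only: jammed_channel_outside[OF False] mult_zero_right)
qed

lemma decoder_jammed_expand:
  assumes D: "linmap (words n) F D" and f: "f \<in> F" "f' \<in> F"
  shows "D (jammed_channel N n \<sigma> X) f f' =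
    (\<Sum>p\<in>words n \<times> words n \<times> words n. \<Sum>q\<in>words n \<times> words n \<times> words n.
       X (fst p) (fst q) * \<sigma> (fst (snd p)) (fst (snd q)) * jam_ker N n p q * D (eunit (snd (snd p)) (snd (snd q))) f f')"
proof -
  let ?L = "words n"
  have "D (jammed_channel N n \<sigma> X) f f' = (\<Sum>y\<in>?L. \<Sum>y'\<in>?L. jammed_channel N n \<sigma> X y y' * D (eunit y y') f f')"
    by (intro linmap_apply[OF D] f)
  also have "\<dots> = (\<Sum>y\<in>?L. \<Sum>y'\<in>?L. \<Sum>x\<in>?L. \<Sum>j\<in>?L. \<Sum>x'\<in>?L. \<Sum>j'\<in>?L.
       X x x' * \<sigma> j j' * jam_ker N n (x, j, y) (x', j', y') * D (eunit y y') f f')"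
    by (intro sum.cong refl) (simp only: jammed_channel_apply in_nlists_UNIV sum_distrib_right)
  also have "\<dots> = (\<Sum>x\<in>?L. \<Sum>j\<in>?L. \<Sum>y\<in>?L. \<Sum>x'\<in>?L. \<Sum>j'\<in>?L. \<Sum>y'\<in>?L.
       X x x' * \<sigma> j j' * jam_ker N n (x, j, y) (x', j', y') * D (eunit y y') f f')"
    unfolding sum.cartesian_product
    by (rule sum.reindex_bij_witness[where i="\<lambda>(x,j,y,x',j',y'). (y,y',x,j,x',j')"
          and j="\<lambda>(y,y',x,j,x',j'). (x,j,y,x',j',y')"]) auto
  also have "\<dots> = (\<Sum>p\<in>?L \<times> ?L \<times> ?L. \<Sum>q\<in>?L \<times> ?L \<times> ?L.
       X (fst p) (fst q) * \<sigma> (fst (snd p)) (fst (snd q)) * jam_ker N n p q * D (eunit (snd (snd p)) (snd (snd q))) f f')"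
    by (simp add: sum.cartesian_product')
  finally show ?thesis .
qed

text \<open>This is the Choi matrix of encoder, jammed channel and decoder in succession. Its
  positivity supplies the hypothesis of \<open>fidelity_pure\<close> and makes matrices of output
  entries positive.\<close>

lemma output_psd:
  fixes N :: "('a::finite, 'j::finite, 'b::finite) jchannel"
  assumes N: "channel UNIV UNIV N" and \<sigma>: "psd (words n) \<sigma>"
    and E: "completely_positive Q (words n) E" "finite Q"
    and D: "completely_positive (words n) F D" "finite F"
  shows "psd (Q \<times> F) (\<lambda>p q. D (jammed_channel N n \<sigma> (E (eunit (fst p) (fst q)))) (snd p) (snd q))"
proof -
  let ?W = "words n \<times> words n \<times> words n :: ('a list \<times> 'j list \<times> 'b list) set"
  let ?S = "(Q \<times> F) \<times> ?W"
  have fin: "finite ?S" "finite ?W" "finite (Q \<times> F)" using E(2) D(2) by (auto simp: finite_nlists)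
  have lin: "linmap (words n) F D" using D(1) by (simp add: completely_positive_def)
  have cE: "psd (Q \<times> words n) (choi E)" by (rule choi_psd[OF E]) (simp add: finite_nlists)
  have cD: "psd (words n \<times> F) (choi D)" using D by (intro choi_psd) (auto simp: finite_nlists)
  let ?K = "\<lambda>s t. choi E (fst (fst s), fst (snd s)) (fst (fst t), fst (snd t)) * \<sigma> (fst (snd (snd s))) (fst (snd (snd t)))
      * jam_ker N n (snd s) (snd t) * choi D (snd (snd (snd s)), snd (fst s)) (snd (snd (snd t)), snd (fst t))"
  have "psd ?S ?K"
  proof (intro psd_schur fin)
    show "psd ?S (\<lambda>s t. choi E (fst (fst s), fst (snd s)) (fst (fst t), fst (snd t)))"
      by (rule psd_pullback[OF fin(1) _ cE]) (use E D in \<open>auto simp: finite_nlists\<close>)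
    show "psd ?S (\<lambda>s t. \<sigma> (fst (snd (snd s))) (fst (snd (snd t))))"
      by (rule psd_pullback[OF fin(1) _ \<sigma>]) (use E D in \<open>auto simp: finite_nlists\<close>)
    show "psd ?S (\<lambda>s t. jam_ker N n (snd s) (snd t))"
      by (rule psd_pullback[OF fin(1) _ jam_ker_psd[OF N]]) (use E D in \<open>auto simp: finite_nlists\<close>)
    show "psd ?S (\<lambda>s t. choi D (snd (snd (snd s)), snd (fst s)) (snd (snd (snd t)), snd (fst t)))"
      by (rule psd_pullback[OF fin(1) _ cD]) (use E D in \<open>auto simp: finite_nlists\<close>)
  qed
  from psd_contract[OF fin(3,2) this]
  have "psd (Q \<times> F) (\<lambda>x y. \<Sum>p\<in>?W. \<Sum>q\<in>?W. ?K (x, p) (y, q))" .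
  moreover have "psd (Q \<times> F) (\<lambda>x y. \<Sum>p\<in>?W. \<Sum>q\<in>?W. ?K (x, p) (y, q)) =
     psd (Q \<times> F) (\<lambda>p q. D (jammed_channel N n \<sigma> (E (eunit (fst p) (fst q)))) (snd p) (snd q))"
  proof (rule psd_cong)
    fix x y assume "x \<in> Q \<times> F" "y \<in> Q \<times> F"
    then have "snd x \<in> F" "snd y \<in> F" by auto
    from decoder_jammed_expand[OF lin this, of N \<sigma> "E (eunit (fst x) (fst y))"]
    show "(\<Sum>p\<in>?W. \<Sum>q\<in>?W. ?K (x, p) (y, q)) = D (jammed_channel N n \<sigma> (E (eunit (fst x) (fst y)))) (snd x) (snd y)"
      by (simp add: choi_def)
  qed
  ultimately show ?thesis by simp
qed

lemma sesq_on_image: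
  assumes fin: "finite I" and h: "inj_on h Q" "h ` Q \<subseteq> I"
    and \<phi>: "\<And>a. a \<in> Q \<Longrightarrow> \<phi> (h a) = c" "\<And>i. i \<in> I - h ` Q \<Longrightarrow> \<phi> i = 0"
  shows "sesq I X \<phi> \<phi> = cnj c * c * (\<Sum>a\<in>Q. \<Sum>b\<in>Q. X (h a) (h b))"
proof -
  have r: "(\<Sum>i\<in>I. f i) = (\<Sum>a\<in>Q. f (h a))" if "\<And>i. i \<in> I - h ` Q \<Longrightarrow> f i = 0" for f :: "_ \<Rightarrow> complex"
  proof -
    have "(\<Sum>i\<in>I. f i) = (\<Sum>i\<in>h ` Q. f i)"
      by (rule sum.mono_neutral_right[OF fin h(2)]) (use that in auto)
    also have "\<dots> = (\<Sum>a\<in>Q. f (h a))" by (simp add: sum.reindex[OF h(1)])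
    finally show ?thesis .
  qed
  have "sesq I X \<phi> \<phi> = (\<Sum>a\<in>Q. \<Sum>j\<in>I. cnj (\<phi> (h a)) * X (h a) j * \<phi> j)"
    unfolding sesq_def by (rule r) (simp add: \<phi>(2))
  also have "\<dots> = (\<Sum>a\<in>Q. \<Sum>b\<in>Q. cnj (\<phi> (h a)) * X (h a) (h b) * \<phi> (h b))"
    by (intro sum.cong refl r) (simp add: \<phi>(2))
  also have "\<dots> = (\<Sum>a\<in>Q. \<Sum>b\<in>Q. cnj c * c * X (h a) (h b))"
    by (intro sum.cong refl) (simp add: \<phi>(1) mult_ac)
  finally show ?thesis by (simp add: sum_distrib_left)
qed

text \<open>Encoder from \<open>C\<close>, decoder from \<open>C'\<close>: the mixed case occurs
  when the prefix is decoded wrongly. One factor \<open>1 / M2\<close> normalizes the input state,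
  the other comes from the target vector, and \<open>1 / M1\<close> averages over the
  messages.\<close>

definition ent_ker :: "('a::finite, 'j::finite, 'b::finite) jchannel \<Rightarrow> nat \<Rightarrow> nat \<Rightarrow> nat \<Rightarrow> ('a, 'b) cet_code \<Rightarrow> ('a, 'b) cet_code \<Rightarrow> 'j list cop" where
  "ent_ker N n M1 M2 C C' = (\<lambda>j j'. of_real (1 / (real M1 * (real M2)\<^sup>2)) * (\<Sum>m<M1.
     tker N n {0..<M2} (\<lambda>a b. enc C m (eunit a b)) (\<lambda>a b y y'. dec C' m (eunit y y') a b) j j'))"

lemma is_cet_codeD:
  assumes "is_cet_code n M1 M2 C"
  shows "1 \<le> M1" "1 \<le> M2" "M2 \<le> dimFB C"
    "\<And>m. m < M1 \<Longrightarrow> completely_positive {0..<M2} (words n) (enc C m)"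
    "\<And>m. m < M1 \<Longrightarrow> trace_preserving {0..<M2} (words n) (enc C m)"
    "\<And>m. m < M1 \<Longrightarrow> completely_positive (words n) {0..<dimFB C} (dec C m)"
    "trace_preserving (words n) {0..<dimFB C} (\<lambda>Y k l. \<Sum>m<M1. dec C m Y k l)"
    "\<And>m. m < M1 \<Longrightarrow> linmap {0..<M2} (words n) (enc C m)"
    "\<And>m. m < M1 \<Longrightarrow> linmap (words n) {0..<dimFB C} (dec C m)"
  using assms by (auto simp: is_cet_code_def channel_def completely_positive_def)

lemma sum_dec_enc_eq_pairing:
  assumes C: "is_cet_code n M1 M2 C"
  shows "of_real (1 / (real M1 * (real M2)\<^sup>2)) * (\<Sum>m<M1. \<Sum>a\<in>{0..<M2}. \<Sum>b\<in>{0..<M2}.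
      dec C m (jammed_channel N n \<sigma> (enc C m (eunit a b))) a b) =
    pairing (words n) \<sigma> (ent_ker N n M1 M2 C C)"
  unfolding ent_ker_def pairing_scale pairing_sum
proof (intro arg_cong2[where f="(*)"] refl sum.cong)
  fix m assume "m \<in> {..<M1}"
  then have "linmap (words n) {0..<dimFB C} (dec C m)" using is_cet_codeD(9)[OF C] by simp
  from sum_decoder_jammed[OF this, of "{0..<M2}" "\<lambda>a. a" N \<sigma> "\<lambda>a b. enc C m (eunit a b)"]
  show "(\<Sum>a\<in>{0..<M2}. \<Sum>b\<in>{0..<M2}. dec C m (jammed_channel N n \<sigma> (enc C m (eunit a b))) a b) =
    pairing (words n) \<sigma> (tker N n {0..<M2} (\<lambda>a b. enc C m (eunit a b)) (\<lambda>a b y y'. dec C m (eunit y y') a b))"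
    using is_cet_codeD(3)[OF C] by auto
qed

text \<open>For each message the target is pure, so \<open>fidelity_pure\<close> replaces the
  fidelity by a quadratic form of the output. The vector \<open>\<phi>\<close> fixes the decoded
  message to \<open>m\<close>, hence only the decoder \<open>dec C m\<close> contributes.\<close>

lemma cet_success_eq:
  assumes N: "channel UNIV UNIV N" and C: "is_cet_code n M1 M2 C" and \<sigma>: "psd (words n) \<sigma>"
  shows "cet_success M1 M2 C (jammed_channel N n \<sigma>) = Re (pairing (words n) \<sigma> (ent_ker N n M1 M2 C C))"
proof -
  note c = is_cet_codeD[OF C]
  let ?I = "{0..<M2} \<times> ({0..<M1} \<times> {0..<dimFB C})"
  let ?out = "\<lambda>m m' a b. dec C m' (jammed_channel N n \<sigma> (enc C m (eunit a b)))"
  have fin: "finite ?I" by simp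
  have M2: "0 < real M2" using c(2) by simp
  have fid: "fidelity ?I
       (\<lambda>(a, (m1, f)) (b, (m2, f')). if m1 = m \<and> m2 = m then max_ent M2 (a, f) (b, f') else 0)
       (id_tensor (\<lambda>X. full_decoder M1 C (jammed_channel N n \<sigma> (enc C m X))) (max_ent M2))
     = Re (of_real (1 / (real M2)\<^sup>2) * (\<Sum>a\<in>{0..<M2}. \<Sum>b\<in>{0..<M2}. ?out m m a b a b))" if m: "m < M1" for m
  proof -
    define \<phi> :: "nat \<times> nat \<times> nat \<Rightarrow> complex" where
      "\<phi> = (\<lambda>(a, (m1, f)). if m1 = m \<and> a = f \<and> a < M2 then of_real (1 / sqrt (real M2)) else 0)"
    let ?h = "\<lambda>a::nat. (a, (m, a))"
    let ?\<rho> = "id_tensor (\<lambda>X. full_decoder M1 C (jammed_channel N n \<sigma> (enc C m X))) (max_ent M2)"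
    have cc: "complex_of_real (1 / sqrt (real M2)) * complex_of_real (1 / sqrt (real M2)) = 1 / of_nat M2"
      unfolding of_real_mult[symmetric] using M2 by simp
    have target: "(\<lambda>(a, (m1, f)) (b, (m2, f')). if m1 = m \<and> m2 = m then max_ent M2 (a, f) (b, f') else 0)
        = (\<lambda>i j. \<phi> i * cnj (\<phi> j))"
      using cc by (auto simp: fun_eq_iff max_ent_def \<phi>_def)
    have slice: "(\<lambda>i j. max_ent M2 (a, i) (b, j)) = (\<lambda>i j. (1 / of_nat M2) * eunit a b i j)" if "a < M2" "b < M2" for a b
      using that by (auto simp: fun_eq_iff max_ent_def eunit_def)
    have \<rho>: "?\<rho> (a, (m1, f)) (b, (m2, f')) = (if m1 = m2 then (1 / of_nat M2) * ?out m m1 a b f f' else 0)"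
      if "a < M2" "b < M2" "m1 < M1" for a b m1 m2 f f'
    proof -
      have "enc C m (\<lambda>i j. max_ent M2 (a, i) (b, j)) = (\<lambda>x x'. (1 / of_nat M2) * enc C m (eunit a b) x x')"
        unfolding slice[OF that(1,2)] by (intro ext linmap_scale[OF c(8)[OF m]])
      then have "jammed_channel N n \<sigma> (enc C m (\<lambda>i j. max_ent M2 (a, i) (b, j)))
         = (\<lambda>y y'. (1 / of_nat M2) * jammed_channel N n \<sigma> (enc C m (eunit a b)) y y')"
        by (intro ext) (simp only: jammed_channel_scale)
      then show ?thesis
        using that(3) linmap_scale[OF c(9)[OF that(3)], of "1 / of_nat M2"]
        by (auto simp: id_tensor_def full_decoder_def)
    qed
    \<comment> \<open>The output is block diagonal in the decoded message. The block of
      \<open>m0\<close> is positive by \<open>output_psd\<close> and is put in its place by a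
      rank-one indicator kernel.\<close>
    have "psd ?I (\<lambda>p q. \<Sum>m0\<in>{0..<M1}. ((if fst (snd p) = m0 then 1 else 0) * cnj (if fst (snd q) = m0 then 1 else 0)) *
        (of_real (1 / real M2) * ?out m m0 (fst p) (fst q) (snd (snd p)) (snd (snd q))))"
    proof (rule psd_sum, rule psd_schur[OF fin])
      fix m0 assume m0: "m0 \<in> {0..<M1}"
      show "psd ?I (\<lambda>p q. (if fst (snd p) = m0 then 1 else 0) * cnj (if fst (snd q) = m0 then 1 else 0))"
        by (rule psd_rank_one[OF fin])
      have "psd ({0..<M2} \<times> {0..<dimFB C}) (\<lambda>p q. ?out m m0 (fst p) (fst q) (snd p) (snd q))"
        by (rule output_psd[OF N \<sigma>]) (use m m0 c in auto)
      from psd_pullback[OF fin _ this, of "\<lambda>p. (fst p, snd (snd p))"]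
      have "psd ?I (\<lambda>p q. ?out m m0 (fst p) (fst q) (snd (snd p)) (snd (snd q)))"
        by force
      then show "psd ?I (\<lambda>p q. of_real (1 / real M2) * ?out m m0 (fst p) (fst q) (snd (snd p)) (snd (snd q)))"
        by (intro psd_scale) auto
    qed
    also have "?this = psd ?I ?\<rho>"
    proof (rule psd_cong)
      fix p q assume pq: "p \<in> ?I" "q \<in> ?I"
      then obtain a m1 f b m2 f' where e: "p = (a, (m1, f))" "q = (b, (m2, f'))" "a < M2" "b < M2" "m1 < M1" "m2 < M1"
        by auto
      have "(\<Sum>m0\<in>{0..<M1}. ((if m1 = m0 then 1 else 0) * cnj (if m2 = m0 then 1 else 0)) *
          (of_real (1 / real M2) * ?out m m0 a b f f'))
        = (\<Sum>m0\<in>{0..<M1}. if m0 = m1 then (if m1 = m2 then (1 / of_nat M2) * ?out m m1 a b f f' else 0) else 0)"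
        by (intro sum.cong) auto
      also have "\<dots> = ?\<rho> p q" using e \<rho>[of a b m1 f m2 f'] by simp
      finally show "(\<Sum>m0\<in>{0..<M1}. ((if fst (snd p) = m0 then 1 else 0) * cnj (if fst (snd q) = m0 then 1 else 0)) *
        (of_real (1 / real M2) * ?out m m0 (fst p) (fst q) (snd (snd p)) (snd (snd q)))) = ?\<rho> p q"
        unfolding e by simp
    qed
    finally have psd: "psd ?I ?\<rho>" .
    have img: "inj_on ?h {0..<M2}" "?h ` {0..<M2} \<subseteq> ?I"
      using m c(3) by (auto intro: inj_onI)
    have \<phi>1: "\<phi> (?h a) = of_real (1 / sqrt (real M2))" if "a \<in> {0..<M2}" for a
      using that by (simp add: \<phi>_def)
    have \<phi>2: "\<phi> i = 0" if "i \<in> ?I - ?h ` {0..<M2}" for i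
      using that by (auto simp: \<phi>_def split: prod.splits)
    have \<phi>3: "\<phi> i = 0" if "i \<notin> ?I" for i
      using that m c(3) by (auto simp: \<phi>_def split: prod.splits)
    have s: "sesq ?I X \<phi> \<phi> = (1 / of_nat M2) * (\<Sum>a\<in>{0..<M2}. \<Sum>b\<in>{0..<M2}. X (?h a) (?h b))" for X
      using sesq_on_image[of ?I ?h "{0..<M2}" \<phi> "of_real (1 / sqrt (real M2))" X, OF fin img \<phi>1 \<phi>2] cc by simp
    have "complex_of_real (sqnorm ?I \<phi>) = 1"
      unfolding sesq_idop_self[OF fin, symmetric] s using M2 by (simp add: idop_def)
    then have n1: "sqnorm ?I \<phi> = 1" by (simp only: of_real_eq_1_iff)
    have "fidelity ?I (\<lambda>i j. \<phi> i * cnj (\<phi> j)) ?\<rho> = Re (sesq ?I ?\<rho> \<phi> \<phi>)"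
      by (rule fidelity_pure[OF fin psd n1 \<phi>3])
    also have "sesq ?I ?\<rho> \<phi> \<phi> = (1 / of_nat M2) * (\<Sum>a\<in>{0..<M2}. \<Sum>b\<in>{0..<M2}. (1 / of_nat M2) * ?out m m a b a b)"
      unfolding s by (intro arg_cong2[where f="(*)"] refl sum.cong) (use m \<rho> in auto)
    also have "\<dots> = of_real (1 / (real M2)\<^sup>2) * (\<Sum>a\<in>{0..<M2}. \<Sum>b\<in>{0..<M2}. ?out m m a b a b)"
      by (simp add: power2_eq_square sum_divide_distrib)
    finally show ?thesis unfolding target .
  qed
  have "cet_success M1 M2 C (jammed_channel N n \<sigma>) =
     (1 / real M1) * (\<Sum>m<M1. Re (of_real (1 / (real M2)\<^sup>2) * (\<Sum>a\<in>{0..<M2}. \<Sum>b\<in>{0..<M2}. ?out m m a b a b)))"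
    unfolding cet_success_def by (intro arg_cong2[where f="(*)"] refl sum.cong fid) simp
  also have "\<dots> = Re (of_real (1 / (real M1 * (real M2)\<^sup>2)) * (\<Sum>m<M1. \<Sum>a\<in>{0..<M2}. \<Sum>b\<in>{0..<M2}. ?out m m a b a b))"
    by (simp add: sum_distrib_left Re_divide_of_nat del: of_real_divide)
  finally show ?thesis unfolding sum_dec_enc_eq_pairing[OF C] .
qed

text \<open>The code used for classical messages: \<open>s = (m, i)\<close> is sent as basis state
  \<open>i\<close> with encoder \<open>m\<close>, and \<open>r\<close> consists of the decoded
  message and the outcome of measuring the output in the basis of \<open>F_B\<close>.\<close>

definition hit_ker :: "('a::finite, 'j::finite, 'b::finite) jchannel \<Rightarrow> nat \<Rightarrow> ('a, 'b) cet_code \<Rightarrow> nat \<times> nat \<Rightarrow> nat \<times> nat \<Rightarrow> 'j list cop" where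
  "hit_ker N n C s r = tker N n {()} (\<lambda>_ _. enc C (fst s) (eunit (snd s) (snd s)))
     (\<lambda>_ _ y y'. dec C (fst r) (eunit y y') (snd r) (snd r))"

lemma pairing_hit_ker:
  assumes C: "is_cet_code n M1 M2 C" and r: "r \<in> {0..<M1} \<times> {0..<dimFB C}"
  shows "pairing (words n) \<sigma> (hit_ker N n C s r) =
    dec C (fst r) (jammed_channel N n \<sigma> (enc C (fst s) (eunit (snd s) (snd s)))) (snd r) (snd r)"
proof -
  have lin: "linmap (words n) {0..<dimFB C} (dec C (fst r))"
    using is_cet_codeD(9)[OF C] r by auto
  show ?thesis
    using sum_decoder_jammed[OF lin, of "{()}" "\<lambda>_. snd r" N \<sigma> "\<lambda>_ _. enc C (fst s) (eunit (snd s) (snd s))"] r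
    by (auto simp: hit_ker_def)
qed

lemma hit_ker_psd:
  assumes N: "channel UNIV UNIV N" and C: "is_cet_code n M1 M2 C"
    and s: "s \<in> {0..<M1} \<times> {0..<M2}" and r: "r \<in> {0..<M1} \<times> {0..<dimFB C}"
  shows "psd (words n) (hit_ker N n C s r)"
proof -
  note c = is_cet_codeD[OF C]
  have cE: "psd ({0..<M2} \<times> words n) (choi (enc C (fst s)))"
    by (rule choi_psd) (use c(4) s in \<open>auto simp: finite_nlists\<close>)
  have cD: "psd (words n \<times> {0..<dimFB C}) (choi (dec C (fst r)))"
    by (rule choi_psd) (use c(6) r in \<open>auto simp: finite_nlists\<close>)
  show ?thesis unfolding hit_ker_def
  proof (rule tker_psd[OF N])
    have "psd ({()} \<times> words n) (\<lambda>p q. choi (enc C (fst s)) (snd s, snd p) (snd s, snd q))"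
      by (rule psd_pullback[OF _ _ cE]) (use s in \<open>auto simp: finite_nlists\<close>)
    then show "psd ({()} \<times> words n) (\<lambda>p q. enc C (fst s) (eunit (snd s) (snd s)) (snd p) (snd q))"
      by (simp add: choi_def)
    have "psd ({()} \<times> words n) (\<lambda>p q. choi (dec C (fst r)) (snd p, snd r) (snd q, snd r))"
      by (rule psd_pullback[OF _ _ cD]) (use r in \<open>auto simp: finite_nlists\<close>)
    then show "psd ({()} \<times> words n) (\<lambda>p q. dec C (fst r) (eunit (snd p) (snd q)) (snd r) (snd r))"
      by (simp add: choi_def)
  qed simp
qed

lemma tr_eunit: "finite I \<Longrightarrow> i \<in> I \<Longrightarrow> j \<in> I \<Longrightarrow> tr I (eunit i j) = idop i j"
proof -
  assume a: "finite I" "i \<in> I" "j \<in> I"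
  have "tr I (eunit i j) = (\<Sum>k\<in>I. if k = i then idop i j else 0)"
    unfolding tr_def eunit_def idop_def by (intro sum.cong) auto
  then show ?thesis using a by simp
qed

text \<open>Encoder, channel and the sum of all decoders preserve the trace, so the outcomes
  \<open>r\<close> form a complete measurement. Each single outcome is therefore bounded by the
  identity kernel.\<close>

lemma sum_pairing_hit_ker:
  assumes N: "channel UNIV UNIV N" and C: "is_cet_code n M1 M2 C" and s: "s \<in> {0..<M1} \<times> {0..<M2}"
  shows "(\<Sum>r\<in>{0..<M1} \<times> {0..<dimFB C}. pairing (words n) \<sigma> (hit_ker N n C s r)) = tr (words n) \<sigma>"
proof -
  note c = is_cet_codeD[OF C]
  let ?X = "enc C (fst s) (eunit (snd s) (snd s))"
  let ?Y = "jammed_channel N n \<sigma> ?X"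
  have "(\<Sum>r\<in>{0..<M1} \<times> {0..<dimFB C}. pairing (words n) \<sigma> (hit_ker N n C s r))
    = (\<Sum>r\<in>{0..<M1} \<times> {0..<dimFB C}. dec C (fst r) ?Y (snd r) (snd r))"
    by (intro sum.cong refl pairing_hit_ker[OF C])
  also have "\<dots> = (\<Sum>f\<in>{0..<dimFB C}. \<Sum>m<M1. dec C m ?Y f f)"
    by (subst sum.swap) (simp add: sum.cartesian_product' lessThan_atLeast0)
  also have "\<dots> = tr (words n) ?Y"
    using c(7) by (simp add: trace_preserving_def tr_def)
  also have "\<dots> = tr (words n) ?X * tr (words n) \<sigma>"
    by (rule tr_jammed_channel[OF N])
  also have "tr (words n) ?X = tr {0..<M2} (eunit (snd s) (snd s))"
    using c(5)[of "fst s"] s by (auto simp: trace_preserving_def)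
  also have "\<dots> = 1" using s by (auto simp: tr_eunit idop_def)
  finally show ?thesis by simp
qed

lemma pairing_hit_ker_le:
  assumes N: "channel UNIV UNIV N" and C: "is_cet_code n M1 M2 C"
    and s: "s \<in> {0..<M1} \<times> {0..<M2}" and r: "r \<in> {0..<M1} \<times> {0..<dimFB C}" and \<sigma>: "psd (words n) \<sigma>"
  shows "pairing (words n) \<sigma> (hit_ker N n C s r) \<le> tr (words n) \<sigma>"
  unfolding sum_pairing_hit_ker[OF N C s, symmetric]
  by (rule member_le_sum[where f="\<lambda>r. pairing (words n) \<sigma> (hit_ker N n C s r)"])
    (use r in \<open>auto intro!: pairing_nonneg hit_ker_psd[OF N C s] \<sigma> simp: finite_nlists\<close>)

lemma psd_idop_diff:
  assumes "finite I" "\<And>\<sigma>. psd I \<sigma> \<Longrightarrow> pairing I \<sigma> X \<le> tr I \<sigma>"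
  shows "psd I (\<lambda>i j. idop i j - X i j)"
  by (rule psd_of_pairing[OF assms(1)]) (simp add: pairing_diff pairing_idop assms)

lemma ent_ker_psd:
  assumes N: "channel UNIV UNIV N" and C: "is_cet_code n M1 M2 C" and C': "is_cet_code n M1 M2 C'"
  shows "psd (words n) (ent_ker N n M1 M2 C C')"
  unfolding ent_ker_def
proof (intro psd_scale psd_sum tker_psd[OF N])
  fix m assume m: "m \<in> {..<M1}"
  have cE: "psd ({0..<M2} \<times> words n) (choi (enc C m))"
    by (rule choi_psd) (use is_cet_codeD(4)[OF C] m in \<open>auto simp: finite_nlists\<close>)
  have cD: "psd (words n \<times> {0..<dimFB C'}) (choi (dec C' m))"
    by (rule choi_psd) (use is_cet_codeD(6)[OF C'] m in \<open>auto simp: finite_nlists\<close>)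
  show "psd ({0..<M2} \<times> words n) (\<lambda>p q. enc C m (eunit (fst p) (fst q)) (snd p) (snd q))"
    using cE by (simp add: choi_def split_def)
  have "psd ({0..<M2} \<times> words n) (\<lambda>p q. choi (dec C' m) (snd p, fst p) (snd q, fst q))"
    by (rule psd_pullback[OF _ _ cD]) (use is_cet_codeD(3)[OF C'] in \<open>auto simp: finite_nlists\<close>)
  then show "psd ({0..<M2} \<times> words n) (\<lambda>p q. dec C' m (eunit (snd p) (snd q)) (fst p) (fst q))"
    by (simp add: choi_def)
qed auto

text \<open>Entanglement transmission implies classical transmission. For fixed \<open>m\<close>,
  the success is the sum of all entries of a positive \<open>M2 \<times> M2\<close> matrix, which is
  at most \<open>M2\<close> times its trace; the diagonal entries are the success probabilities of
  the basis states. The factor \<open>M2\<close> cancels one of the two normalizations, leaving a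
  uniform average over \<open>M1 * M2\<close> messages.\<close>

lemma pairing_ent_ker_le_hit:
  assumes N: "channel UNIV UNIV N" and C: "is_cet_code n M1 M2 C" and \<sigma>: "psd (words n) \<sigma>"
  shows "pairing (words n) \<sigma> (ent_ker N n M1 M2 C C) \<le>
    of_real (1 / (real M1 * real M2)) * (\<Sum>s\<in>{0..<M1} \<times> {0..<M2}. pairing (words n) \<sigma> (hit_ker N n C s s))"
proof -
  note c = is_cet_codeD[OF C]
  let ?G = "\<lambda>m a b. dec C m (jammed_channel N n \<sigma> (enc C m (eunit a b))) a b"
  have le: "(\<Sum>a\<in>{0..<M2}. \<Sum>b\<in>{0..<M2}. ?G m a b) \<le> of_nat M2 * (\<Sum>a\<in>{0..<M2}. ?G m a a)" if m: "m < M1" for m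
  proof -
    have "psd ({0..<M2} \<times> {0..<dimFB C}) (\<lambda>p q. dec C m (jammed_channel N n \<sigma> (enc C m (eunit (fst p) (fst q)))) (snd p) (snd q))"
      by (rule output_psd[OF N \<sigma>]) (use m c in auto)
    then have "psd {0..<M2} (\<lambda>a b. dec C m (jammed_channel N n \<sigma> (enc C m (eunit (fst (a, a)) (fst (b, b))))) (snd (a, a)) (snd (b, b)))"
      by (rule psd_pullback[rotated 2]) (use c(3) in auto)
    then have "psd {0..<M2} (?G m)" by simp
    from psd_sum_entries_le[OF this] show ?thesis by simp
  qed
  have "pairing (words n) \<sigma> (ent_ker N n M1 M2 C C) =
     of_real (1 / (real M1 * (real M2)\<^sup>2)) * (\<Sum>m<M1. \<Sum>a\<in>{0..<M2}. \<Sum>b\<in>{0..<M2}. ?G m a b)"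
    by (rule sum_dec_enc_eq_pairing[OF C, symmetric])
  also have "\<dots> \<le> of_real (1 / (real M1 * (real M2)\<^sup>2)) * (\<Sum>m<M1. of_nat M2 * (\<Sum>a\<in>{0..<M2}. ?G m a a))"
    by (intro mult_left_mono sum_mono le) (auto simp: less_eq_complex_def)
  also have "\<dots> = of_real (1 / (real M1 * real M2)) * (\<Sum>m<M1. \<Sum>a\<in>{0..<M2}. ?G m a a)"
    using c(2) by (simp add: power2_eq_square flip: sum_distrib_left)
  also have "(\<Sum>m<M1. \<Sum>a\<in>{0..<M2}. ?G m a a) = (\<Sum>s\<in>{0..<M1} \<times> {0..<M2}. pairing (words n) \<sigma> (hit_ker N n C s s))"
  proof -
    have "(\<Sum>s\<in>{0..<M1} \<times> {0..<M2}. pairing (words n) \<sigma> (hit_ker N n C s s))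
       = (\<Sum>s\<in>{0..<M1} \<times> {0..<M2}. ?G (fst s) (snd s) (snd s))"
      by (intro sum.cong refl pairing_hit_ker[OF C]) (use c(3) in auto)
    then show ?thesis by (simp add: sum.cartesian_product' lessThan_atLeast0)
  qed
  finally show ?thesis .
qed

text \<open>Together with \<open>ent_ker_psd\<close> this places the kernel of a code between 0 and
  1, the range required by the tensor inequality and by the concentration bound.\<close>

lemma pairing_ent_ker_le:
  assumes N: "channel UNIV UNIV N" and C: "is_cet_code n M1 M2 C" and \<sigma>: "psd (words n) \<sigma>"
  shows "pairing (words n) \<sigma> (ent_ker N n M1 M2 C C) \<le> tr (words n) \<sigma>"
proof -
  note c = is_cet_codeD[OF C]
  have "pairing (words n) \<sigma> (ent_ker N n M1 M2 C C) \<le>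
    of_real (1 / (real M1 * real M2)) * (\<Sum>s\<in>{0..<M1} \<times> {0..<M2}. pairing (words n) \<sigma> (hit_ker N n C s s))"
    by (rule pairing_ent_ker_le_hit[OF N C \<sigma>])
  also have "\<dots> \<le> of_real (1 / (real M1 * real M2)) * (\<Sum>s\<in>{0..<M1} \<times> {0..<M2}. tr (words n) \<sigma>)"
    by (intro mult_left_mono sum_mono pairing_hit_ker_le[OF N C _ _ \<sigma>]) (use c(3) in \<open>auto simp: less_eq_complex_def\<close>)
  also have "\<dots> = tr (words n) \<sigma>" using c(1,2) by simp
  finally show ?thesis .
qed

section \<open>Sending the choice of a code over a prefix\<close>

lemma psd_extend:
  assumes "psd I X" "I \<subseteq> J" "finite J" "\<And>i j. \<not> (i \<in> I \<and> j \<in> I) \<Longrightarrow> X i j = 0"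
  shows "psd J X"
proof -
  have "sesq J X v v = sesq I X v v" for v
  proof -
    have "sesq J X v v = (\<Sum>i\<in>I. \<Sum>j\<in>J. cnj (v i) * X i j * v j)"
      unfolding sesq_def by (rule sum.mono_neutral_right) (use assms in auto)
    also have "\<dots> = sesq I X v v"
      unfolding sesq_def by (intro sum.cong refl sum.mono_neutral_right) (use assms in auto)
    finally show ?thesis .
  qed
  then show ?thesis using assms(1) by (simp add: psd_iff_sesq)
qed

text \<open>A larger output space only adds zero rows and columns. The codes that are combined may
  have different output dimensions and are padded to a common one.\<close>

lemma choi_psd_extend:
  assumes "completely_positive I J \<Phi>" "finite I" "finite J'" "J \<subseteq> J'"
  shows "psd (I \<times> J') (choi \<Phi>)"
proof -
  have fJ: "finite J" using assms(3,4) by (rule rev_finite_subset)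
  have lin: "linmap I J \<Phi>" using assms(1) by (simp add: completely_positive_def)
  have "psd (I \<times> J) (choi \<Phi>)" by (rule choi_psd[OF assms(1,2) fJ])
  then have "psd (I \<times> J) (\<lambda>p q. if p \<in> I \<times> J \<and> q \<in> I \<times> J then choi \<Phi> p q else 0)"
    by (simp cong: psd_cong)
  then have "psd (I \<times> J') (\<lambda>p q. if p \<in> I \<times> J \<and> q \<in> I \<times> J then choi \<Phi> p q else 0)"
    by (rule psd_extend) (use assms in auto)
  also have "?this = psd (I \<times> J') (choi \<Phi>)"
    by (rule psd_cong) (use linmap_outside[OF lin] in \<open>auto simp: choi_def\<close>)
  finally show ?thesis .
qed

lemma completely_positive_trace_nonneg:
  assumes cp: "completely_positive I J \<Phi>" and fin: "finite I" "finite J" and X: "psd I X"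
  shows "0 \<le> tr J (\<Phi> X)"
proof -
  have lin: "linmap I J \<Phi>" using cp by (simp add: completely_positive_def)
  have "tr J (\<Phi> X) = (\<Sum>k\<in>J. pairing I X (\<lambda>i j. choi \<Phi> (i, k) (j, k)))"
    unfolding tr_def pairing_def choi_def prod.case by (intro sum.cong refl linmap_apply[OF lin])
  moreover have "psd I (\<lambda>i j. choi \<Phi> (i, k) (j, k))" if "k \<in> J" for k
    by (rule psd_pullback[OF fin(1) _ choi_psd[OF cp fin]]) (use fin that in auto)
  ultimately show ?thesis by (simp add: sum_nonneg pairing_nonneg[OF fin(1) X])
qed

text \<open>Choi positivity and one trace identity for the summed decoders suffice: on a positive
  input all decoders have nonnegative trace, so each is bounded by the sum, which equals the trace
  of the input.\<close>

lemma is_cet_codeI: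
  fixes C :: "('a::finite, 'b::finite) cet_code"
  assumes M: "1 \<le> M1" "1 \<le> M2" "M2 \<le> dimFB C"
    and enc: "\<And>m. m < M1 \<Longrightarrow> linmap {0..<M2} (words n) (enc C m)"
      "\<And>m. m < M1 \<Longrightarrow> psd ({0..<M2} \<times> words n) (choi (enc C m))"
      "\<And>m X. m < M1 \<Longrightarrow> tr (words n) (enc C m X) = tr {0..<M2} X"
    and dec: "\<And>m. m < M1 \<Longrightarrow> linmap (words n) {0..<dimFB C} (dec C m)"
      "\<And>m. m < M1 \<Longrightarrow> psd (words n \<times> {0..<dimFB C}) (choi (dec C m))"
      "\<And>Y. (\<Sum>m<M1. tr {0..<dimFB C} (dec C m Y)) = tr (words n) Y"
  shows "is_cet_code n M1 M2 C"
proof -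
  have fin: "finite (words n :: 'a list set)" "finite (words n :: 'b list set)"
    by (auto simp: finite_nlists)
  have cp: "completely_positive (words n) {0..<dimFB C} (dec C m)" if "m < M1" for m
    by (rule completely_positive_of_choi[OF dec(1)[OF that] dec(2)[OF that]]) (use fin in auto)
  have ni: "trace_nonincreasing (words n) {0..<dimFB C} (dec C m)" if "m < M1" for m
    unfolding trace_nonincreasing_def
  proof (intro allI impI)
    fix X :: "'b list cop" assume X: "psd (words n) X"
    have "tr {0..<dimFB C} (dec C m X) \<le> (\<Sum>m<M1. tr {0..<dimFB C} (dec C m X))"
      by (rule member_le_sum[where f="\<lambda>m. tr {0..<dimFB C} (dec C m X)"])
        (use that cp X fin in \<open>auto intro: completely_positive_trace_nonneg\<close>)
    then show "Re (tr {0..<dimFB C} (dec C m X)) \<le> Re (tr (words n) X)"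
      using dec(3) by (simp add: less_eq_complex_def)
  qed
  have "trace_preserving (words n) {0..<dimFB C} (\<lambda>Y k l. \<Sum>m<M1. dec C m Y k l)"
    unfolding trace_preserving_def
  proof
    fix Y :: "'b list cop"
    have "tr {0..<dimFB C} (\<lambda>k l. \<Sum>m<M1. dec C m Y k l) = (\<Sum>m<M1. tr {0..<dimFB C} (dec C m Y))"
      unfolding tr_def by (rule sum.swap)
    then show "tr {0..<dimFB C} (\<lambda>k l. \<Sum>m<M1. dec C m Y k l) = tr (words n) Y"
      by (simp only: dec(3))
  qed
  moreover have "channel {0..<M2} (words n) (enc C m)" if "m < M1" for m
    unfolding channel_def trace_preserving_def
    using completely_positive_of_choi[OF enc(1)[OF that] enc(2)[OF that]] enc(3)[OF that] fin by auto
  ultimately show ?thesis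
    using M cp ni by (simp add: is_cet_code_def)
qed

text \<open>An outcome outside of \<open>F_A\<close> is an error, but some code has to be run on the
  suffix for the summed decoder to preserve the trace. Index 0 always labels a code.\<close>

definition pick :: "nat \<Rightarrow> nat \<times> nat \<Rightarrow> nat \<times> nat" where
  "pick M r = (fst r, if snd r < M then snd r else 0)"

text \<open>The first \<open>k\<close> channel uses carry the classical message \<open>s = (m, i)\<close>, sent as the basis state
  \<open>i\<close> through the encoder of message \<open>m\<close> of \<open>Cd\<close>; the remaining \<open>l\<close> uses run the code \<open>Cs s\<close>.
  Decoding outcomes \<open>i\<close> outside of \<open>F_A\<close> are reassigned by \<open>pick\<close>.\<close>
definition comb_code :: "nat \<Rightarrow> nat \<Rightarrow> nat \<Rightarrow> nat \<Rightarrow> ('a, 'b) cet_code \<Rightarrow> (nat \<times> nat \<Rightarrow> ('a, 'b) cet_code) \<Rightarrow> ('a, 'b) cet_code" where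
  "comb_code k l K1 K2 Cd Cs = \<lparr>
     dimFB = (\<Sum>s\<in>{0..<K1} \<times> {0..<K2}. dimFB (Cs s)),
     enc = (\<lambda>m X x x'. if x \<in> words (k + l) \<and> x' \<in> words (k + l)
       then of_real (1 / (real K1 * real K2)) * (\<Sum>s\<in>{0..<K1} \<times> {0..<K2}.
         enc Cd (fst s) (eunit (snd s) (snd s)) (take k x) (take k x') * enc (Cs s) m X (drop k x) (drop k x'))
       else 0),
     dec = (\<lambda>m Y f f'. \<Sum>y\<in>words (k + l). \<Sum>y'\<in>words (k + l). Y y y' *
       (\<Sum>r\<in>{0..<K1} \<times> {0..<dimFB Cd}. dec Cd (fst r) (eunit (take k y) (take k y')) (snd r) (snd r) *
          dec (Cs (pick K2 r)) m (eunit (drop k y) (drop k y')) f f')) \<rparr>"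

lemma sum_eunit:
  assumes "finite I" "y \<in> I" "y' \<in> I"
  shows "(\<Sum>z\<in>I. \<Sum>z'\<in>I. eunit y y' z z' * R z z') = R y y'"
proof -
  have "(\<Sum>z\<in>I. \<Sum>z'\<in>I. eunit y y' z z' * R z z') = (\<Sum>z\<in>I. \<Sum>z'\<in>I. if z' = y' then (if z = y then R y y' else 0) else 0)"
    unfolding eunit_def by (intro sum.cong) auto
  then show ?thesis using assms by simp
qed

lemma comb_code_dec_eunit:
  fixes Cd :: "('a, 'b::finite) cet_code"
  assumes "length y = k + l" "length y' = k + l"
  shows "dec (comb_code k l K1 K2 Cd Cs) m (eunit y y') f f' =
    (\<Sum>r\<in>{0..<K1} \<times> {0..<dimFB Cd}. dec Cd (fst r) (eunit (take k y) (take k y')) (snd r) (snd r) *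
          dec (Cs (pick K2 r)) m (eunit (drop k y) (drop k y')) f f')"
  unfolding comb_code_def using assms by (simp add: sum_eunit finite_nlists in_nlists_UNIV)

lemma idop_take_drop: "idop (take k y) (take k y') * idop (drop k y) (drop k y') = idop y y'"
proof -
  have "y = y' \<longleftrightarrow> take k y = take k y' \<and> drop k y = drop k y'"
    by (metis append_take_drop_id)
  then show ?thesis by (auto simp: idop_def)
qed

lemma sum_tr_dec_eunit:
  fixes C :: "('a, 'b::finite) cet_code"
  assumes C: "is_cet_code n M1 M2 C" and y: "length y = n" "length y' = n" and W: "dimFB C \<le> W"
  shows "(\<Sum>m<M1. tr {0..<W} (dec C m (eunit y y'))) = idop y y'"
proof -
  note c = is_cet_codeD[OF C]
  have "tr {0..<W} (dec C m (eunit y y')) = tr {0..<dimFB C} (dec C m (eunit y y'))" if "m < M1" for m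
    unfolding tr_def by (rule sum.mono_neutral_right) (use W linmap_outside[OF c(9)[OF that]] in auto)
  then have "(\<Sum>m<M1. tr {0..<W} (dec C m (eunit y y'))) = tr {0..<dimFB C} (\<lambda>k l. \<Sum>m<M1. dec C m (eunit y y') k l)"
    unfolding tr_def by (subst sum.swap) simp
  also have "\<dots> = tr (words n) (eunit y y')"
    using c(7) by (simp add: trace_preserving_def)
  also have "\<dots> = idop y y'" using y by (intro tr_eunit) (auto simp: finite_nlists in_nlists_UNIV)
  finally show ?thesis .
qed

text \<open>Both Choi matrices are sums of Schur products of a prefix factor and a suffix factor,
  and traces factor at the cut. The random choice of \<open>s\<close> is absorbed into the encoder
  as a uniform mixture, so the resulting code is deterministic.\<close>

lemma comb_code_is_code:
  fixes Cd :: "('a::finite, 'b::finite) cet_code"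
  assumes Cd: "is_cet_code k K1 K2 Cd" and Cs: "\<And>s. s \<in> {0..<K1} \<times> {0..<K2} \<Longrightarrow> is_cet_code l M1 M2 (Cs s)"
  shows "is_cet_code (k + l) M1 M2 (comb_code k l K1 K2 Cd Cs)"
proof -
  let ?C = "comb_code k l K1 K2 Cd Cs"
  let ?K = "{0..<K1} \<times> {0..<K2}" and ?R = "{0..<K1} \<times> {0..<dimFB Cd}"
  let ?LA = "words (k + l) :: 'a list set" and ?LB = "words (k + l) :: 'b list set"
  note d = is_cet_codeD[OF Cd]
  note c = is_cet_codeD[OF Cs]
  have s0: "(0, 0) \<in> ?K" using d(1,2) by auto
  have finA: "finite ?LA" and finB: "finite ?LB" by (auto simp: finite_nlists)
  have pick: "pick K2 r \<in> ?K" if "r \<in> ?R" for r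
    using that d(2) by (auto simp: pick_def)
  \<comment> \<open>The sum of the output dimensions is simply a common upper bound for all of
    them.\<close>
  have W: "dimFB (Cs s) \<le> dimFB ?C" if "s \<in> ?K" for s
    unfolding comb_code_def using that by (auto intro: member_le_sum)
  have tdA: "take k x \<in> words k" "drop k x \<in> words l" if "x \<in> words (k + l)" for x :: "'z list"
    using that by (auto simp: in_nlists_UNIV)
  show ?thesis
  proof (rule is_cet_codeI)
    show "1 \<le> M1" "1 \<le> M2" using c(1,2)[OF s0] .
    show "M2 \<le> dimFB ?C" using c(3)[OF s0] W[OF s0] by simp
  next
    fix m assume m: "m < M1"
    show "linmap {0..<M2} ?LA (enc ?C m)"
      unfolding linmap_def
    proof (intro allI)
      fix X x x'
      show "enc ?C m X x x' = (if x \<in> ?LA \<and> x' \<in> ?LA then \<Sum>i\<in>{0..<M2}. \<Sum>j\<in>{0..<M2}. X i j * enc ?C m (eunit i j) x x' else 0)"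
      proof (cases "x \<in> ?LA \<and> x' \<in> ?LA")
        case True
        let ?A = "\<lambda>s. enc Cd (fst s) (eunit (snd s) (snd s)) (take k x) (take k x')"
        let ?B = "\<lambda>s i j. enc (Cs s) m (eunit i j) (drop k x) (drop k x')"
        let ?c = "of_real (1 / (real K1 * real K2)) :: complex"
        have "enc ?C m X x x' = ?c * (\<Sum>s\<in>?K. ?A s * enc (Cs s) m X (drop k x) (drop k x'))"
          using True by (simp add: comb_code_def)
        also have "\<dots> = ?c * (\<Sum>s\<in>?K. ?A s * (\<Sum>i\<in>{0..<M2}. \<Sum>j\<in>{0..<M2}. X i j * ?B s i j))"
          by (intro arg_cong2[where f="(*)"] refl sum.cong linmap_apply[OF c(8)[OF _ m]]) (use True tdA in auto)
        also have "\<dots> = (\<Sum>s\<in>?K. \<Sum>i\<in>{0..<M2}. \<Sum>j\<in>{0..<M2}. X i j * (?c * (?A s * ?B s i j)))"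
          by (simp only: sum_distrib_left mult_ac)
        also have "\<dots> = (\<Sum>i\<in>{0..<M2}. \<Sum>s\<in>?K. \<Sum>j\<in>{0..<M2}. X i j * (?c * (?A s * ?B s i j)))"
          by (rule sum.swap)
        also have "\<dots> = (\<Sum>i\<in>{0..<M2}. \<Sum>j\<in>{0..<M2}. \<Sum>s\<in>?K. X i j * (?c * (?A s * ?B s i j)))"
          by (intro sum.cong refl sum.swap)
        also have "\<dots> = (\<Sum>i\<in>{0..<M2}. \<Sum>j\<in>{0..<M2}. X i j * enc ?C m (eunit i j) x x')"
          using True by (simp add: comb_code_def sum_distrib_left del: of_real_divide)
        finally show ?thesis using True by simp
      next
        case False
        show ?thesis unfolding comb_code_def by (simp only: False if_False cet_code.select_convs)
      qed
    qed
    let ?S = "{0..<M2} \<times> ?LA"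
    have finS: "finite ?S" using finA by simp
    have "psd ?S (\<lambda>p q. of_real (1 / (real K1 * real K2)) * (\<Sum>s\<in>?K.
        choi (enc Cd (fst s)) (snd s, take k (snd p)) (snd s, take k (snd q)) *
        choi (enc (Cs s) m) (fst p, drop k (snd p)) (fst q, drop k (snd q))))"
    proof (intro psd_scale psd_sum psd_schur finS)
      fix s assume s: "s \<in> ?K"
      have 1: "psd ({0..<K2} \<times> words k) (choi (enc Cd (fst s)))"
        by (rule choi_psd) (use d(4) s in \<open>auto simp: finite_nlists\<close>)
      show "psd ?S (\<lambda>p q. choi (enc Cd (fst s)) (snd s, take k (snd p)) (snd s, take k (snd q)))"
        by (rule psd_pullback[OF finS _ 1]) (use s tdA in \<open>auto simp: finite_nlists\<close>)
      have 2: "psd ({0..<M2} \<times> words l) (choi (enc (Cs s) m))"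
        by (rule choi_psd) (use c(4)[OF s m] in \<open>auto simp: finite_nlists\<close>)
      show "psd ?S (\<lambda>p q. choi (enc (Cs s) m) (fst p, drop k (snd p)) (fst q, drop k (snd q)))"
        by (rule psd_pullback[OF finS _ 2]) (use s tdA in \<open>auto simp: finite_nlists\<close>)
    qed simp
    also have "?this = psd ?S (choi (enc ?C m))"
      by (rule psd_cong) (auto simp: choi_def comb_code_def)
    finally show "psd ?S (choi (enc ?C m))" .
    fix X :: "nat cop"
    have "tr ?LA (enc ?C m X) = (\<Sum>x\<in>?LA. of_real (1 / (real K1 * real K2)) * (\<Sum>s\<in>?K.
         enc Cd (fst s) (eunit (snd s) (snd s)) (take k x) (take k x) * enc (Cs s) m X (drop k x) (drop k x)))"
      unfolding tr_def comb_code_def by (intro sum.cong refl) simp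
    also have "\<dots> = of_real (1 / (real K1 * real K2)) * (\<Sum>s\<in>?K. \<Sum>x\<in>?LA.
         enc Cd (fst s) (eunit (snd s) (snd s)) (take k x) (take k x) * enc (Cs s) m X (drop k x) (drop k x))"
      unfolding sum_distrib_left by (rule sum.swap)
    also have "\<dots> = of_real (1 / (real K1 * real K2)) * (\<Sum>s\<in>?K. tr {0..<M2} X)"
    proof (intro arg_cong2[where f="(*)"] refl sum.cong)
      fix s assume s: "s \<in> ?K"
      have "(\<Sum>x\<in>?LA. enc Cd (fst s) (eunit (snd s) (snd s)) (take k x) (take k x) * enc (Cs s) m X (drop k x) (drop k x))
        = tr (words k) (enc Cd (fst s) (eunit (snd s) (snd s))) * tr (words l) (enc (Cs s) m X)"
        unfolding sum_nlists_append tr_def sum_product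
        by (intro sum.cong refl) (simp add: in_nlists_UNIV)
      also have "tr (words k) (enc Cd (fst s) (eunit (snd s) (snd s))) = tr {0..<K2} (eunit (snd s) (snd s))"
        using d(5)[of "fst s"] s by (auto simp: trace_preserving_def)
      also have "\<dots> = 1" using s by (auto simp: tr_eunit idop_def)
      also have "tr (words l) (enc (Cs s) m X) = tr {0..<M2} X"
        using c(5)[OF s m] by (auto simp: trace_preserving_def)
      finally show "(\<Sum>x\<in>?LA. enc Cd (fst s) (eunit (snd s) (snd s)) (take k x) (take k x) * enc (Cs s) m X (drop k x) (drop k x))
        = tr {0..<M2} X" by simp
    qed
    also have "\<dots> = tr {0..<M2} X" using d(1,2) by simp
    finally show "tr ?LA (enc ?C m X) = tr {0..<M2} X" .
  next
    fix m assume m: "m < M1"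
    have lin: "linmap (words l) {0..<dimFB (Cs (pick K2 r))} (dec (Cs (pick K2 r)) m)" if "r \<in> ?R" for r
      using c(9)[OF pick[OF that] m] .
    have e: "dec ?C m Y f f' = (\<Sum>y\<in>?LB. \<Sum>y'\<in>?LB. Y y y' * dec ?C m (eunit y y') f f')" for Y f f'
    proof -
      have "dec ?C m Y f f' = (\<Sum>y\<in>?LB. \<Sum>y'\<in>?LB. Y y y' * (\<Sum>r\<in>?R. dec Cd (fst r) (eunit (take k y) (take k y')) (snd r) (snd r) *
          dec (Cs (pick K2 r)) m (eunit (drop k y) (drop k y')) f f'))"
        by (simp add: comb_code_def)
      also have "\<dots> = (\<Sum>y\<in>?LB. \<Sum>y'\<in>?LB. Y y y' * dec ?C m (eunit y y') f f')"
        by (intro sum.cong refl) (simp add: comb_code_dec_eunit in_nlists_UNIV)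
      finally show ?thesis .
    qed
    have z: "dec ?C m Y f f' = 0" if "\<not> (f \<in> {0..<dimFB ?C} \<and> f' \<in> {0..<dimFB ?C})" for Y f f'
    proof -
      have "dec (Cs (pick K2 r)) m Z f f' = 0" if "r \<in> ?R" for r Z
        by (rule linmap_outside[OF lin[OF that]])
          (use W[OF pick[OF that]] \<open>\<not> (f \<in> {0..<dimFB ?C} \<and> f' \<in> {0..<dimFB ?C})\<close> in auto)
      then show ?thesis by (simp add: comb_code_def)
    qed
    show "linmap ?LB {0..<dimFB ?C} (dec ?C m)"
      unfolding linmap_def
    proof (intro allI)
      fix X f f'
      show "dec ?C m X f f' = (if f \<in> {0..<dimFB ?C} \<and> f' \<in> {0..<dimFB ?C}
        then \<Sum>i\<in>?LB. \<Sum>j\<in>?LB. X i j * dec ?C m (eunit i j) f f' else 0)"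
      proof (cases "f \<in> {0..<dimFB ?C} \<and> f' \<in> {0..<dimFB ?C}")
        case True
        then show ?thesis by (simp only: if_True simp_thms) (rule e)
      next
        case False
        show ?thesis by (simp only: False if_False z[OF False])
      qed
    qed
    let ?S = "?LB \<times> {0..<dimFB ?C}"
    have finS: "finite ?S" using finB by simp
    have "psd ?S (\<lambda>p q. \<Sum>r\<in>?R. choi (dec Cd (fst r)) (take k (fst p), snd r) (take k (fst q), snd r) *
        choi (dec (Cs (pick K2 r)) m) (drop k (fst p), snd p) (drop k (fst q), snd q))"
    proof (intro psd_sum psd_schur finS)
      fix r assume r: "r \<in> ?R"
      have 1: "psd (words k \<times> {0..<dimFB Cd}) (choi (dec Cd (fst r)))"
        by (rule choi_psd) (use d(6) r in \<open>auto simp: finite_nlists\<close>)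
      show "psd ?S (\<lambda>p q. choi (dec Cd (fst r)) (take k (fst p), snd r) (take k (fst q), snd r))"
        by (rule psd_pullback[OF finS _ 1]) (use r tdA in \<open>auto simp: finite_nlists\<close>)
      have 2: "psd (words l \<times> {0..<dimFB ?C}) (choi (dec (Cs (pick K2 r)) m))"
        by (rule choi_psd_extend[OF c(6)[OF pick[OF r] m]]) (use W[OF pick[OF r]] in \<open>auto simp: finite_nlists\<close>)
      show "psd ?S (\<lambda>p q. choi (dec (Cs (pick K2 r)) m) (drop k (fst p), snd p) (drop k (fst q), snd q))"
        by (rule psd_pullback[OF finS _ 2]) (use tdA in \<open>auto simp: finite_nlists\<close>)
    qed
    also have "?this = psd ?S (choi (dec ?C m))"
      by (rule psd_cong) (auto simp: choi_def comb_code_dec_eunit in_nlists_UNIV)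
    finally show "psd ?S (choi (dec ?C m))" .
  next
    fix Y :: "'b list cop"
    let ?W = "{0..<dimFB ?C}"
    let ?D = "\<lambda>r y y'. dec Cd (fst r) (eunit (take k y) (take k y')) (snd r) (snd r)"
    let ?E = "\<lambda>r m y y' f. dec (Cs (pick K2 r)) m (eunit (drop k y) (drop k y')) f f"
    have "(\<Sum>m<M1. tr ?W (dec ?C m Y)) = (\<Sum>m<M1. \<Sum>f\<in>?W. \<Sum>y\<in>?LB. \<Sum>y'\<in>?LB. \<Sum>r\<in>?R. Y y y' * (?D r y y' * ?E r m y y' f))"
      unfolding tr_def by (intro sum.cong refl) (simp add: comb_code_def sum_distrib_left)
    also have "\<dots> = (\<Sum>y\<in>?LB. \<Sum>y'\<in>?LB. \<Sum>r\<in>?R. \<Sum>m<M1. \<Sum>f\<in>?W. Y y y' * (?D r y y' * ?E r m y y' f))"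
      unfolding sum.cartesian_product
      by (rule sum.reindex_bij_witness[where i="\<lambda>(y,y',r,m,f). (m,f,y,y',r)" and j="\<lambda>(m,f,y,y',r). (y,y',r,m,f)"]) auto
    also have "\<dots> = (\<Sum>y\<in>?LB. \<Sum>y'\<in>?LB. \<Sum>r\<in>?R. Y y y' * (?D r y y' * (\<Sum>m<M1. tr ?W (dec (Cs (pick K2 r)) m (eunit (drop k y) (drop k y'))))))"
      unfolding tr_def by (simp only: sum_distrib_left)
    \<comment> \<open>For each prefix outcome \<open>r\<close>, the suffix decoders of the one code
      selected by \<open>r\<close> are summed first and leave an identity that does not depend on
      \<open>r\<close>. Only then can the outcomes be summed.\<close>
    also have "\<dots> = (\<Sum>y\<in>?LB. \<Sum>y'\<in>?LB. \<Sum>r\<in>?R. Y y y' * (?D r y y' * idop (drop k y) (drop k y')))"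
      by (intro sum.cong refl arg_cong2[where f="(*)"] sum_tr_dec_eunit[OF Cs[OF pick]] W[OF pick])
        (auto simp: in_nlists_UNIV)
    also have "\<dots> = (\<Sum>y\<in>?LB. \<Sum>y'\<in>?LB. Y y y' * ((\<Sum>r\<in>?R. ?D r y y') * idop (drop k y) (drop k y')))"
      by (simp only: sum_distrib_left sum_distrib_right)
    also have "\<dots> = (\<Sum>y\<in>?LB. \<Sum>y'\<in>?LB. Y y y' * (idop (take k y) (take k y') * idop (drop k y) (drop k y')))"
    proof (intro sum.cong refl arg_cong2[where f="(*)"])
      fix y y' :: "'b list" assume y: "y \<in> ?LB" "y' \<in> ?LB"
      have "(\<Sum>r\<in>?R. ?D r y y') = (\<Sum>m<K1. tr {0..<dimFB Cd} (dec Cd m (eunit (take k y) (take k y'))))"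
        unfolding tr_def by (simp add: sum.cartesian_product' lessThan_atLeast0)
      also have "\<dots> = idop (take k y) (take k y')"
        by (rule sum_tr_dec_eunit[OF Cd]) (use y in \<open>auto simp: in_nlists_UNIV\<close>)
      finally show "(\<Sum>r\<in>?R. ?D r y y') = idop (take k y) (take k y')" .
    qed
    also have "\<dots> = (\<Sum>y\<in>?LB. \<Sum>y'\<in>?LB. Y y y' * idop y y')"
      by (intro sum.cong refl arg_cong2[where f="(*)"] idop_take_drop)
    also have "\<dots> = tr ?LB Y"
      using pairing_idop[OF finB, of Y] by (simp add: pairing_def)
    finally show "(\<Sum>m<M1. tr ?W (dec ?C m Y)) = tr ?LB Y" .
  qed
qed

section \<open>Product kernels and the marginals of the jammer state\<close>

definition tens :: "nat \<Rightarrow> 'x list cop \<Rightarrow> 'x list cop \<Rightarrow> 'x list cop" where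
  "tens k A B = (\<lambda>j j'. A (take k j) (take k j') * B (drop k j) (drop k j'))"

lemma tens_psd:
  fixes A B :: "'x::finite list cop"
  assumes "psd (words k) A" "psd (words l) B"
  shows "psd (words (k + l)) (tens k A B)"
  unfolding tens_def
  by (intro psd_schur psd_pullback[OF _ _ assms(1)] psd_pullback[OF _ _ assms(2)])
    (auto simp: finite_nlists in_nlists_UNIV)

text \<open>Bilinearity of \<open>tker\<close> in encoder and decoder, then factorization at the
  cut. Each pair of sent message \<open>s\<close> and outcome \<open>r\<close> contributes the
  kernel of that prefix event, tensored with the kernel of encoding with \<open>Cs s\<close> and
  decoding with the code picked by \<open>r\<close>.\<close>

lemma ent_ker_comb_code:
  assumes j: "length j = k + l" "length j' = k + l"
  shows "ent_ker N (k + l) M1 M2 (comb_code k l K1 K2 Cd Cs) (comb_code k l K1 K2 Cd Cs) j j' =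
    of_real (1 / (real K1 * real K2)) * (\<Sum>s\<in>{0..<K1} \<times> {0..<K2}. \<Sum>r\<in>{0..<K1} \<times> {0..<dimFB Cd}.
      tens k (hit_ker N k Cd s r) (ent_ker N l M1 M2 (Cs s) (Cs (pick K2 r))) j j')"
proof -
  let ?C = "comb_code k l K1 K2 Cd Cs" and ?c = "of_real (1 / (real K1 * real K2)) :: complex"
  let ?K = "{0..<K1} \<times> {0..<K2}" and ?R = "{0..<K1} \<times> {0..<dimFB Cd}" and ?Q = "{0..<M2}"
  let ?e = "of_real (1 / (real M1 * (real M2)\<^sup>2)) :: complex"
  let ?P1 = "\<lambda>s. enc Cd (fst s) (eunit (snd s) (snd s))" and ?P2 = "\<lambda>m s a b. enc (Cs s) m (eunit a b)"
  let ?D1 = "\<lambda>r y y'. dec Cd (fst r) (eunit y y') (snd r) (snd r)"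
  let ?D2 = "\<lambda>m r a b y y'. dec (Cs (pick K2 r)) m (eunit y y') a b"
  let ?T = "\<lambda>m s r. tker N l ?Q (?P2 m s) (?D2 m r) (drop k j) (drop k j')"
  have t: "tker N (k + l) ?Q (\<lambda>a b. enc ?C m (eunit a b)) (\<lambda>a b y y'. dec ?C m (eunit y y') a b) j j'
     = ?c * (\<Sum>s\<in>?K. \<Sum>r\<in>?R. hit_ker N k Cd s r (take k j) (take k j') * ?T m s r)" for m
  proof -
    have "tker N (k + l) ?Q (\<lambda>a b. enc ?C m (eunit a b)) (\<lambda>a b y y'. dec ?C m (eunit y y') a b) j j'
      = tker N (k + l) ?Q (\<lambda>a b x x'. ?c * (\<Sum>s\<in>?K. ?P1 s (take k x) (take k x') * ?P2 m s a b (drop k x) (drop k x')))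
         (\<lambda>a b y y'. \<Sum>r\<in>?R. ?D1 r (take k y) (take k y') * ?D2 m r a b (drop k y) (drop k y')) j j'"
      by (rule tker_cong) (simp add: comb_code_def in_nlists_UNIV, simp add: comb_code_dec_eunit)
    also have "\<dots> = ?c * (\<Sum>s\<in>?K. \<Sum>r\<in>?R. tker N (k + l) ?Q (\<lambda>a b x x'. ?P1 s (take k x) (take k x') * ?P2 m s a b (drop k x) (drop k x'))
         (\<lambda>a b y y'. ?D1 r (take k y) (take k y') * ?D2 m r a b (drop k y) (drop k y')) j j')"
      by (simp only: tker_scale_left tker_sum_left tker_sum_right)
    also have "\<dots> = ?c * (\<Sum>s\<in>?K. \<Sum>r\<in>?R. hit_ker N k Cd s r (take k j) (take k j') * ?T m s r)"
    proof (intro arg_cong2[where f="(*)"] refl sum.cong)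
      fix s r
      have "length (take k j) = k" "length (take k j') = k" using j by auto
      from tker_append[OF this, of N l ?Q "?P1 s" "?P2 m s" "?D1 r" "?D2 m r" "drop k j" "drop k j'"]
      show "tker N (k + l) ?Q (\<lambda>a b x x'. ?P1 s (take k x) (take k x') * ?P2 m s a b (drop k x) (drop k x'))
         (\<lambda>a b y y'. ?D1 r (take k y) (take k y') * ?D2 m r a b (drop k y) (drop k y')) j j'
        = hit_ker N k Cd s r (take k j) (take k j') * ?T m s r"
        unfolding append_take_drop_id hit_ker_def .
    qed
    finally show ?thesis .
  qed
  have "ent_ker N (k + l) M1 M2 ?C ?C j j' = ?e * (\<Sum>m<M1. ?c * (\<Sum>s\<in>?K. \<Sum>r\<in>?R. hit_ker N k Cd s r (take k j) (take k j') * ?T m s r))"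
    unfolding ent_ker_def t ..
  also have "\<dots> = (\<Sum>m<M1. \<Sum>s\<in>?K. \<Sum>r\<in>?R. ?e * (?c * (hit_ker N k Cd s r (take k j) (take k j') * ?T m s r)))"
    by (simp only: sum_distrib_left)
  also have "\<dots> = (\<Sum>s\<in>?K. \<Sum>m<M1. \<Sum>r\<in>?R. ?e * (?c * (hit_ker N k Cd s r (take k j) (take k j') * ?T m s r)))"
    by (rule sum.swap)
  also have "\<dots> = (\<Sum>s\<in>?K. \<Sum>r\<in>?R. \<Sum>m<M1. ?e * (?c * (hit_ker N k Cd s r (take k j) (take k j') * ?T m s r)))"
    by (intro sum.cong refl sum.swap)
  also have "\<dots> = ?c * (\<Sum>s\<in>?K. \<Sum>r\<in>?R. tens k (hit_ker N k Cd s r) (ent_ker N l M1 M2 (Cs s) (Cs (pick K2 r))) j j')"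
    unfolding tens_def ent_ker_def by (simp only: sum_distrib_left mult_ac)
  finally show ?thesis .
qed

text \<open>The partial trace over the last \<open>l\<close> systems. Writing it with
  \<open>idop\<close> makes it visibly the adjoint, with respect to \<open>pairing\<close>, of
  tensoring with the identity.\<close>

definition marg1 :: "nat \<Rightarrow> 'x list cop \<Rightarrow> 'x list cop" where
  "marg1 l \<sigma> = (\<lambda>j j'. \<Sum>i\<in>words l. \<Sum>i'\<in>words l. \<sigma> (j @ i) (j' @ i') * idop i i')"

definition marg2 :: "nat \<Rightarrow> 'x list cop \<Rightarrow> 'x list cop" where
  "marg2 k \<sigma> = (\<lambda>j j'. \<Sum>i\<in>words k. \<Sum>i'\<in>words k. \<sigma> (i @ j) (i' @ j') * idop i i')"

lemma pairing_tens:
  "pairing (words (k + l)) \<sigma> (tens k A B) =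
   (\<Sum>j\<in>words k. \<Sum>j'\<in>words k. \<Sum>i\<in>words l. \<Sum>i'\<in>words l. \<sigma> (j @ i) (j' @ i') * (A j j' * B i i'))"
proof -
  have "pairing (words (k + l)) \<sigma> (tens k A B) =
    (\<Sum>j\<in>words k. \<Sum>i\<in>words l. \<Sum>j'\<in>words k. \<Sum>i'\<in>words l. \<sigma> (j @ i) (j' @ i') * (A j j' * B i i'))"
    unfolding pairing_def sum_nlists_append tens_def
    by (intro sum.cong refl) (simp add: in_nlists_UNIV)
  then show ?thesis by (simp only: sum.swap[of _ "words k" "words l"])
qed

lemma pairing_marg1: "pairing (words (k + l)) \<sigma> (tens k A idop) = pairing (words k) (marg1 l \<sigma>) A"
  unfolding pairing_tens unfolding pairing_def marg1_def by (simp only: sum_distrib_left sum_distrib_right mult_ac)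

lemma pairing_marg2: "pairing (words (k + l)) \<sigma> (tens k idop B) = pairing (words l) (marg2 k \<sigma>) B"
proof -
  have "pairing (words (k + l)) \<sigma> (tens k idop B) =
    (\<Sum>i\<in>words l. \<Sum>i'\<in>words l. \<Sum>j\<in>words k. \<Sum>j'\<in>words k. \<sigma> (j @ i) (j' @ i') * (idop j j' * B i i'))"
    unfolding pairing_tens sum.cartesian_product
    by (rule sum.reindex_bij_witness[where i="\<lambda>(i,i',j,j'). (j,j',i,i')" and j="\<lambda>(j,j',i,i'). (i,i',j,j')"]) auto
  then show ?thesis unfolding pairing_def marg2_def by (simp only: sum_distrib_left sum_distrib_right mult_ac)
qed

lemma tens_idop: "tens k idop idop = idop"
  unfolding tens_def idop_take_drop ..

text \<open>By adjointness, pairing a marginal with a positive kernel is pairing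
  \<open>\<sigma>\<close> with that kernel tensored with the identity, so positivity follows by
  duality.\<close>

lemma marg_state:
  fixes \<sigma> :: "'x::finite list cop"
  assumes "is_state (words (k + l)) \<sigma>"
  shows "is_state (words k) (marg1 l \<sigma>)" "is_state (words l) (marg2 k \<sigma>)"
proof -
  have fin: "finite (words m :: 'x list set)" for m by (simp add: finite_nlists)
  have \<sigma>: "psd (words (k + l)) \<sigma>" "tr (words (k + l)) \<sigma> = 1"
    using assms by (auto simp: is_state_def)
  have "psd (words k) (marg1 l \<sigma>)"
  proof (rule psd_of_pairing[OF fin])
    fix A :: "'x list cop" assume "psd (words k) A"
    then have "0 \<le> pairing (words (k + l)) \<sigma> (tens k A idop)"
      by (intro pairing_nonneg tens_psd psd_idop \<sigma> fin)
    then show "0 \<le> pairing (words k) A (marg1 l \<sigma>)"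
      unfolding pairing_marg1 by (simp add: pairing_def mult.commute)
  qed
  moreover have "tr (words k) (marg1 l \<sigma>) = 1"
    using pairing_marg1[of k l \<sigma> idop] \<sigma>(2) by (simp add: tens_idop pairing_idop fin)
  ultimately show "is_state (words k) (marg1 l \<sigma>)" by (simp add: is_state_def)
  have "psd (words l) (marg2 k \<sigma>)"
  proof (rule psd_of_pairing[OF fin])
    fix A :: "'x list cop" assume "psd (words l) A"
    then have "0 \<le> pairing (words (k + l)) \<sigma> (tens k idop A)"
      by (intro pairing_nonneg tens_psd psd_idop \<sigma> fin)
    then show "0 \<le> pairing (words l) A (marg2 k \<sigma>)"
      unfolding pairing_marg2 by (simp add: pairing_def mult.commute)
  qed
  moreover have "tr (words l) (marg2 k \<sigma>) = 1"
    using pairing_marg2[of k l \<sigma> idop] \<sigma>(2) by (simp add: tens_idop pairing_idop fin)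
  ultimately show "is_state (words l) (marg2 k \<sigma>)" by (simp add: is_state_def)
qed

text \<open>Expand the positive kernel (1 - A) \<otimes> (1 - B). This acts as a union bound for the
  two failure events, whatever the correlations in \<open>\<sigma>\<close>.\<close>

lemma pairing_tens_ge:
  fixes \<sigma> :: "'x::finite list cop"
  assumes \<sigma>: "is_state (words (k + l)) \<sigma>"
    and A: "psd (words k) (\<lambda>i j. idop i j - A i j)" and B: "psd (words l) (\<lambda>i j. idop i j - B i j)"
  shows "pairing (words k) (marg1 l \<sigma>) A + pairing (words l) (marg2 k \<sigma>) B - 1
    \<le> pairing (words (k + l)) \<sigma> (tens k A B)"
proof -
  have fin: "finite (words m :: 'x list set)" for m by (simp add: finite_nlists)
  have s: "psd (words (k + l)) \<sigma>" "tr (words (k + l)) \<sigma> = 1"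
    using \<sigma> by (auto simp: is_state_def)
  have "0 \<le> pairing (words (k + l)) \<sigma> (tens k (\<lambda>i j. idop i j - A i j) (\<lambda>i j. idop i j - B i j))"
    by (intro pairing_nonneg tens_psd A B s fin)
  also have "tens k (\<lambda>i j. idop i j - A i j) (\<lambda>i j. idop i j - B i j)
     = (\<lambda>i j. (tens k idop idop i j - tens k A idop i j) - (tens k idop B i j - tens k A B i j))"
    by (simp add: tens_def fun_eq_iff algebra_simps)
  also have "pairing (words (k + l)) \<sigma> \<dots> = (1 - pairing (words k) (marg1 l \<sigma>) A)
     - (pairing (words l) (marg2 k \<sigma>) B - pairing (words (k + l)) \<sigma> (tens k A B))"
    unfolding pairing_diff pairing_marg1 pairing_marg2 tens_idop by (simp add: pairing_idop fin s)
  finally show ?thesis by (simp add: less_eq_complex_def)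
qed

text \<open>The entanglement success of the prefix is at most its average classical success. For
  each \<open>s\<close>, the event that the prefix is read correctly is combined with the success of
  \<open>Cs s\<close> by \<open>pairing_tens_ge\<close>; the union bound is applied before averaging
  over \<open>s\<close>.\<close>

lemma cet_success_comb_code:
  fixes N :: "('a::finite, 'j::finite, 'b::finite) jchannel"
  assumes N: "channel UNIV UNIV N" and Cd: "is_cet_code k K1 K2 Cd"
    and Cs: "\<And>s. s \<in> {0..<K1} \<times> {0..<K2} \<Longrightarrow> is_cet_code l M1 M2 (Cs s)"
    and \<sigma>: "is_state (words (k + l)) \<sigma>"
  shows "cet_success K1 K2 Cd (jammed_channel N k (marg1 l \<sigma>)) +
      (1 / (real K1 * real K2)) * (\<Sum>s\<in>{0..<K1} \<times> {0..<K2}. cet_success M1 M2 (Cs s) (jammed_channel N l (marg2 k \<sigma>))) - 1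
    \<le> cet_success M1 M2 (comb_code k l K1 K2 Cd Cs) (jammed_channel N (k + l) \<sigma>)"
proof -
  let ?L = "words (k + l) :: 'j list set" and ?Lk = "words k :: 'j list set" and ?Ll = "words l :: 'j list set"
  let ?K = "{0..<K1} \<times> {0..<K2}" and ?R = "{0..<K1} \<times> {0..<dimFB Cd}"
  let ?c = "of_real (1 / (real K1 * real K2)) :: complex"
  let ?H = "\<lambda>s r. hit_ker N k Cd s r" and ?G = "\<lambda>s s'. ent_ker N l M1 M2 (Cs s) (Cs s')"
  note d = is_cet_codeD[OF Cd]
  have fin: "finite ?L" "finite ?Lk" "finite ?Ll" by (auto simp: finite_nlists)
  have s: "psd ?L \<sigma>" using \<sigma> by (simp add: is_state_def)
  have m1: "psd ?Lk (marg1 l \<sigma>)" and m2: "psd ?Ll (marg2 k \<sigma>)"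
    using marg_state[OF \<sigma>] by (auto simp: is_state_def)
  have c0: "0 \<le> ?c" by (simp add: less_eq_complex_def)
  have pick: "pick K2 r \<in> ?K" if "r \<in> ?R" for r
    using that d(2) by (auto simp: pick_def)
  have KR: "s \<in> ?R" "pick K2 s = s" if "s \<in> ?K" for s
    using that d(3) by (auto simp: pick_def prod_eq_iff)
  have "pairing ?Lk (marg1 l \<sigma>) (ent_ker N k K1 K2 Cd Cd) \<le> ?c * (\<Sum>s\<in>?K. pairing ?Lk (marg1 l \<sigma>) (?H s s))"
    by (rule pairing_ent_ker_le_hit[OF N Cd m1])
  then have "pairing ?Lk (marg1 l \<sigma>) (ent_ker N k K1 K2 Cd Cd) + ?c * (\<Sum>s\<in>?K. pairing ?Ll (marg2 k \<sigma>) (?G s s)) - 1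
     \<le> ?c * (\<Sum>s\<in>?K. pairing ?Lk (marg1 l \<sigma>) (?H s s)) + ?c * (\<Sum>s\<in>?K. pairing ?Ll (marg2 k \<sigma>) (?G s s)) - 1"
    by (simp add: less_eq_complex_def)
  also have "\<dots> = ?c * (\<Sum>s\<in>?K. pairing ?Lk (marg1 l \<sigma>) (?H s s) + pairing ?Ll (marg2 k \<sigma>) (?G s s) - 1)"
    using d(1,2) by (simp add: sum.distrib sum_subtractf field_simps)
  also have "\<dots> \<le> ?c * (\<Sum>s\<in>?K. pairing ?L \<sigma> (tens k (?H s s) (?G s s)))"
  proof (intro mult_left_mono[OF _ c0] sum_mono pairing_tens_ge[OF \<sigma>])
    fix s assume s: "s \<in> ?K"
    show "psd ?Lk (\<lambda>i j. idop i j - ?H s s i j)"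
      by (intro psd_idop_diff fin pairing_hit_ker_le[OF N Cd s KR(1)[OF s]])
    show "psd ?Ll (\<lambda>i j. idop i j - ?G s s i j)"
      by (intro psd_idop_diff fin pairing_ent_ker_le[OF N Cs[OF s]])
  qed
  \<comment> \<open>The terms added here belong to wrong outcomes \<open>r\<close>. They pair
    \<open>\<sigma>\<close> with positive kernels, including those for a mismatched encoder and
    decoder.\<close>
  also have "\<dots> \<le> ?c * (\<Sum>s\<in>?K. \<Sum>r\<in>?R. pairing ?L \<sigma> (tens k (?H s r) (?G s (pick K2 r))))"
  proof (intro mult_left_mono[OF _ c0] sum_mono)
    fix s assume s': "s \<in> ?K"
    have "pairing ?L \<sigma> (tens k (?H s s) (?G s (pick K2 s))) \<le> (\<Sum>r\<in>?R. pairing ?L \<sigma> (tens k (?H s r) (?G s (pick K2 r))))"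
    proof (rule member_le_sum[where f="\<lambda>r. pairing ?L \<sigma> (tens k (?H s r) (?G s (pick K2 r)))"])
      show "s \<in> ?R" by (rule KR[OF s'])
      fix r assume "r \<in> ?R - {s}"
      then have r: "r \<in> ?R" by simp
      show "0 \<le> pairing ?L \<sigma> (tens k (?H s r) (?G s (pick K2 r)))"
        by (intro pairing_nonneg fin s tens_psd hit_ker_psd[OF N Cd s' r] ent_ker_psd[OF N Cs[OF s'] Cs[OF pick[OF r]]])
    qed simp
    then show "pairing ?L \<sigma> (tens k (?H s s) (?G s s)) \<le> (\<Sum>r\<in>?R. pairing ?L \<sigma> (tens k (?H s r) (?G s (pick K2 r))))"
      unfolding KR(2)[OF s'] .
  qed
  also have "\<dots> = pairing ?L \<sigma> (\<lambda>j j'. ?c * (\<Sum>s\<in>?K. \<Sum>r\<in>?R. tens k (?H s r) (?G s (pick K2 r)) j j'))"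
    by (simp only: pairing_scale pairing_sum)
  also have "\<dots> = pairing ?L \<sigma> (ent_ker N (k + l) M1 M2 (comb_code k l K1 K2 Cd Cs) (comb_code k l K1 K2 Cd Cs))"
    unfolding pairing_def by (intro sum.cong refl arg_cong2[where f="(*)"] ent_ker_comb_code[symmetric]) (auto simp: in_nlists_UNIV)
  finally have "Re (pairing ?Lk (marg1 l \<sigma>) (ent_ker N k K1 K2 Cd Cd) + ?c * (\<Sum>s\<in>?K. pairing ?Ll (marg2 k \<sigma>) (?G s s)) - 1)
    \<le> Re (pairing ?L \<sigma> (ent_ker N (k + l) M1 M2 (comb_code k l K1 K2 Cd Cs) (comb_code k l K1 K2 Cd Cs)))"
    by (simp add: less_eq_complex_def)
  moreover have "Re (?c * (\<Sum>s\<in>?K. pairing ?Ll (marg2 k \<sigma>) (?G s s))) =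
     (1 / (real K1 * real K2)) * (\<Sum>s\<in>?K. cet_success M1 M2 (Cs s) (jammed_channel N l (marg2 k \<sigma>)))"
  proof -
    have "Re (of_real x * z) = x * Re z" for x z by simp
    then show ?thesis
      unfolding Re_sum by (simp only: Re_sum) (intro arg_cong2[where f="(*)"] refl sum.cong cet_success_eq[OF N Cs m2, symmetric])
  qed
  moreover have CC: "is_cet_code (k + l) M1 M2 (comb_code k l K1 K2 Cd Cs)"
    by (rule comb_code_is_code[OF Cd Cs])
  ultimately show ?thesis
    unfolding cet_success_eq[OF N CC s] cet_success_eq[OF N Cd m1]
    by (simp only: minus_complex.sel plus_complex.sel one_complex.sel)
qed

text \<open>The witness for the pair (0, 0): the sender emits a fixed word and the receiver outputs
  the trace in a one-dimensional space, so the success is exactly 1 against every jammer.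
  \<open>undefined\<close> stands for some fixed letter.\<close>

definition trivial_code :: "nat \<Rightarrow> ('a, 'b) cet_code" where
  "trivial_code n = \<lparr> dimFB = 1,
     enc = (\<lambda>m X x x'. if x = replicate n undefined \<and> x' = replicate n undefined then X 0 0 else 0),
     dec = (\<lambda>m Y f f'. if f = 0 \<and> f' = 0 then tr (words n) Y else 0) \<rparr>"

lemma trivial_code_is_code: "is_cet_code n 1 1 (trivial_code n :: ('a::finite, 'b::finite) cet_code)"
proof -
  let ?C = "trivial_code n :: ('a, 'b) cet_code"
  let ?x = "replicate n undefined :: 'a list"
  have fin: "finite (words n :: 'a list set)" "finite (words n :: 'b list set)"
    by (auto simp: finite_nlists)
  have x: "?x \<in> words n" by (simp add: in_nlists_UNIV)
  show ?thesis
  proof (rule is_cet_codeI)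
    show "1 \<le> dimFB ?C" by (simp add: trivial_code_def)
    fix m
    show "linmap {0..<1} (words n) (enc ?C m)"
      by (auto simp: linmap_def trivial_code_def eunit_def in_nlists_UNIV)
    have "psd ({0..<1::nat} \<times> words n) (\<lambda>p q. (if snd p = ?x then 1 else 0) * cnj (if snd q = ?x then 1 else 0))"
      by (rule psd_rank_one) (simp add: fin)
    also have "?this = psd ({0..<1} \<times> words n) (choi (enc ?C m))"
      by (rule psd_cong) (auto simp: choi_def trivial_code_def eunit_def)
    finally show "psd ({0..<1} \<times> words n) (choi (enc ?C m))" .
    show "tr (words n) (enc ?C m X) = tr {0..<1} X" for X
      using x fin(1) by (simp add: tr_def trivial_code_def)
    have t: "tr (words n) Y = (\<Sum>i\<in>words n. \<Sum>j\<in>words n. Y i j * tr (words n) (eunit i j))" for Y :: "'b list cop"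
    proof -
      have "(\<Sum>i\<in>words n. \<Sum>j\<in>words n. Y i j * tr (words n) (eunit i j)) = pairing (words n) Y idop"
        unfolding pairing_def by (intro sum.cong refl) (simp add: tr_eunit fin)
      then show ?thesis by (simp add: pairing_idop fin)
    qed
    show "linmap (words n) {0..<dimFB ?C} (dec ?C m)"
      unfolding linmap_def
    proof (intro allI)
      fix X f f'
      show "dec ?C m X f f' = (if f \<in> {0..<dimFB ?C} \<and> f' \<in> {0..<dimFB ?C}
        then \<Sum>i\<in>words n. \<Sum>j\<in>words n. X i j * dec ?C m (eunit i j) f f' else 0)"
        using t[of X] by (simp add: trivial_code_def)
    qed
    have "psd (nlists n (UNIV :: 'b set) \<times> {0..<dimFB ?C}) (\<lambda>p q. idop (fst p) (fst q))"
      by (rule psd_pullback[OF _ _ psd_idop[OF fin(2)]]) (auto simp: fin)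
    also have "?this = psd (words n \<times> {0..<dimFB ?C}) (choi (dec ?C m))"
      by (rule psd_cong) (auto simp: choi_def trivial_code_def tr_eunit fin)
    finally show "psd (words n \<times> {0..<dimFB ?C}) (choi (dec ?C m))" .
    show "(\<Sum>m<1. tr {0..<dimFB ?C} (dec ?C m Y)) = tr (words n) Y" for Y
      by (simp add: tr_def[of "{0..<dimFB ?C}"]) (simp add: trivial_code_def)
  qed simp_all
qed

lemma cet_success_trivial_code:
  fixes N :: "('a::finite, 'j::finite, 'b::finite) jchannel"
  assumes N: "channel UNIV UNIV N" and \<sigma>: "is_state (words n) \<sigma>"
  shows "cet_success 1 1 (trivial_code n) (jammed_channel N n \<sigma>) = 1"
proof -
  let ?C = "trivial_code n :: ('a, 'b) cet_code"
  have C: "is_cet_code n 1 1 ?C" by (rule trivial_code_is_code)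
  have s: "psd (words n) \<sigma>" "tr (words n) \<sigma> = 1" using \<sigma> by (auto simp: is_state_def)
  have "pairing (words n) \<sigma> (ent_ker N n 1 1 ?C ?C) = dec ?C 0 (jammed_channel N n \<sigma> (enc ?C 0 (eunit 0 0))) 0 0"
    using sum_dec_enc_eq_pairing[OF C, of N \<sigma>] by simp
  also have "\<dots> = tr (words n) (jammed_channel N n \<sigma> (enc ?C 0 (eunit 0 0)))"
    by (simp add: trivial_code_def)
  also have "\<dots> = tr (words n) (enc ?C 0 (eunit 0 0))"
    by (simp add: tr_jammed_channel[OF N] s)
  also have "\<dots> = 1"
    using is_cet_codeD(5)[OF C, of 0] by (simp add: trace_preserving_def tr_eunit idop_def)
  finally show ?thesis unfolding cet_success_eq[OF N C s(1)] by simp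
qed

lemma cet_success_bounds:
  assumes N: "channel UNIV UNIV N" and C: "is_cet_code n M1 M2 C" and \<sigma>: "is_state (words n) \<sigma>"
  shows "0 \<le> cet_success M1 M2 C (jammed_channel N n \<sigma>)" "cet_success M1 M2 C (jammed_channel N n \<sigma>) \<le> 1"
proof -
  have s: "psd (words n) \<sigma>" "tr (words n) \<sigma> = 1" using \<sigma> by (auto simp: is_state_def)
  show "0 \<le> cet_success M1 M2 C (jammed_channel N n \<sigma>)"
    using pairing_nonneg[OF _ s(1) ent_ker_psd[OF N C C]]
    by (simp add: cet_success_eq[OF N C s(1)] finite_nlists less_eq_complex_def)
  show "cet_success M1 M2 C (jammed_channel N n \<sigma>) \<le> 1"
    using pairing_ent_ker_le[OF N C s(1)]
    by (simp add: cet_success_eq[OF N C s(1)] s(2) less_eq_complex_def)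
qed

section \<open>Matrix concentration by the moment method\<close>

definition wprod :: "'i set \<Rightarrow> 'i cop list \<Rightarrow> 'i cop" where
  "wprod I Xs = foldr (opmult I) Xs idop"

lemma wprod_simps: "wprod I [] = idop" "wprod I (X # Xs) = opmult I X (wprod I Xs)"
  by (simp_all add: wprod_def)

lemma opow_sum_words:
  "opow I (\<lambda>a b. \<Sum>i\<in>T. X i a b) m a b = (\<Sum>w\<in>nlists m T. wprod I (map X w) a b)"
proof (induction m arbitrary: a)
  case 0
  then show ?case by (simp add: nlists_0 wprod_simps)
next
  case (Suc m)
  have "opow I (\<lambda>a b. \<Sum>i\<in>T. X i a b) (Suc m) a b = (\<Sum>c\<in>I. \<Sum>i\<in>T. \<Sum>w\<in>nlists m T. X i a c * wprod I (map X w) c b)"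
    by (simp add: opmult_def Suc.IH sum_product)
  also have "\<dots> = (\<Sum>i\<in>T. \<Sum>c\<in>I. \<Sum>w\<in>nlists m T. X i a c * wprod I (map X w) c b)"
    by (rule sum.swap)
  also have "\<dots> = (\<Sum>i\<in>T. \<Sum>w\<in>nlists m T. \<Sum>c\<in>I. X i a c * wprod I (map X w) c b)"
    by (intro sum.cong refl sum.swap)
  also have "\<dots> = (\<Sum>w\<in>nlists (Suc m) T. wprod I (map X w) a b)"
    unfolding sum_nlists_Suc by (simp add: wprod_simps opmult_def)
  finally show ?case .
qed

text \<open>Matrix multiplication as a sum over index paths starting in \<open>a\<close>; the path
  includes its endpoint, which \<open>idop\<close> pins to \<open>b\<close>. An entry of a word thus
  becomes a polynomial in the entries of the samples, and Fubini applies.\<close>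

lemma wprod_paths:
  "wprod I (map X w) a b =
    (\<Sum>p\<in>nlists (length w) I. (\<Prod>t<length w. X (w ! t) ((a # p) ! t) (p ! t)) * idop ((a # p) ! length w) b)"
proof (induction w arbitrary: a)
  case Nil
  then show ?case by (simp add: nlists_0 wprod_simps)
next
  case (Cons i w)
  have "wprod I (map X (i # w)) a b = (\<Sum>c\<in>I. X i a c * (\<Sum>p\<in>nlists (length w) I.
      (\<Prod>t<length w. X (w ! t) ((c # p) ! t) (p ! t)) * idop ((c # p) ! length w) b))"
    by (simp add: wprod_simps opmult_def Cons.IH)
  also have "\<dots> = (\<Sum>c\<in>I. \<Sum>p\<in>nlists (length w) I. X i a c * (\<Prod>t<length w. X (w ! t) ((c # p) ! t) (p ! t)) * idop ((c # p) ! length w) b)"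
    by (simp only: sum_distrib_left mult.assoc)
  finally show ?case
    by (simp add: sum_nlists_Suc prod.lessThan_Suc_shift del: prod.lessThan_Suc)
qed

lemma sqnorm_wprod_le:
  assumes "finite I" "0 \<le> c" "\<And>X v. X \<in> set Xs \<Longrightarrow> sqnorm I (app_op I X v) \<le> c\<^sup>2 * sqnorm I v"
  shows "sqnorm I (app_op I (wprod I Xs) v) \<le> (c\<^sup>2) ^ length Xs * sqnorm I v"
  using assms(3)
proof (induction Xs)
  case Nil
  show ?case by (simp add: sqnorm_def app_idop assms(1) wprod_simps)
next
  case (Cons X Xs)
  have "sqnorm I (app_op I (wprod I (X # Xs)) v) \<le> c\<^sup>2 * sqnorm I (app_op I (wprod I Xs) v)"
    unfolding wprod_simps app_opmult by (rule Cons.prems) simp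
  also have "\<dots> \<le> c\<^sup>2 * ((c\<^sup>2) ^ length Xs * sqnorm I v)"
    by (intro mult_left_mono Cons.IH Cons.prems) auto
  finally show ?case by (simp add: mult.assoc)
qed

lemma wprod_entry_le:
  assumes "finite I" "0 \<le> c" "\<And>X v. X \<in> set Xs \<Longrightarrow> sqnorm I (app_op I X v) \<le> c\<^sup>2 * sqnorm I v"
    and "i \<in> I" "j \<in> I"
  shows "norm (wprod I Xs i j) \<le> c ^ length Xs"
proof -
  have "(norm (app_op I (wprod I Xs) (idop j) i))\<^sup>2 \<le> sqnorm I (app_op I (wprod I Xs) (idop j))"
    unfolding sqnorm_def by (rule member_le_sum) (use assms in auto)
  also have "\<dots> \<le> (c\<^sup>2) ^ length Xs"
    using sqnorm_wprod_le[OF assms(1,2,3), of Xs "idop j"] assms by (simp add: sqnorm_unit)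
  also have "\<dots> = (c ^ length Xs)\<^sup>2" by (simp add: power_mult[symmetric] mult.commute)
  finally show ?thesis using assms by (simp add: app_unit abs_le_square_iff[symmetric])
qed

text \<open>The words that can contribute to a moment: if a centred sample occurs exactly once in a
  word, independence makes the expectation vanish.\<close>

definition no_single :: "'t list \<Rightarrow> bool" where
  "no_single w \<longleftrightarrow> (\<forall>t<length w. \<exists>t'<length w. t' \<noteq> t \<and> w ! t' = w ! t)"

lemma card_set_no_single:
  assumes "no_single w"
  shows "2 * card (set w) \<le> length w"
proof -
  let ?F = "\<lambda>x. {t \<in> {..<length w}. w ! t = x}"
  have "2 \<le> card (?F x)" if x: "x \<in> set w" for x
  proof -
    obtain t where t: "t < length w" "w ! t = x" using x by (auto simp: in_set_conv_nth)
    obtain t' where t': "t' < length w" "t' \<noteq> t" "w ! t' = x" using assms t unfolding no_single_def by blast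
    have "card {t, t'} \<le> card (?F x)" by (rule card_mono) (use t t' in auto)
    then show ?thesis using t' by simp
  qed
  then have "(\<Sum>x\<in>set w. 2) \<le> (\<Sum>x\<in>set w. card (?F x))" by (intro sum_mono) auto
  also have "\<dots> = (\<Sum>x\<in>set w. \<Sum>t\<in>?F x. 1)" by simp
  also have "\<dots> = (\<Sum>t\<in>{..<length w}. 1)"
    by (rule sum.group) auto
  finally show ?thesis by simp
qed

lemma card_nlists: "finite S \<Longrightarrow> card (nlists n S) = card S ^ n"
  using card_lists_length_eq[of S n] by (simp add: nlists_def conj_commute)

text \<open>At most \<open>p\<close> letters occur in such a word, so it is determined by a list
  \<open>v\<close> of \<open>p\<close> letters, padded with a letter of the word, and by
  \<open>2 * p\<close> positions in \<open>v\<close>. The gain is \<open>card T ^ p\<close> in place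
  of \<open>card T ^ (2 * p)\<close>; the other factor does not depend on \<open>T\<close>.\<close>

lemma card_no_single_le:
  assumes T: "finite T" and p: "0 < p"
  shows "card {w \<in> nlists (2 * p) T. no_single w} \<le> card T ^ p * p ^ (2 * p)"
proof -
  let ?f = "\<lambda>(v, h). map (\<lambda>i. v ! i) h"
  have "{w \<in> nlists (2 * p) T. no_single w} \<subseteq> ?f ` (nlists p T \<times> nlists (2 * p) {..<p})"
  proof
    fix w assume "w \<in> {w \<in> nlists (2 * p) T. no_single w}"
    then have w: "length w = 2 * p" "set w \<subseteq> T" "no_single w" by (auto simp: nlists_def)
    have c: "card (set w) \<le> p" using card_set_no_single[OF w(3)] w(1) by simp
    define u where "u = remdups w"
    have u: "set u = set w" by (simp add: u_def)
    have lu: "length u \<le> p" using c by (simp add: u_def length_remdups_card_conv)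
    have "w \<noteq> []" using w(1) p by auto
    define v where "v = u @ replicate (p - length u) (hd w)"
    have v: "length v = p" "set v \<subseteq> T" "set w \<subseteq> set v"
      using lu u w(2) \<open>w \<noteq> []\<close> hd_in_set[of w] by (auto simp: v_def)
    have "\<forall>x\<in>set w. \<exists>i. i < p \<and> v ! i = x"
    proof
      fix x assume "x \<in> set w"
      then have "x \<in> set v" using v(3) by blast
      then show "\<exists>i. i < p \<and> v ! i = x" unfolding in_set_conv_nth v(1) .
    qed
    from bchoice[OF this] obtain g where g: "\<And>x. x \<in> set w \<Longrightarrow> g x < p \<and> v ! g x = x" by auto
    have "map (\<lambda>i. v ! i) (map g w) = w" using g by (simp add: map_idI)
    moreover have "(v, map g w) \<in> nlists p T \<times> nlists (2 * p) {..<p}"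
      using v w g by (auto simp: nlists_def)
    ultimately show "w \<in> ?f ` (nlists p T \<times> nlists (2 * p) {..<p})"
      by (intro image_eqI[of _ _ "(v, map g w)"]) simp_all
  qed
  then have "card {w \<in> nlists (2 * p) T. no_single w} \<le> card (nlists p T \<times> nlists (2 * p) {..<p})"
    by (rule surj_card_le[rotated]) (simp add: T finite_nlists)
  then show ?thesis by (simp add: card_cartesian_product card_nlists T)
qed

text \<open>The operator norm is at most the Hilbert-Schmidt norm, by Cauchy-Schwarz in each row;
  for hermitian \<open>S\<close> the square of the latter is the trace of
  \<open>S S\<close>.\<close>

lemma sqnorm_app_le_trace:
  assumes fin: "finite I" and h: "herm_on I S"
  shows "sqnorm I (app_op I S v) \<le> Re (tr I (opmult I S S)) * sqnorm I v"
proof -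
  have "sqnorm I (app_op I S v) \<le> (\<Sum>i\<in>I. (\<Sum>j\<in>I. (norm (S i j))\<^sup>2) * sqnorm I v)"
    unfolding sqnorm_def[of I "app_op I S v"]
  proof (intro sum_mono)
    fix i
    have "(norm (\<Sum>j\<in>I. cnj (cnj (S i j)) * v j))\<^sup>2 \<le> sqnorm I (\<lambda>j. cnj (S i j)) * sqnorm I v"
      by (rule norm_sesq_idop_le[OF fin])
    then show "(norm (app_op I S v i))\<^sup>2 \<le> (\<Sum>j\<in>I. (norm (S i j))\<^sup>2) * sqnorm I v"
      by (simp add: app_op_def sqnorm_def)
  qed
  also have "\<dots> = (\<Sum>i\<in>I. \<Sum>j\<in>I. (norm (S i j))\<^sup>2) * sqnorm I v"
    by (simp add: sum_distrib_right)
  also have "(\<Sum>i\<in>I. \<Sum>j\<in>I. (norm (S i j))\<^sup>2) = Re (tr I (opmult I S S))"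
  proof -
    have "tr I (opmult I S S) = (\<Sum>i\<in>I. \<Sum>j\<in>I. of_real ((norm (S i j))\<^sup>2))"
      unfolding tr_def opmult_def
    proof (intro sum.cong refl)
      fix i j assume "i \<in> I" "j \<in> I"
      then have "S j i = cnj (S i j)" using h unfolding herm_on_def by blast
      then show "S i j * S j i = of_real ((norm (S i j))\<^sup>2)" unfolding complex_norm_square by (simp only:)
    qed
    then show ?thesis by (simp only: of_real_sum[symmetric] Re_complex_of_real)
  qed
  finally show ?thesis .
qed

lemma herm_on_square:
  assumes fin: "finite I" and h: "herm_on I S"
  shows "herm_on I (opmult I S S)"
  unfolding herm_on_def
proof (intro ballI)
  fix i j assume ij: "i \<in> I" "j \<in> I"
  have e: "opow I S 2 i j = opmult I S S i j" if "j \<in> I" for i j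
    using that by (simp add: numeral_2_eq_2 opmult_idop_right fin opmult_assoc[symmetric])
  have "opow I S 2 j i = cnj (opow I S 2 i j)"
    using herm_on_opow[OF fin h, of 2] ij unfolding herm_on_def by blast
  then show "opmult I S S j i = cnj (opmult I S S i j)" by (simp only: e ij)
qed

lemma sqnorm_app_herm:
  assumes fin: "finite I" and h: "herm_on I S"
  shows "of_real (sqnorm I (app_op I S v)) = sesq I (opmult I S S) v v"
proof -
  have "of_real (sqnorm I (app_op I S v)) = (\<Sum>i\<in>I. cnj (app_op I S v i) * app_op I S v i)"
    unfolding sesq_idop_self[OF fin, symmetric] sesq_idop[OF fin] ..
  also have "\<dots> = sesq I S (app_op I S v) v" by (simp only: sesq_app)
  also have "\<dots> = cnj (sesq I S v (app_op I S v))" by (rule herm_on_sesq[OF h])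
  also have "sesq I S v (app_op I S v) = sesq I (opmult I S S) v v"
    unfolding sesq_app app_opmult ..
  also have "cnj (sesq I (opmult I S S) v v) = sesq I (opmult I S S) v v"
    by (rule herm_on_sesq[OF herm_on_square[OF fin h], of v v, symmetric])
  finally show ?thesis .
qed

lemma opow_mult:
  assumes "finite I" "i \<in> I" "j \<in> I"
  shows "opow I (opow I X m) n i j = opow I X (m * n) i j"
  using assms(2)
proof (induction n arbitrary: i)
  case (Suc n)
  have "opow I X (m * Suc n) i j = opmult I (opow I X m) (opow I X (m * n)) i j"
    using Suc.prems assms(1) by (simp add: opow_add del: opow.simps)
  also have "\<dots> = opow I (opow I X m) (Suc n) i j"
    using Suc by (simp add: opmult_def)
  finally show ?case by simp
qed simp

text \<open>Replaces an argument with eigenvalues. By Cauchy-Schwarz the squared form of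
  \<open>S\<close> at \<open>v\<close> is at most \<open>sqnorm I v\<close> times the form of
  \<open>S S\<close>, so each squaring of the operator halves the exponent, until the
  Hilbert-Schmidt bound finishes. The exponents are therefore powers of two.\<close>

lemma sesq_power_le_trace:
  assumes fin: "finite I" and h: "herm_on I S"
  shows "norm (sesq I S v v) ^ (2 ^ Suc q) \<le> Re (tr I (opow I S (2 ^ Suc q))) * sqnorm I v ^ (2 ^ Suc q)"
  using h
proof (induction q arbitrary: S)
  case 0
  have "(norm (sesq I S v v))\<^sup>2 \<le> sqnorm I v * sqnorm I (app_op I S v)"
    unfolding sesq_app by (rule norm_sesq_idop_le[OF fin])
  also have "\<dots> \<le> sqnorm I v * (Re (tr I (opmult I S S)) * sqnorm I v)"
    by (intro mult_left_mono sqnorm_app_le_trace[OF fin 0] sqnorm_nonneg)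
  also have "tr I (opmult I S S) = tr I (opow I S 2)"
    unfolding tr_def by (intro sum.cong refl)
      (simp add: numeral_2_eq_2 opmult_idop_right fin opmult_assoc[symmetric])
  finally show ?case by (simp add: power2_eq_square mult_ac)
next
  case (Suc q)
  let ?S = "opow I S 2"
  have e: "opow I S 2 i j = opmult I S S i j" if "j \<in> I" for i j
    using that by (simp add: numeral_2_eq_2 opmult_idop_right fin opmult_assoc[symmetric])
  have "(norm (sesq I S v v))\<^sup>2 \<le> sqnorm I v * sqnorm I (app_op I S v)"
    unfolding sesq_app by (rule norm_sesq_idop_le[OF fin])
  also have "sqnorm I (app_op I S v) = norm (sesq I (opmult I S S) v v)"
    unfolding sqnorm_app_herm[OF fin Suc.prems, symmetric] by (simp add: sqnorm_nonneg)
  also have "sesq I (opmult I S S) v v = sesq I ?S v v"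
    unfolding sesq_def by (intro sum.cong refl) (simp only: e)
  finally have "((norm (sesq I S v v))\<^sup>2) ^ (2 ^ Suc q) \<le> (sqnorm I v * norm (sesq I ?S v v)) ^ (2 ^ Suc q)"
    by (rule power_mono) simp
  also have "\<dots> = sqnorm I v ^ (2 ^ Suc q) * norm (sesq I ?S v v) ^ (2 ^ Suc q)"
    by (rule power_mult_distrib)
  also have "\<dots> \<le> sqnorm I v ^ (2 ^ Suc q) * (Re (tr I (opow I ?S (2 ^ Suc q))) * sqnorm I v ^ (2 ^ Suc q))"
    by (intro mult_left_mono Suc.IH herm_on_opow[OF fin Suc.prems] zero_le_power sqnorm_nonneg)
  also have "tr I (opow I ?S (2 ^ Suc q)) = tr I (opow I S (2 ^ Suc (Suc q)))"
    unfolding tr_def by (intro sum.cong refl) (simp add: opow_mult[OF fin])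
  finally have "((norm (sesq I S v v))\<^sup>2) ^ (2 ^ Suc q) \<le>
      sqnorm I v ^ (2 ^ Suc q) * (Re (tr I (opow I S (2 ^ Suc (Suc q)))) * sqnorm I v ^ (2 ^ Suc q))" .
  moreover have "x ^ (2 ^ Suc (Suc q)) = x ^ (2 ^ Suc q) * x ^ (2 ^ Suc q)" for x :: real
    by (simp add: power_add[symmetric])
  ultimately show ?case
    by (simp only: power2_eq_square power_mult_distrib mult_ac)
qed

section \<open>Moments of a sum of independent samples\<close>

lemma wprod_path_group:
  fixes Y :: "'c \<Rightarrow> 'i cop"
  assumes "finite T" "set w \<subseteq> T"
  shows "(\<Prod>t<length w. Y (\<omega> (w ! t)) (e t) (e' t)) = (\<Prod>s\<in>T. \<Prod>t\<in>{t \<in> {..<length w}. w ! t = s}. Y (\<omega> s) (e t) (e' t))"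
proof -
  have "(\<Prod>s\<in>T. \<Prod>t\<in>{t \<in> {..<length w}. w ! t = s}. Y (\<omega> s) (e t) (e' t))
     = (\<Prod>s\<in>T. \<Prod>t\<in>{t \<in> {..<length w}. w ! t = s}. Y (\<omega> (w ! t)) (e t) (e' t))"
    by (intro prod.cong refl) simp
  also have "\<dots> = (\<Prod>t<length w. Y (\<omega> (w ! t)) (e t) (e' t))"
    by (rule prod.group) (use assms in \<open>auto simp: set_conv_nth\<close>)
  finally show ?thesis by simp
qed

text \<open>Along a fixed path, collecting the factors by sample gives a product of functions of
  different coordinates, which integrates factor by factor under the product measure.\<close>

lemma integral_wprod:
  fixes Y :: "'c \<Rightarrow> 'i cop" and T :: "'t set"
  assumes M: "prob_space M" and fin: "finite I" "finite T" and w: "set w \<subseteq> T"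
    and meas: "\<And>i j. i \<in> I \<Longrightarrow> j \<in> I \<Longrightarrow> (\<lambda>c. Y c i j) \<in> borel_measurable M"
    and bnd: "\<And>c i j. c \<in> space M \<Longrightarrow> i \<in> I \<Longrightarrow> j \<in> I \<Longrightarrow> norm (Y c i j) \<le> B"
    and a: "a \<in> I"
  shows "integrable (Pi\<^sub>M T (\<lambda>_. M)) (\<lambda>\<omega>. wprod I (map (\<lambda>s. Y (\<omega> s)) w) a b)"
    and "(\<And>i j. i \<in> I \<Longrightarrow> j \<in> I \<Longrightarrow> (\<integral>c. Y c i j \<partial>M) = 0) \<Longrightarrow> \<not> no_single w \<Longrightarrow>
      (\<integral>\<omega>. wprod I (map (\<lambda>s. Y (\<omega> s)) w) a b \<partial>Pi\<^sub>M T (\<lambda>_. M)) = 0"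
proof -
  interpret M: prob_space M by (rule M)
  interpret product_sigma_finite "\<lambda>_::'t. M" ..
  let ?P = "Pi\<^sub>M T (\<lambda>_. M)" and ?m = "length w"
  let ?F = "\<lambda>s. {t \<in> {..<?m}. w ! t = s}"
  let ?f = "\<lambda>p s c. \<Prod>t\<in>?F s. Y c ((a # p) ! t) (p ! t)"
  have mem: "(a # p) ! t \<in> I" "p ! t \<in> I" if "p \<in> nlists ?m I" "t < ?m" for p t
  proof -
    have p: "length p = ?m" "set p \<subseteq> I" using that(1) by (auto simp: nlists_def)
    have pm: "p ! k \<in> I" if "k < ?m" for k using p that nth_mem[of k p] by auto
    show "p ! t \<in> I" using pm that(2) .
    show "(a # p) ! t \<in> I" using pm that(2) a by (cases t) auto
  qed
  have int: "integrable M (?f p s)" if p: "p \<in> nlists ?m I" for p s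
  proof (rule M.integrable_const_bound[where B="\<Prod>t\<in>?F s. B"])
    show "AE c in M. norm (?f p s c) \<le> (\<Prod>t\<in>?F s. B)"
      unfolding prod_norm[symmetric] using mem[OF p] bnd by (intro AE_I2 prod_mono) auto
    show "?f p s \<in> borel_measurable M"
      using mem[OF p] meas by (intro borel_measurable_prod) auto
  qed
  have e: "wprod I (map (\<lambda>s. Y (\<omega> s)) w) a b = (\<Sum>p\<in>nlists ?m I. (\<Prod>s\<in>T. ?f p s (\<omega> s)) * idop ((a # p) ! ?m) b)" for \<omega>
    unfolding wprod_paths[of I "\<lambda>s. Y (\<omega> s)"] wprod_path_group[where Y=Y, OF fin(2) w] ..
  show "integrable ?P (\<lambda>\<omega>. wprod I (map (\<lambda>s. Y (\<omega> s)) w) a b)"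
    unfolding e by (intro Bochner_Integration.integrable_sum integrable_mult_left product_integrable_prod fin int)
  assume zero: "\<And>i j. i \<in> I \<Longrightarrow> j \<in> I \<Longrightarrow> (\<integral>c. Y c i j \<partial>M) = 0" and ns: "\<not> no_single w"
  from ns obtain t0 where t0: "t0 < ?m" "\<And>t'. t' < ?m \<Longrightarrow> w ! t' = w ! t0 \<Longrightarrow> t' = t0"
    unfolding no_single_def by auto
  \<comment> \<open>The sample \<open>w ! t0\<close> occurs once, so its factor is a single entry of
    \<open>Y\<close>, which has mean zero.\<close>
  have F: "?F (w ! t0) = {t0}" using t0 by auto
  have "(\<integral>\<omega>. wprod I (map (\<lambda>s. Y (\<omega> s)) w) a b \<partial>?P) =
      (\<Sum>p\<in>nlists ?m I. (\<integral>\<omega>. (\<Prod>s\<in>T. ?f p s (\<omega> s)) * idop ((a # p) ! ?m) b \<partial>?P))"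
    unfolding e by (intro Bochner_Integration.integral_sum integrable_mult_left product_integrable_prod fin int)
  also have "\<dots> = (\<Sum>p\<in>nlists ?m I. 0)"
  proof (intro sum.cong refl)
    fix p assume p: "p \<in> nlists ?m I"
    have "(\<integral>\<omega>. (\<Prod>s\<in>T. ?f p s (\<omega> s)) * idop ((a # p) ! ?m) b \<partial>?P) =
       (\<integral>\<omega>. (\<Prod>s\<in>T. ?f p s (\<omega> s)) \<partial>?P) * idop ((a # p) ! ?m) b"
      by (rule Bochner_Integration.integral_mult_left_zero)
    also have "(\<integral>\<omega>. (\<Prod>s\<in>T. ?f p s (\<omega> s)) \<partial>?P) = (\<Prod>s\<in>T. \<integral>c. ?f p s c \<partial>M)"
      by (intro product_integral_prod fin int p)
    also have "\<dots> = 0"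
    proof (rule prod_zero[OF fin(2)])
      have "w ! t0 \<in> T" using t0(1) w by auto
      moreover have "(\<integral>c. ?f p (w ! t0) c \<partial>M) = 0"
        unfolding F using zero mem[OF p t0(1)] by simp
      ultimately show "\<exists>s\<in>T. (\<integral>c. ?f p s c \<partial>M) = 0" by blast
    qed
    finally show "(\<integral>\<omega>. (\<Prod>s\<in>T. ?f p s (\<omega> s)) * idop ((a # p) ! ?m) b \<partial>?P) = 0" by simp
  qed
  finally show "(\<integral>\<omega>. wprod I (map (\<lambda>s. Y (\<omega> s)) w) a b \<partial>?P) = 0" by simp
qed

text \<open>In the expected trace of the power, only the words counted by
  \<open>card_no_single_le\<close> survive, and each diagonal entry of such a word has modulus at
  most \<open>c ^ (2 * p)\<close>. Some sample does not exceed the expectation.\<close>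

lemma exists_sample_small_moment:
  fixes Y :: "'c \<Rightarrow> 'i cop" and T :: "'t set"
  assumes M: "prob_space M" and fin: "finite I" "finite T" and p: "0 < p" and c0: "0 \<le> c"
    and meas: "\<And>i j. i \<in> I \<Longrightarrow> j \<in> I \<Longrightarrow> (\<lambda>\<omega>. Y \<omega> i j) \<in> borel_measurable M"
    and contr: "\<And>\<omega> v. \<omega> \<in> space M \<Longrightarrow> sqnorm I (app_op I (Y \<omega>) v) \<le> c\<^sup>2 * sqnorm I v"
    and zero: "\<And>i j. i \<in> I \<Longrightarrow> j \<in> I \<Longrightarrow> (\<integral>\<omega>. Y \<omega> i j \<partial>M) = 0"
    and lt: "real (card I) * (real (card T ^ p * p ^ (2 * p)) * c ^ (2 * p)) < b"
  shows "\<exists>\<omega>. (\<forall>s\<in>T. \<omega> s \<in> space M) \<and> Re (tr I (opow I (\<lambda>i j. \<Sum>s\<in>T. Y (\<omega> s) i j) (2 * p))) < b"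
proof -
  interpret M: prob_space M by (rule M)
  interpret product_sigma_finite "\<lambda>_::'t. M" ..
  let ?P = "Pi\<^sub>M T (\<lambda>_. M)" and ?m = "2 * p"
  interpret P: prob_space ?P by (intro prob_space_PiM M)
  let ?W = "nlists ?m T"
  let ?g = "\<lambda>w a \<omega>. wprod I (map (\<lambda>s. Y (\<omega> s)) w) a a"
  have bnd: "norm (Y \<omega> i j) \<le> c" if "\<omega> \<in> space M" "i \<in> I" "j \<in> I" for \<omega> i j
    using wprod_entry_le[OF fin(1) c0, of "[Y \<omega>]" i j] contr[OF that(1)] that fin(1)
    by (simp add: wprod_simps opmult_idop_right)
  have W: "set w \<subseteq> T" "length w = ?m" if "w \<in> ?W" for w using that by (auto simp: nlists_def)
  have int: "integrable ?P (?g w a)" if "w \<in> ?W" "a \<in> I" for w a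
    by (rule integral_wprod(1)[OF M fin W(1)[OF that(1)] meas bnd that(2)])
  have sp: "\<omega> s \<in> space M" if "\<omega> \<in> space ?P" "s \<in> T" for \<omega> s
    using that by (auto simp: space_PiM)
  have le: "norm (\<integral>\<omega>. ?g w a \<omega> \<partial>?P) \<le> (if no_single w then c ^ ?m else 0)" if w: "w \<in> ?W" and a: "a \<in> I" for w a
  proof (cases "no_single w")
    case True
    have "norm (\<integral>\<omega>. ?g w a \<omega> \<partial>?P) \<le> (\<integral>\<omega>. norm (?g w a \<omega>) \<partial>?P)"
      by (rule integral_norm_bound)
    also have "\<dots> \<le> c ^ ?m"
    proof (rule P.integral_le_const)
      show "integrable ?P (\<lambda>\<omega>. norm (?g w a \<omega>))" using int[OF w a] by (rule integrable_norm)
      show "AE \<omega> in ?P. norm (?g w a \<omega>) \<le> c ^ ?m"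
      proof (rule AE_I2)
        fix \<omega> assume om: "\<omega> \<in> space ?P"
        have "norm (?g w a \<omega>) \<le> c ^ length (map (\<lambda>s. Y (\<omega> s)) w)"
          by (rule wprod_entry_le[OF fin(1) c0 _ a a]) (use contr sp[OF om] W(1)[OF w] in auto)
        then show "norm (?g w a \<omega>) \<le> c ^ ?m" by (simp add: W(2)[OF w])
      qed
    qed
    finally show ?thesis using True by simp
  next
    case False
    then show ?thesis using integral_wprod(2)[OF M fin W(1)[OF w] meas bnd a zero False] by simp
  qed
  have e: "tr I (opow I (\<lambda>i j. \<Sum>s\<in>T. Y (\<omega> s) i j) ?m) = (\<Sum>a\<in>I. \<Sum>w\<in>?W. ?g w a \<omega>)" for \<omega>
    unfolding tr_def opow_sum_words ..
  have intt: "integrable ?P (\<lambda>\<omega>. \<Sum>a\<in>I. \<Sum>w\<in>?W. ?g w a \<omega>)"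
    by (intro Bochner_Integration.integrable_sum int)
  have "norm (\<integral>\<omega>. (\<Sum>a\<in>I. \<Sum>w\<in>?W. ?g w a \<omega>) \<partial>?P) = norm (\<Sum>a\<in>I. \<Sum>w\<in>?W. (\<integral>\<omega>. ?g w a \<omega> \<partial>?P))"
    using int by (simp add: Bochner_Integration.integral_sum)
  also have "\<dots> \<le> (\<Sum>a\<in>I. \<Sum>w\<in>?W. norm (\<integral>\<omega>. ?g w a \<omega> \<partial>?P))"
    by (intro order_trans[OF norm_sum] sum_mono) auto
  also have "\<dots> \<le> (\<Sum>a\<in>I. \<Sum>w\<in>?W. if no_single w then c ^ ?m else 0)"
    by (intro sum_mono le)
  also have "\<dots> = real (card I) * (real (card {w \<in> ?W. no_single w}) * c ^ ?m)"
    by (simp add: sum.If_cases finite_nlists fin(2) Int_def)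
  also have "\<dots> \<le> real (card I) * (real (card T ^ p * p ^ ?m) * c ^ ?m)"
    by (intro mult_left_mono mult_right_mono of_nat_mono card_no_single_le fin(2) p) (use c0 in auto)
  also note lt
  finally have nlt: "norm (\<integral>\<omega>. (\<Sum>a\<in>I. \<Sum>w\<in>?W. ?g w a \<omega>) \<partial>?P) < b" .
  have "\<exists>\<omega>\<in>space ?P. Re (\<Sum>a\<in>I. \<Sum>w\<in>?W. ?g w a \<omega>) < b"
  proof (rule ccontr)
    assume "\<not> ?thesis"
    then have "b \<le> (\<integral>\<omega>. Re (\<Sum>a\<in>I. \<Sum>w\<in>?W. ?g w a \<omega>) \<partial>?P)"
      by (intro P.integral_ge_const integrable_Re[OF intt] AE_I2) (auto simp: not_less)
    also have "\<dots> = Re (\<integral>\<omega>. (\<Sum>a\<in>I. \<Sum>w\<in>?W. ?g w a \<omega>) \<partial>?P)"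
      by (rule integral_Re[OF intt])
    also have "\<dots> \<le> norm (\<integral>\<omega>. (\<Sum>a\<in>I. \<Sum>w\<in>?W. ?g w a \<omega>) \<partial>?P)"
      by (rule complex_Re_le_cmod)
    finally show False using nlt by simp
  qed
  then obtain \<omega> where "\<omega> \<in> space ?P" "Re (\<Sum>a\<in>I. \<Sum>w\<in>?W. ?g w a \<omega>) < b" by auto
  then show ?thesis unfolding e using sp by (intro exI[of _ \<omega>]) auto
qed

text \<open>A random code comes with measurable success probabilities, that is, with measurable
  quadratic forms of its kernel. Polarization with the coefficients 1 and \<open>\<i>\<close>
  recovers the entries.\<close>

lemma entry_measurable:
  assumes fin: "finite I" and ij: "i \<in> I" "j \<in> I" and psd: "\<And>c. c \<in> space M \<Longrightarrow> psd I (X c)"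
    and meas: "\<And>v. (\<lambda>c. Re (sesq I (X c) v v)) \<in> borel_measurable M"
  shows "(\<lambda>c. X c i j) \<in> borel_measurable M"
proof -
  let ?q = "\<lambda>c z. Re (sesq I (X c) (\<lambda>k. idop i k + z * idop j k) (\<lambda>k. idop i k + z * idop j k))"
  have e: "sesq I (X c) (\<lambda>k. idop i k + z * idop j k) (\<lambda>k. idop i k + z * idop j k)
     = X c i i + z * X c i j + cnj z * cnj (X c i j) + cnj z * z * X c j j" if "c \<in> space M" for c z
    unfolding sesq_left sesq_right using ij fin psd_hermitian[OF psd[OF that] fin ij]
    by (simp add: sesq_unit algebra_simps)
  have re: "Re (X c i j) = (?q c 1 - Re (sesq I (X c) (idop i) (idop i)) - Re (sesq I (X c) (idop j) (idop j))) / 2" if "c \<in> space M" for c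
    unfolding e[OF that] using ij fin by (simp add: sesq_unit)
  have im: "Im (X c i j) = (Re (sesq I (X c) (idop i) (idop i)) + Re (sesq I (X c) (idop j) (idop j)) - ?q c \<i>) / 2" if "c \<in> space M" for c
    unfolding e[OF that] using ij fin by (simp add: sesq_unit)
  have "(\<lambda>c. Re (X c i j)) \<in> borel_measurable M"
    by (subst measurable_cong[OF re]) (assumption, intro borel_measurable_divide borel_measurable_diff meas borel_measurable_const)
  moreover have "(\<lambda>c. Im (X c i j)) \<in> borel_measurable M"
    by (subst measurable_cong[OF im]) (assumption, intro borel_measurable_divide borel_measurable_diff borel_measurable_add meas borel_measurable_const)
  ultimately show ?thesis by (simp add: borel_measurable_complex_iff)
qed

text \<open>The trace of a high even power of the centred sum dominates its operator norm, and in its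
  expectation only words in which no sample occurs exactly once survive.\<close>
lemma exists_sample_average_close:
  fixes X :: "'c \<Rightarrow> 'i cop" and T :: "'t set"
  assumes M: "prob_space M" and fin: "finite I" "finite T"
    and meas: "\<And>i j. i \<in> I \<Longrightarrow> j \<in> I \<Longrightarrow> (\<lambda>c. X c i j) \<in> borel_measurable M"
    and psd: "\<And>c. c \<in> space M \<Longrightarrow> psd I (X c)" "\<And>c. c \<in> space M \<Longrightarrow> psd I (\<lambda>i j. idop i j - X c i j)"
    and p: "p = 2 ^ q" and card: "card I \<le> d ^ p" and \<delta>: "0 < \<delta>"
    and big: "4 * (real p)\<^sup>2 * real d < \<delta>\<^sup>2 * real (card T)"
  shows "\<exists>\<omega>. (\<forall>s\<in>T. \<omega> s \<in> space M) \<and> (\<forall>\<sigma>. is_state I \<sigma> \<longrightarrow>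
      (\<integral>c. Re (pairing I \<sigma> (X c)) \<partial>M) - \<delta> \<le> (1 / real (card T)) * (\<Sum>s\<in>T. Re (pairing I \<sigma> (X (\<omega> s)))))"
proof -
  interpret M: prob_space M by (rule M)
  let ?K = "real (card T)"
  have K: "0 < ?K"
  proof (rule ccontr)
    assume "\<not> 0 < ?K"
    then have "?K = 0" by simp
    then have "4 * (real p)\<^sup>2 * real d < 0" using big by (simp only: mult_zero_right)
    moreover have "0 \<le> 4 * (real p)\<^sup>2 * real d" by simp
    ultimately show False by linarith
  qed
  have p0: "0 < p" using p by simp
  have sq: "norm (sesq I (X c) u v) \<le> sqrt (sqnorm I u) * sqrt (sqnorm I v)" if "c \<in> space M" for c u v
    by (rule sesq_le_sqrt[OF psd(1)[OF that] psd(2)[OF that] fin(1)])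
  have bnd: "norm (X c i j) \<le> 1" if "c \<in> space M" "i \<in> I" "j \<in> I" for c i j
    using sq[OF that(1), of "idop i" "idop j"] that fin by (simp add: sesq_unit sqnorm_unit)
  have int: "integrable M (\<lambda>c. X c i j)" if "i \<in> I" "j \<in> I" for i j
    by (rule M.integrable_const_bound[where B=1]) (use meas bnd that in \<open>auto intro!: AE_I2\<close>)
  define E where "E = (\<lambda>i j. \<integral>c. X c i j \<partial>M)"
  define Y where "Y = (\<lambda>c i j. X c i j - E i j)"
  have ints: "integrable M (\<lambda>c. sesq I (X c) u v)" for u v
    unfolding sesq_def by (intro Bochner_Integration.integrable_sum integrable_mult_left integrable_mult_right int)
  have Es: "sesq I E u v = (\<integral>c. sesq I (X c) u v \<partial>M)" for u v
    unfolding sesq_def E_def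
    by (simp add: Bochner_Integration.integral_sum int Bochner_Integration.integrable_sum)
  have intp: "integrable M (\<lambda>c. pairing I \<sigma> (X c))" for \<sigma>
    unfolding pairing_def by (intro Bochner_Integration.integrable_sum integrable_mult_right int)
  have Ep: "pairing I \<sigma> E = (\<integral>c. pairing I \<sigma> (X c) \<partial>M)" for \<sigma>
    unfolding pairing_def E_def
    by (simp add: Bochner_Integration.integral_sum int Bochner_Integration.integrable_sum)
  \<comment> \<open>The constant 2 is one unit for \<open>X c\<close> and one for its mean
    \<open>E\<close>.\<close>
  have contr: "sqnorm I (app_op I (Y c) v) \<le> 2\<^sup>2 * sqnorm I v" if c: "c \<in> space M" for c v
  proof (rule sqnorm_app_le_of_sesq[OF fin(1)])
    fix u v
    let ?b = "sqrt (sqnorm I u) * sqrt (sqnorm I v)"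
    have "norm (sesq I E u v) \<le> (\<integral>c. norm (sesq I (X c) u v) \<partial>M)"
      unfolding Es by (rule integral_norm_bound)
    also have "\<dots> \<le> ?b"
      by (rule M.integral_le_const) (use ints sq in \<open>auto intro!: AE_I2\<close>)
    finally have "norm (sesq I E u v) \<le> ?b" .
    moreover have "norm (sesq I (Y c) u v) \<le> norm (sesq I (X c) u v) + norm (sesq I E u v)"
      unfolding Y_def sesq_op_diff by (rule norm_triangle_ineq4)
    ultimately show "norm (sesq I (Y c) u v) \<le> 2 * sqrt (sqnorm I u) * sqrt (sqnorm I v)"
      using sq[OF c, of u v] by simp
  qed simp
  have Ymeas: "(\<lambda>c. Y c i j) \<in> borel_measurable M" if "i \<in> I" "j \<in> I" for i j
    unfolding Y_def using meas[OF that] by (intro borel_measurable_diff) auto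
  have Yzero: "(\<integral>c. Y c i j \<partial>M) = 0" if "i \<in> I" "j \<in> I" for i j
    unfolding Y_def using int[OF that] by (simp add: E_def M.prob_space)
  \<comment> \<open>Because \<open>card I \<le> d ^ p\<close>, the dimension joins the other factors
    under one p-th power: the moment is at most \<open>(4 * p^2 * d * card T) ^ p\<close>, and
    \<open>big\<close> compares the bases.\<close>
  have lt: "real (card I) * (real (card T ^ p * p ^ (2 * p)) * 2 ^ (2 * p)) < (\<delta> * ?K) ^ (2 * p)"
  proof -
    have "real (card I) * (real (card T ^ p * p ^ (2 * p)) * 2 ^ (2 * p)) \<le> real (d ^ p) * (real (card T ^ p * p ^ (2 * p)) * 2 ^ (2 * p))"
      using card by (intro mult_right_mono of_nat_mono) auto
    also have "\<dots> = (4 * (real p)\<^sup>2 * real d * ?K) ^ p"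
    proof -
      have "(2::real) ^ (2 * p) = 4 ^ p" "real p ^ (2 * p) = ((real p)\<^sup>2) ^ p" by (simp_all add: power_mult)
      then show ?thesis by (simp only: of_nat_mult of_nat_power power_mult_distrib mult_ac)
    qed
    also have "\<dots> < (\<delta>\<^sup>2 * ?K * ?K) ^ p"
      using big K p0 by (intro power_strict_mono mult_strict_right_mono) auto
    also have "\<dots> = (\<delta> * ?K) ^ (2 * p)"
      by (simp add: power_mult power_mult_distrib power2_eq_square mult_ac)
    finally show ?thesis .
  qed
  from exists_sample_small_moment[OF M fin p0 _ Ymeas contr Yzero lt]
  obtain \<omega> where om: "\<And>s. s \<in> T \<Longrightarrow> \<omega> s \<in> space M"
    and tr: "Re (tr I (opow I (\<lambda>i j. \<Sum>s\<in>T. Y (\<omega> s) i j) (2 * p))) < (\<delta> * ?K) ^ (2 * p)"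
    by auto
  define S where "S = (\<lambda>i j. \<Sum>s\<in>T. Y (\<omega> s) i j)"
  have pq: "2 * p = 2 ^ Suc q" by (simp add: p)
  have Eh: "E j i = cnj (E i j)" if "i \<in> I" "j \<in> I" for i j
  proof -
    have "E j i = (\<integral>c. cnj (X c i j) \<partial>M)"
      unfolding E_def by (intro Bochner_Integration.integral_cong refl psd_hermitian[OF psd(1) fin(1) that])
    then show ?thesis by (simp add: E_def)
  qed
  have hS: "herm_on I S" unfolding herm_on_def
  proof (intro ballI)
    fix i j assume ij: "i \<in> I" "j \<in> I"
    have "Y (\<omega> s) j i = cnj (Y (\<omega> s) i j)" if "s \<in> T" for s
      unfolding Y_def complex_cnj_diff using psd_hermitian[OF psd(1)[OF om[OF that]] fin(1) ij] Eh[OF ij]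
      by (simp only:)
    then show "S j i = cnj (S i j)" unfolding S_def cnj_sum by (intro sum.cong refl)
  qed
  have Sle: "norm (sesq I S v v) \<le> \<delta> * ?K * sqnorm I v" for v
  proof -
    have "norm (sesq I S v v) ^ (2 * p) \<le> Re (tr I (opow I S (2 * p))) * sqnorm I v ^ (2 * p)"
      unfolding pq by (rule sesq_power_le_trace[OF fin(1) hS])
    also have "\<dots> \<le> (\<delta> * ?K) ^ (2 * p) * sqnorm I v ^ (2 * p)"
      using tr by (intro mult_right_mono) (auto simp: S_def sqnorm_nonneg)
    also have "\<dots> = (\<delta> * ?K * sqnorm I v) ^ (2 * p)" by (simp add: power_mult_distrib)
    finally have "norm (sesq I S v v) ^ (2 * p) \<le> (\<delta> * ?K * sqnorm I v) ^ (2 * p)" .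
    then show ?thesis
      by (subst (asm) power_mono_iff) (use p0 \<delta> K sqnorm_nonneg[of I v] in auto)
  qed
  \<comment> \<open>The form bound becomes one operator inequality, and pairing it with any state
    yields the estimate for all states at once. No union bound over jammer states is
    involved.\<close>
  have Z: "psd I (\<lambda>i j. of_real (\<delta> * ?K) * idop i j + S i j)"
  proof (rule psdI_herm)
    show "herm_on I (\<lambda>i j. of_real (\<delta> * ?K) * idop i j + S i j)"
      unfolding herm_on_def
    proof (intro ballI)
      fix i j assume "i \<in> I" "j \<in> I"
      then have "S j i = cnj (S i j)" using hS unfolding herm_on_def by blast
      then show "of_real (\<delta> * ?K) * idop j i + S j i = cnj (of_real (\<delta> * ?K) * idop i j + S i j)"
        unfolding complex_cnj_add by (simp add: idop_def)
    qed
    fix v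
    have "- (\<delta> * ?K * sqnorm I v) \<le> Re (sesq I S v v)"
      using Sle[of v] abs_Re_le_cmod[of "sesq I S v v"] by linarith
    then show "0 \<le> Re (sesq I (\<lambda>i j. of_real (\<delta> * ?K) * idop i j + S i j) v v)"
      unfolding sesq_op_add sesq_op_scale sesq_idop_self[OF fin(1)] by simp
  qed
  show ?thesis
  proof (intro exI[of _ \<omega>] conjI ballI allI impI om)
    fix \<sigma> assume st: "is_state I \<sigma>"
    have "0 \<le> pairing I \<sigma> (\<lambda>i j. of_real (\<delta> * ?K) * idop i j + S i j)"
      using st by (intro pairing_nonneg fin Z) (simp add: is_state_def)
    also have "\<dots> = of_real (\<delta> * ?K) + (\<Sum>s\<in>T. pairing I \<sigma> (X (\<omega> s)) - pairing I \<sigma> E)"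
      using st unfolding pairing_add pairing_scale S_def pairing_sum Y_def pairing_diff
      by (simp add: pairing_idop fin is_state_def)
    finally have "0 \<le> \<delta> * ?K + ((\<Sum>s\<in>T. Re (pairing I \<sigma> (X (\<omega> s)))) - ?K * Re (pairing I \<sigma> E))"
      by (simp add: less_eq_complex_def sum_subtractf)
    then have "?K * (Re (pairing I \<sigma> E) - \<delta>) \<le> (\<Sum>s\<in>T. Re (pairing I \<sigma> (X (\<omega> s))))"
      by (simp add: algebra_simps)
    then have "Re (pairing I \<sigma> E) - \<delta> \<le> (1 / ?K) * (\<Sum>s\<in>T. Re (pairing I \<sigma> (X (\<omega> s))))"
      using K by (simp add: field_simps)
    moreover have "Re (pairing I \<sigma> E) = (\<integral>c. Re (pairing I \<sigma> (X c)) \<partial>M)"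
      unfolding Ep by (rule integral_Re[OF intp, symmetric])
    ultimately show "(\<integral>c. Re (pairing I \<sigma> (X c)) \<partial>M) - \<delta> \<le> (1 / ?K) * (\<Sum>s\<in>T. Re (pairing I \<sigma> (X (\<omega> s))))"
      by simp
  qed
qed

text \<open>The concentration bound applied to the kernels \<open>ent_ker N l M1 M2 C C\<close>. As
  it controls them in operator norm, a single choice of codes works against all jammer
  states.\<close>

lemma derandomize:
  fixes N :: "('a::finite, 'j::finite, 'b::finite) jchannel" and \<mu> :: "('a, 'b) cet_code measure"
    and T :: "'t set"
  assumes N: "channel UNIV UNIV N" and \<mu>: "prob_space \<mu>" and C: "\<And>C. C \<in> space \<mu> \<Longrightarrow> is_cet_code l M1 M2 C"
    and meas: "\<And>\<sigma>. is_state (words l) \<sigma> \<Longrightarrow>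
        (\<lambda>C. cet_success M1 M2 C (jammed_channel N l \<sigma>)) \<in> borel_measurable \<mu>"
    and e: "\<And>\<sigma>. is_state (words l) \<sigma> \<Longrightarrow> e \<le> (\<integral>C. cet_success M1 M2 C (jammed_channel N l \<sigma>) \<partial>\<mu>)"
    and T: "finite T" and p: "p = 2 ^ q" "l \<le> p" and \<delta>: "0 < \<delta>"
    and big: "4 * (real p)\<^sup>2 * real CARD('j) < \<delta>\<^sup>2 * real (card T)"
  shows "\<exists>Cs. (\<forall>s\<in>T. Cs s \<in> space \<mu>) \<and> (\<forall>\<sigma>. is_state (words l) \<sigma> \<longrightarrow>
      e - \<delta> \<le> (1 / real (card T)) * (\<Sum>s\<in>T. cet_success M1 M2 (Cs s) (jammed_channel N l \<sigma>)))"
proof -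
  let ?I = "words l :: 'j list set"
  let ?X = "\<lambda>C. ent_ker N l M1 M2 C C"
  have fin: "finite ?I" by (simp add: finite_nlists)
  have psd: "psd ?I (?X C)" if "C \<in> space \<mu>" for C by (intro ent_ker_psd[OF N] assms that)
  have psd': "psd ?I (\<lambda>i j. idop i j - ?X C i j)" if "C \<in> space \<mu>" for C
    by (intro psd_idop_diff fin pairing_ent_ker_le[OF N C[OF that]])
  have succ: "cet_success M1 M2 C (jammed_channel N l \<sigma>) = Re (pairing ?I \<sigma> (?X C))"
    if "is_state ?I \<sigma>" "C \<in> space \<mu>" for C \<sigma>
    by (rule cet_success_eq[OF N C[OF that(2)]]) (use that(1) in \<open>simp add: is_state_def\<close>)
  have ms: "(\<lambda>C. Re (sesq ?I (?X C) v v)) \<in> borel_measurable \<mu>" for v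
  proof (cases "sqnorm ?I v = 0")
    case True
    then have "v i = 0" if "i \<in> ?I" for i
      using that fin unfolding sqnorm_def by (simp add: sum_nonneg_eq_0_iff)
    then have "sesq ?I (?X C) v v = 0" for C by (simp add: sesq_def)
    then show ?thesis by simp
  next
    case False
    define r where "r = sqnorm ?I v"
    have r: "0 < r" using False sqnorm_nonneg[of ?I v] by (simp add: r_def)
    \<comment> \<open>Normalizing \<open>v\<close> gives a pure jammer state, so a multiple of a
      success probability is the quadratic form at \<open>v\<close>. The null vector was treated
      separately.\<close>
    define \<sigma> where "\<sigma> = (\<lambda>i j. of_real (1 / r) * (cnj (v i) * v j))"
    have "psd ?I \<sigma>" unfolding \<sigma>_def using r by (intro psd_scale psd_rank_one_cnj fin) simp
    moreover have "tr ?I \<sigma> = 1"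
    proof -
      have "tr ?I \<sigma> = of_real (1 / r) * (\<Sum>i\<in>?I. cnj (v i) * v i)"
        by (simp add: tr_def \<sigma>_def sum_distrib_left)
      also have "(\<Sum>i\<in>?I. cnj (v i) * v i) = of_real r"
        unfolding r_def sesq_idop_self[OF fin, symmetric] sesq_idop[OF fin] ..
      finally show ?thesis using r by simp
    qed
    ultimately have st: "is_state ?I \<sigma>" by (simp add: is_state_def)
    have "Re (sesq ?I (?X C) v v) = r * cet_success M1 M2 C (jammed_channel N l \<sigma>)" if "C \<in> space \<mu>" for C
    proof -
      have "pairing ?I \<sigma> (?X C) = of_real (1 / r) * sesq ?I (?X C) v v"
        unfolding sesq_eq_pairing \<sigma>_def pairing_def by (simp add: sum_distrib_left mult.assoc)
      then show ?thesis using succ[OF st that] r by simp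
    qed
    then show ?thesis
      using meas[OF st] by (simp cong: measurable_cong)
  qed
  \<comment> \<open>The dimension is \<open>CARD('j) ^ l\<close>; this is where \<open>p\<close>
    must be at least the block length.\<close>
  have "card ?I \<le> CARD('j) ^ p"
    unfolding card_nlists[OF finite] using p(2) by (intro power_increasing) (auto simp: Suc_le_eq)
  from exists_sample_average_close[OF \<mu> fin T entry_measurable[OF fin _ _ psd ms] psd psd' p(1) this \<delta> big]
  obtain Cs where Cs: "\<And>s. s \<in> T \<Longrightarrow> Cs s \<in> space \<mu>"
    and av: "\<And>\<sigma>. is_state ?I \<sigma> \<Longrightarrow> (\<integral>C. Re (pairing ?I \<sigma> (?X C)) \<partial>\<mu>) - \<delta> \<le> (1 / real (card T)) * (\<Sum>s\<in>T. Re (pairing ?I \<sigma> (?X (Cs s))))"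
    by auto
  show ?thesis
  proof (intro exI[of _ Cs] conjI ballI allI impI Cs)
    fix \<sigma> assume st: "is_state ?I \<sigma>"
    have "(\<integral>C. cet_success M1 M2 C (jammed_channel N l \<sigma>) \<partial>\<mu>) = (\<integral>C. Re (pairing ?I \<sigma> (?X C)) \<partial>\<mu>)"
      by (intro Bochner_Integration.integral_cong refl succ st)
    moreover have "(\<Sum>s\<in>T. cet_success M1 M2 (Cs s) (jammed_channel N l \<sigma>)) = (\<Sum>s\<in>T. Re (pairing ?I \<sigma> (?X (Cs s))))"
      by (intro sum.cong refl succ st Cs)
    ultimately show "e - \<delta> \<le> (1 / real (card T)) * (\<Sum>s\<in>T. cet_success M1 M2 (Cs s) (jammed_channel N l \<sigma>))"
      using av[OF st] e[OF st] by simp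
  qed
qed

section \<open>Elimination of the randomness\<close>

text \<open>The rate at length \<open>n\<close> is the rate at length \<open>l n\<close> times
  \<open>l n / n\<close>. For a target \<open>a\<close> below \<open>R\<close>, an intermediate
  \<open>c\<close> splits the slack: the first factor is eventually above \<open>c\<close>, the
  second above \<open>a / c\<close>. Negative targets are separate, as rates are
  nonnegative.\<close>

lemma liminf_rate_reindex:
  fixes M l :: "nat \<Rightarrow> nat"
  assumes M: "\<And>n. 1 \<le> M n" and l: "filterlim l at_top sequentially"
    and ratio: "(\<lambda>n. real (l n) / real n) \<longlonglongrightarrow> 1"
    and R: "ereal R \<le> liminf (\<lambda>n. ereal (log 2 (real (M n)) / real n))"
  shows "ereal R \<le> liminf (\<lambda>n. ereal (log 2 (real (M (l n))) / real n))"
  unfolding le_Liminf_iff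
proof (intro allI impI)
  fix y assume y: "y < ereal R"
  have nn: "0 \<le> log 2 (real (M (l n))) / real n" for n
    using M[of "l n"] by (intro divide_nonneg_nonneg) auto
  show "\<forall>\<^sub>F n in sequentially. y < ereal (log 2 (real (M (l n))) / real n)"
  proof (cases "y < 0")
    case True
    then show ?thesis using nn by (intro always_eventually allI) (meson ereal_less_eq(5) less_le_trans)
  next
    case False
    then obtain a where a: "y = ereal a" "0 \<le> a" using y by (cases y) auto
    then have "a < R" using y by simp
    then obtain c where c: "a < c" "c < R" using dense by blast
    have "\<forall>\<^sub>F n in sequentially. c < log 2 (real (M n)) / real n"
      using R[unfolded le_Liminf_iff, rule_format, of "ereal c"] c(2) by simp
    then have "\<forall>\<^sub>F n in sequentially. c < log 2 (real (M (l n))) / real (l n)"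
      by (rule eventually_compose_filterlim[OF _ l])
    moreover have "\<forall>\<^sub>F n in sequentially. a / c < real (l n) / real n"
      using order_tendstoD(1)[OF ratio, of "a / c"] a c by simp
    ultimately show ?thesis
    proof eventually_elim
      case (elim n)
      have l0: "l n \<noteq> 0" using elim(1) a c by (intro notI) simp
      have "a = c * (a / c)" using a c by simp
      also have "\<dots> < (log 2 (real (M (l n))) / real (l n)) * (real (l n) / real n)"
        using elim a c by (intro mult_strict_mono) auto
      also have "\<dots> = log 2 (real (M (l n))) / real n" using l0 by simp
      finally show ?case by (simp add: a)
    qed
  qed
qed

lemma eventually_exponential_of_liminf:
  fixes M :: "nat \<Rightarrow> nat"
  assumes M: "\<And>n. 1 \<le> M n" and r: "0 < r" "ereal r \<le> liminf (\<lambda>n. ereal (log 2 (real (M n)) / real n))"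
  shows "\<forall>\<^sub>F n in sequentially. 2 powr (real n * r / 2) \<le> real (M n)"
proof -
  have "\<forall>\<^sub>F n in sequentially. ereal (r / 2) < ereal (log 2 (real (M n)) / real n)"
    using r(2)[unfolded le_Liminf_iff, rule_format, of "ereal (r / 2)"] r(1) by simp
  moreover have "\<forall>\<^sub>F n in sequentially. 0 < n" by (rule eventually_gt_at_top)
  ultimately show ?thesis
  proof eventually_elim
    case (elim n)
    have "real n * r / 2 \<le> log 2 (real (M n))" using elim by (simp add: field_simps)
    then have "2 powr (real n * r / 2) \<le> 2 powr (log 2 (real (M n)))" by simp
    also have "\<dots> = real (M n)" using M[of n] by simp
    finally show ?case .
  qed
qed

section \<open>Worst-case success and the easy inclusions\<close>

lemma is_state_eunit:
  assumes "finite I" "i \<in> I"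
  shows "is_state I (eunit i i)"
proof -
  have "eunit i i = (\<lambda>a b. (if a = i then 1 else 0) * cnj (if b = i then 1 else 0))"
    by (auto simp: eunit_def fun_eq_iff)
  then have "psd I (eunit i i)" using psd_rank_one[OF assms(1)] by simp
  then show ?thesis using assms by (simp add: is_state_def tr_eunit idop_def)
qed

lemma state_exists: "\<exists>\<sigma>. is_state (nlists n (UNIV :: 'x::finite set)) \<sigma>"
  using is_state_eunit[of "nlists n (UNIV :: 'x set)" "replicate n undefined"]
  by (auto simp: finite_nlists in_nlists_UNIV)

lemma states_nonempty: "{\<sigma>. is_state (nlists n (UNIV :: 'x::finite set)) \<sigma>} \<noteq> {}"
  using state_exists[of n] by auto

definition worst_success :: "('a::finite, 'j::finite, 'b::finite) jchannel \<Rightarrow> nat \<Rightarrow> nat \<Rightarrow> nat \<Rightarrow> ('a, 'b) cet_code \<Rightarrow> real" where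
  "worst_success N n M1 M2 C = (INF \<sigma>\<in>{\<sigma>. is_state (words n) \<sigma>}. cet_success M1 M2 C (jammed_channel N n \<sigma>))"

lemma worst_success_le:
  assumes N: "channel UNIV UNIV N" and C: "is_cet_code n M1 M2 C" and \<sigma>: "is_state (words n) \<sigma>"
  shows "worst_success N n M1 M2 C \<le> cet_success M1 M2 C (jammed_channel N n \<sigma>)"
  unfolding worst_success_def
  by (rule cINF_lower) (use \<sigma> cet_success_bounds(1)[OF N C] in \<open>auto intro!: bdd_belowI2[where m=0]\<close>)

lemma worst_success_le_1:
  fixes N :: "('a::finite, 'j::finite, 'b::finite) jchannel"
  assumes N: "channel UNIV UNIV N" and C: "is_cet_code n M1 M2 C"
  shows "worst_success N n M1 M2 C \<le> 1"
proof -
  obtain \<sigma> :: "'j list cop" where \<sigma>: "is_state (words n) \<sigma>" using state_exists by auto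
  show ?thesis
    using worst_success_le[OF N C \<sigma>] cet_success_bounds(2)[OF N C \<sigma>] by linarith
qed

lemma worst_success_ge:
  assumes "\<And>\<sigma>. is_state (words n) \<sigma> \<Longrightarrow> e \<le> cet_success M1 M2 C (jammed_channel N n \<sigma>)"
  shows "e \<le> worst_success N n M1 M2 C"
  unfolding worst_success_def by (rule cINF_greatest[OF states_nonempty]) (use assms in auto)

lemma det_cet_region_iff:
  fixes N :: "('a::finite, 'j::finite, 'b::finite) jchannel"
  shows "(R1, R2) \<in> det_cet_region N \<longleftrightarrow> 0 \<le> R1 \<and> 0 \<le> R2 \<and>
    (\<exists>(M1 :: nat \<Rightarrow> nat) (M2 :: nat \<Rightarrow> nat) (C :: nat \<Rightarrow> ('a, 'b) cet_code).
        (\<forall>n. is_cet_code n (M1 n) (M2 n) (C n)) \<and>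
        ereal R1 \<le> liminf (\<lambda>n. ereal (log 2 (real (M1 n)) / real n)) \<and>
        ereal R2 \<le> liminf (\<lambda>n. ereal (log 2 (real (M2 n)) / real n)) \<and>
        (\<lambda>n. worst_success N n (M1 n) (M2 n) (C n)) \<longlonglongrightarrow> 1)"
  unfolding det_cet_region_def worst_success_def by simp

lemma zero_in_det_cet_region:
  fixes N :: "('a::finite, 'j::finite, 'b::finite) jchannel"
  assumes N: "channel UNIV UNIV N"
  shows "(0, 0) \<in> det_cet_region N"
proof -
  let ?C = "\<lambda>n. trivial_code n :: ('a, 'b) cet_code"
  have "worst_success N n 1 1 (?C n) = 1" for n
    using worst_success_le_1[OF N trivial_code_is_code] worst_success_ge[of n 1 1 1 "?C n" N]
      cet_success_trivial_code[OF N, of n] by (intro antisym) auto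
  then have "(\<lambda>n. worst_success N n 1 1 (?C n)) \<longlonglongrightarrow> 1" by simp
  moreover have "ereal 0 \<le> liminf (\<lambda>n. ereal (log 2 (real 1) / real n))"
    by (rule Liminf_bounded) simp
  ultimately show ?thesis
    unfolding det_cet_region_iff
    by (intro conjI exI[of _ "\<lambda>_. 1"] exI[of _ ?C] allI order_refl) (simp_all only: trivial_code_is_code)
qed

text \<open>A deterministic code is a Dirac measure. On a one-point space with the discrete
  sigma-algebra the measurability requirement holds for every function.\<close>

lemma det_subset_rand:
  fixes N :: "('a::finite, 'j::finite, 'b::finite) jchannel"
  shows "det_cet_region N \<subseteq> rand_cet_region N"
proof
  fix R assume "R \<in> det_cet_region N"
  moreover obtain R1 R2 where R: "R = (R1, R2)" by (cases R)
  ultimately obtain M1 M2 and C :: "nat \<Rightarrow> ('a, 'b) cet_code" where R0: "0 \<le> R1" "0 \<le> R2"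
    and C: "\<And>n. is_cet_code n (M1 n) (M2 n) (C n)"
    and rate: "ereal R1 \<le> liminf (\<lambda>n. ereal (log 2 (real (M1 n)) / real n))"
       "ereal R2 \<le> liminf (\<lambda>n. ereal (log 2 (real (M2 n)) / real n))"
    and lim: "(\<lambda>n. worst_success N n (M1 n) (M2 n) (C n)) \<longlonglongrightarrow> 1"
    using det_cet_region_iff[of R1 R2 N] by auto
  define \<mu> where "\<mu> n = return (count_space {C n}) (C n)" for n
  have sp: "space (\<mu> n) = {C n}" "sets (\<mu> n) = sets (count_space {C n})" for n by (auto simp: \<mu>_def)
  have pr: "prob_space (\<mu> n)" for n unfolding \<mu>_def by (rule prob_space_return) simp
  have me: "f \<in> borel_measurable (\<mu> n)" for f :: "('a, 'b) cet_code \<Rightarrow> real" and n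
    unfolding measurable_cong_sets[OF sp(2) refl] by simp
  have it: "(\<integral>D. f D \<partial>\<mu> n) = f (C n)" for f :: "('a, 'b) cet_code \<Rightarrow> real" and n
    unfolding \<mu>_def by (rule integral_return) auto
  show "R \<in> rand_cet_region N"
    unfolding rand_cet_region_def R mem_Collect_eq prod.case
    by (intro conjI exI[of _ M1] exI[of _ M2] exI[of _ \<mu>] R0 rate)
      (use C pr me lim in \<open>simp_all only: sp(1) it worst_success_def, auto\<close>)
qed

text \<open>The prefix length must tend to infinity fast enough for a number of messages exponential
  in it to beat every polynomial in \<open>n\<close>, yet be of smaller order than \<open>n\<close>
  so that no rate is lost. The square root does both.\<close>

lemma sqrt_floor_facts:
  defines "k \<equiv> \<lambda>n::nat. nat \<lfloor>sqrt (real n)\<rfloor>"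
  shows "k n \<le> n" "real (k n) \<le> sqrt (real n)" "sqrt (real n) - 1 \<le> real (k n)"
    "filterlim k at_top sequentially" "filterlim (\<lambda>n. n - k n) at_top sequentially"
    "(\<lambda>n. real (n - k n) / real n) \<longlonglongrightarrow> 1"
proof -
  have le: "real (k n) \<le> sqrt (real n)" for n unfolding k_def by simp
  show "real (k n) \<le> sqrt (real n)" by (rule le)
  have ge: "sqrt (real n) - 1 \<le> real (k n)" for n
  proof -
    have "real (k n) = of_int \<lfloor>sqrt (real n)\<rfloor>" unfolding k_def by simp
    then show ?thesis by linarith
  qed
  show "sqrt (real n) - 1 \<le> real (k n)" by (rule ge)
  have sn: "sqrt (real n) \<le> real n" for n
  proof (cases "n = 0")
    case False
    then have "sqrt (real n) * 1 \<le> sqrt (real n) * sqrt (real n)" by (intro mult_left_mono) auto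
    then show ?thesis by simp
  qed simp
  have kn: "k n \<le> n" for n using le[of n] sn[of n] by linarith
  show "k n \<le> n" by (rule kn)
  have "filterlim (\<lambda>n. sqrt (real n) - 1) at_top sequentially" by real_asymp
  then have "filterlim (\<lambda>n. real (k n)) at_top sequentially"
    by (rule filterlim_at_top_mono) (simp add: ge)
  then show "filterlim k at_top sequentially" by (simp add: filterlim_real_sequentially filterlim_sequentially_iff_filterlim_real)
  have d: "real (n - k n) = real n - real (k n)" for n using kn[of n] by (simp add: of_nat_diff)
  have "filterlim (\<lambda>n. real n - sqrt (real n)) at_top sequentially" by real_asymp
  then have "filterlim (\<lambda>n. real (n - k n)) at_top sequentially"
    by (rule filterlim_at_top_mono) (simp add: d le)
  then show "filterlim (\<lambda>n. n - k n) at_top sequentially" by (simp add: filterlim_sequentially_iff_filterlim_real)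
  have "(\<lambda>n. (real n - sqrt (real n)) / real n) \<longlonglongrightarrow> 1" by real_asymp
  moreover have "(\<lambda>n::nat. 1 :: real) \<longlonglongrightarrow> 1" by simp
  moreover have "\<forall>\<^sub>F n in sequentially. (real n - sqrt (real n)) / real n \<le> real (n - k n) / real n"
    by (intro always_eventually allI divide_right_mono) (simp_all add: d le)
  moreover have "\<forall>\<^sub>F n in sequentially. real (n - k n) / real n \<le> 1"
    by (intro always_eventually allI) (simp add: divide_le_eq)
  ultimately show "(\<lambda>n. real (n - k n) / real n) \<longlonglongrightarrow> 1"
    by (rule tendsto_sandwich[rotated 2])
qed

text \<open>The moment order has to be a power of two and at least the block length. Staying below
  twice the length keeps the number of samples polynomial.\<close>

lemma exists_power_of_two_between:
  assumes "1 \<le> (n::nat)"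
  shows "\<exists>q. n \<le> 2 ^ q \<and> 2 ^ q \<le> 2 * n"
  using assms
proof (induction n rule: nat_induct_at_least)
  case base
  show ?case by (intro exI[of _ 0]) simp
next
  case (Suc n)
  then obtain q where q: "n \<le> 2 ^ q" "2 ^ q \<le> 2 * n" by auto
  show ?case
  proof (cases "Suc n \<le> 2 ^ q")
    case True
    then show ?thesis using q by (intro exI[of _ q]) auto
  next
    case False
    then have "n = 2 ^ q" using q by simp
    then show ?thesis using Suc.hyps by (intro exI[of _ "Suc q"]) auto
  qed
qed

section \<open>Assembling the block codes\<close>

definition worst_random_success :: "('a::finite, 'j::finite, 'b::finite) jchannel \<Rightarrow> nat \<Rightarrow> nat \<Rightarrow> nat \<Rightarrow> ('a, 'b) cet_code measure \<Rightarrow> real" where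
  "worst_random_success N n M1 M2 \<mu> =
    (INF \<sigma>\<in>{\<sigma>. is_state (words n) \<sigma>}. \<integral>C. cet_success M1 M2 C (jammed_channel N n \<sigma>) \<partial>\<mu>)"

lemma worst_random_success_le:
  fixes N :: "('a::finite, 'j::finite, 'b::finite) jchannel"
  assumes N: "channel UNIV UNIV N" and C: "\<And>C. C \<in> space \<mu> \<Longrightarrow> is_cet_code n M1 M2 C"
    and \<sigma>: "is_state (words n) \<sigma>"
  shows "worst_random_success N n M1 M2 \<mu> \<le> (\<integral>C. cet_success M1 M2 C (jammed_channel N n \<sigma>) \<partial>\<mu>)"
  unfolding worst_random_success_def
proof (rule cINF_lower)
  show "\<sigma> \<in> {\<sigma>. is_state (words n) \<sigma>}" using \<sigma> by simp
  show "bdd_below ((\<lambda>\<sigma>. \<integral>C. cet_success M1 M2 C (jammed_channel N n \<sigma>) \<partial>\<mu>) ` {\<sigma>. is_state (words n) \<sigma>})"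
  proof (rule bdd_belowI2[where m=0])
    fix \<tau> :: "'j list cop" assume "\<tau> \<in> {\<sigma>. is_state (words n) \<sigma>}"
    then have "is_state (words n) \<tau>" by simp
    then show "0 \<le> (\<integral>C. cet_success M1 M2 C (jammed_channel N n \<tau>) \<partial>\<mu>)"
      by (intro Bochner_Integration.integral_nonneg cet_success_bounds(1)[OF N C])
  qed
qed

text \<open>One code is drawn for every message of the prefix, so all \<open>K1 * K2\<close>
  messages are used, however many exceed the threshold. The bound is conditional because a code must
  exist at every length, even where the prefix is too small.\<close>

lemma elimination_block:
  fixes N :: "('a::finite, 'j::finite, 'b::finite) jchannel" and \<mu> :: "('a, 'b) cet_code measure"
  assumes N: "channel UNIV UNIV N" and Cd: "is_cet_code k K1 K2 Cd"
    and \<mu>: "prob_space \<mu>" and C: "\<And>C. C \<in> space \<mu> \<Longrightarrow> is_cet_code l M1 M2 C"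
    and meas: "\<And>\<sigma>. is_state (words l) \<sigma> \<Longrightarrow>
        (\<lambda>C. cet_success M1 M2 C (jammed_channel N l \<sigma>)) \<in> borel_measurable \<mu>"
  shows "\<exists>C'. is_cet_code (k + l) M1 M2 C' \<and>
    (1 \<le> k + l \<and> 16 * real CARD('j) * real (k + l) ^ 4 < real K1 * real K2 \<longrightarrow>
      worst_success N k K1 K2 Cd + worst_random_success N l M1 M2 \<mu> - 1 - 1 / real (k + l)
        \<le> worst_success N (k + l) M1 M2 C')"
proof -
  let ?n = "k + l" and ?T = "{0..<K1} \<times> {0..<K2}"
  interpret prob_space \<mu> by (rule \<mu>)
  show ?thesis
  proof (cases "1 \<le> ?n \<and> 16 * real CARD('j) * real ?n ^ 4 < real K1 * real K2")
    case True
    then have n: "1 \<le> ?n" and big: "16 * real CARD('j) * real ?n ^ 4 < real K1 * real K2" by auto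
    obtain q where q: "?n \<le> 2 ^ q" "2 ^ q \<le> 2 * ?n" using exists_power_of_two_between[OF n] by auto
    define p :: nat where "p = 2 ^ q"
    \<comment> \<open>With \<open>p \<le> 2 * n\<close> and accuracy \<open>1 / n\<close>, the
      requirement of the concentration bound becomes \<open>16 * d * n^2 < K1 * K2 / n^2\<close>,
      where \<open>n = k + l\<close> and \<open>d = CARD('j)\<close>; this is the source of the
      constant 16 and of the fourth power.\<close>
    have "4 * (real p)\<^sup>2 * real CARD('j) < (1 / real ?n)\<^sup>2 * real (card ?T)"
    proof -
      have "real p \<le> real (2 * ?n)" using q(2) unfolding p_def by (rule of_nat_mono)
      then have "(real p)\<^sup>2 \<le> (real (2 * ?n))\<^sup>2" by (rule power_mono) simp
      then have "4 * (real p)\<^sup>2 * real CARD('j) \<le> 4 * (real (2 * ?n))\<^sup>2 * real CARD('j)"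
        by (intro mult_right_mono mult_left_mono) auto
      also have "\<dots> = (1 / real ?n)\<^sup>2 * (16 * real CARD('j) * real ?n ^ 4)"
      proof -
        define x where "x = real ?n"
        have x: "x \<noteq> 0" "real (2 * ?n) = 2 * x" using n by (simp_all add: x_def)
        then show ?thesis unfolding x(2) x_def[symmetric]
          by (simp add: field_simps power2_eq_square power4_eq_xxxx)
      qed
      also have "\<dots> < (1 / real ?n)\<^sup>2 * (real K1 * real K2)"
        using big n by (intro mult_strict_left_mono) auto
      finally show ?thesis by simp
    qed
    from derandomize[OF N \<mu> C meas worst_random_success_le[OF N C] _ p_def _ _ this]
    obtain Cs where Cs: "\<And>s. s \<in> ?T \<Longrightarrow> Cs s \<in> space \<mu>"
      and av: "\<And>\<sigma>. is_state (words l) \<sigma> \<Longrightarrow> worst_random_success N l M1 M2 \<mu> - 1 / real ?n \<le>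
         (1 / real (card ?T)) * (\<Sum>s\<in>?T. cet_success M1 M2 (Cs s) (jammed_channel N l \<sigma>))"
      using n q(1) by (auto simp: p_def)
    have code: "is_cet_code l M1 M2 (Cs s)" if "s \<in> ?T" for s by (rule C[OF Cs[OF that]])
    have "worst_success N k K1 K2 Cd + worst_random_success N l M1 M2 \<mu> - 1 - 1 / real ?n
        \<le> worst_success N ?n M1 M2 (comb_code k l K1 K2 Cd Cs)"
    proof (rule worst_success_ge)
      fix \<sigma> :: "'j list cop" assume \<sigma>: "is_state (words ?n) \<sigma>"
      have "worst_success N k K1 K2 Cd \<le> cet_success K1 K2 Cd (jammed_channel N k (marg1 l \<sigma>))"
        by (rule worst_success_le[OF N Cd marg_state(1)[OF \<sigma>]])
      moreover have "worst_random_success N l M1 M2 \<mu> - 1 / real ?n \<le>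
         (1 / (real K1 * real K2)) * (\<Sum>s\<in>?T. cet_success M1 M2 (Cs s) (jammed_channel N l (marg2 k \<sigma>)))"
        using av[OF marg_state(2)[OF \<sigma>]] by simp
      ultimately show "worst_success N k K1 K2 Cd + worst_random_success N l M1 M2 \<mu> - 1 - 1 / real ?n
        \<le> cet_success M1 M2 (comb_code k l K1 K2 Cd Cs) (jammed_channel N ?n \<sigma>)"
        using cet_success_comb_code[where Cs=Cs, OF N Cd code \<sigma>] by linarith
    qed
    then show ?thesis
      using comb_code_is_code[where Cs=Cs, OF Cd code] by (intro exI[of _ "comb_code k l K1 K2 Cd Cs"]) simp
  next
    case False
    \<comment> \<open>Below the threshold any valid code of the right length will do, for instance
      the same code behind every prefix message.\<close>
    obtain C0 where "C0 \<in> space \<mu>" using not_empty by auto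
    then have "is_cet_code ?n M1 M2 (comb_code k l K1 K2 Cd (\<lambda>_. C0))"
      by (intro comb_code_is_code[OF Cd] C)
    then show ?thesis using False by (intro exI[of _ "comb_code k l K1 K2 Cd (\<lambda>_. C0)"]) (simp only: False simp_thms)
  qed
qed

lemma rand_subset_det:
  fixes N :: "('a::finite, 'j::finite, 'b::finite) jchannel"
  assumes N: "channel UNIV UNIV N" and r: "(r1, r2) \<in> det_cet_region N" "(r1, r2) \<noteq> (0, 0)"
  shows "rand_cet_region N \<subseteq> det_cet_region N"
proof
  fix R assume "R \<in> rand_cet_region N"
  moreover obtain R1 R2 where R: "R = (R1, R2)" by (cases R)
  ultimately obtain M1 M2 and \<mu> :: "nat \<Rightarrow> ('a, 'b) cet_code measure" where R0: "0 \<le> R1" "0 \<le> R2"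
    and codes: "\<forall>n. prob_space (\<mu> n) \<and> (\<forall>C\<in>space (\<mu> n). is_cet_code n (M1 n) (M2 n) C) \<and>
             (\<forall>\<sigma>. is_state (words n) \<sigma> \<longrightarrow>
                 (\<lambda>C. cet_success (M1 n) (M2 n) C (jammed_channel N n \<sigma>)) \<in> borel_measurable (\<mu> n))"
    and rate: "ereal R1 \<le> liminf (\<lambda>n. ereal (log 2 (real (M1 n)) / real n))"
       "ereal R2 \<le> liminf (\<lambda>n. ereal (log 2 (real (M2 n)) / real n))"
    and lim: "(\<lambda>n. worst_random_success N n (M1 n) (M2 n) (\<mu> n)) \<longlonglongrightarrow> 1"
    unfolding rand_cet_region_def worst_random_success_def by auto
  have \<mu>: "prob_space (\<mu> n)" and C: "\<And>C. C \<in> space (\<mu> n) \<Longrightarrow> is_cet_code n (M1 n) (M2 n) C"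
    and meas: "\<And>\<sigma>. is_state (words n) \<sigma> \<Longrightarrow>
      (\<lambda>C. cet_success (M1 n) (M2 n) C (jammed_channel N n \<sigma>)) \<in> borel_measurable (\<mu> n)" for n
    using spec[OF codes, of n] by simp_all
  from r(1) obtain K1 K2 and Cd :: "nat \<Rightarrow> ('a, 'b) cet_code" where r0: "0 \<le> r1" "0 \<le> r2"
    and Cd: "\<And>n. is_cet_code n (K1 n) (K2 n) (Cd n)"
    and rrate: "ereal r1 \<le> liminf (\<lambda>n. ereal (log 2 (real (K1 n)) / real n))"
       "ereal r2 \<le> liminf (\<lambda>n. ereal (log 2 (real (K2 n)) / real n))"
    and rlim: "(\<lambda>n. worst_success N n (K1 n) (K2 n) (Cd n)) \<longlonglongrightarrow> 1"
    unfolding det_cet_region_iff by auto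
  have K: "1 \<le> K1 n" "1 \<le> K2 n" for n using is_cet_codeD(1,2)[OF Cd[of n]] by auto
  have M: "1 \<le> M1 n" "1 \<le> M2 n" for n
  proof -
    obtain C0 where "C0 \<in> space (\<mu> n)" using prob_space.not_empty[OF \<mu>[of n]] by auto
    from is_cet_codeD(1,2)[OF C[OF this]] show "1 \<le> M1 n" "1 \<le> M2 n" by auto
  qed
  define k where "k n = nat \<lfloor>sqrt (real n)\<rfloor>" for n :: nat
  note k = sqrt_floor_facts[folded k_def]
  define l where "l n = n - k n" for n
  have kl: "k n + l n = n" for n using k(1)[of n] by (simp add: l_def)
  have l: "filterlim l at_top sequentially" "(\<lambda>n. real (l n) / real n) \<longlonglongrightarrow> 1"
    unfolding l_def using k(5,6) by auto
  \<comment> \<open>Either positive rate suffices: the other factor of \<open>K1 n * K2 n\<close> is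
    at least 1, so the number of classical messages is exponential in both cases.\<close>
  obtain r where rpos: "0 < r" and "\<forall>\<^sub>F n in sequentially. 2 powr (real n * r / 2) \<le> real (K1 n) * real (K2 n)"
  proof (cases "0 < r1")
    case True
    have "\<forall>\<^sub>F n in sequentially. 2 powr (real n * r1 / 2) \<le> real (K1 n)"
      by (rule eventually_exponential_of_liminf[OF K(1) True rrate(1)])
    then have "\<forall>\<^sub>F n in sequentially. 2 powr (real n * r1 / 2) \<le> real (K1 n) * real (K2 n)"
    proof eventually_elim
      case (elim n)
      have "real (K1 n) * 1 \<le> real (K1 n) * real (K2 n)" using K(2)[of n] by (intro mult_left_mono) auto
      then show ?case using elim by simp
    qed
    then show ?thesis using that True by auto
  next
    case False
    then have r2: "0 < r2" using r(2) r0 by auto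
    have "\<forall>\<^sub>F n in sequentially. 2 powr (real n * r2 / 2) \<le> real (K2 n)"
      by (rule eventually_exponential_of_liminf[OF K(2) r2 rrate(2)])
    then have "\<forall>\<^sub>F n in sequentially. 2 powr (real n * r2 / 2) \<le> real (K1 n) * real (K2 n)"
    proof eventually_elim
      case (elim n)
      have "1 * real (K2 n) \<le> real (K1 n) * real (K2 n)" using K(1)[of n] by (intro mult_right_mono) auto
      then show ?case using elim by simp
    qed
    then show ?thesis using that r2 by auto
  qed
  then have "\<forall>\<^sub>F n in sequentially. 2 powr (real (k n) * r / 2) \<le> real (K1 (k n)) * real (K2 (k n))"
    by (intro eventually_compose_filterlim[OF _ k(4)])
  moreover have "\<forall>\<^sub>F n in sequentially. 16 * real CARD('j) * real n ^ 4 < 2 powr ((sqrt (real n) - 1) * r / 2)"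
  proof -
    have "0 < real CARD('j)" by simp
    with rpos show ?thesis by real_asymp
  qed
  ultimately have big: "\<forall>\<^sub>F n in sequentially. 16 * real CARD('j) * real n ^ 4 < real (K1 (k n)) * real (K2 (k n))"
  proof eventually_elim
    case (elim n)
    \<comment> \<open>Rounding the prefix length down costs at most 1 in the exponent.\<close>
    have "2 powr ((sqrt (real n) - 1) * r / 2) \<le> 2 powr (real (k n) * r / 2)"
      using k(3)[of n] rpos by (intro powr_mono) (auto intro!: mult_right_mono)
    then show ?case using elim by linarith
  qed
  let ?b = "\<lambda>n. worst_success N (k n) (K1 (k n)) (K2 (k n)) (Cd (k n))
     + worst_random_success N (l n) (M1 (l n)) (M2 (l n)) (\<mu> (l n)) - 1 - 1 / real n"
  have "\<exists>C'. is_cet_code n (M1 (l n)) (M2 (l n)) C' \<and>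
    (1 \<le> n \<and> 16 * real CARD('j) * real n ^ 4 < real (K1 (k n)) * real (K2 (k n)) \<longrightarrow>
      ?b n \<le> worst_success N n (M1 (l n)) (M2 (l n)) C')" for n
    using elimination_block[OF N Cd[of "k n"] \<mu>[of "l n"] C meas] unfolding kl .
  then obtain C' where C': "\<And>n. is_cet_code n (M1 (l n)) (M2 (l n)) (C' n)"
    and low: "\<And>n. 1 \<le> n \<Longrightarrow> 16 * real CARD('j) * real n ^ 4 < real (K1 (k n)) * real (K2 (k n)) \<Longrightarrow>
      ?b n \<le> worst_success N n (M1 (l n)) (M2 (l n)) (C' n)"
    by metis
  \<comment> \<open>The two failure probabilities and the sampling error \<open>1 / n\<close> all
    vanish, since \<open>k n\<close> and \<open>l n\<close> both tend to infinity.\<close>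
  have "?b \<longlonglongrightarrow> 1 + 1 - 1 - 0"
    by (intro tendsto_diff tendsto_add tendsto_const lim_1_over_n
        filterlim_compose[OF rlim k(4)] filterlim_compose[OF lim l(1)])
  then have b1: "?b \<longlonglongrightarrow> 1" by simp
  have "(\<lambda>n. worst_success N n (M1 (l n)) (M2 (l n)) (C' n)) \<longlonglongrightarrow> 1"
  proof (rule tendsto_sandwich[OF _ _ b1 tendsto_const])
    show "\<forall>\<^sub>F n in sequentially. ?b n \<le> worst_success N n (M1 (l n)) (M2 (l n)) (C' n)"
      using big eventually_ge_at_top[of 1] by eventually_elim (rule low)
    show "\<forall>\<^sub>F n in sequentially. worst_success N n (M1 (l n)) (M2 (l n)) (C' n) \<le> 1"
      by (intro always_eventually allI worst_success_le_1[OF N C'])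
  qed
  moreover have "ereal R1 \<le> liminf (\<lambda>n. ereal (log 2 (real (M1 (l n))) / real n))"
    by (rule liminf_rate_reindex[OF M(1) l rate(1)])
  moreover have "ereal R2 \<le> liminf (\<lambda>n. ereal (log 2 (real (M2 (l n))) / real n))"
    by (rule liminf_rate_reindex[OF M(2) l rate(2)])
  ultimately show "R \<in> det_cet_region N"
    unfolding R det_cet_region_iff
    by (intro conjI exI[of _ "\<lambda>n. M1 (l n)"] exI[of _ "\<lambda>n. M2 (l n)"] exI[of _ C'] allI R0 C')
qed

theorem mainTheorem18:
  fixes N :: "('a::finite \<times> 'j::finite) cop \<Rightarrow> 'b::finite cop"
  assumes "channel UNIV UNIV N"
  shows "det_cet_region N = {(0, 0)} \<or> det_cet_region N = rand_cet_region N"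
proof (cases "det_cet_region N = {(0, 0)}")
  case False
  \<comment> \<open>Since (0, 0) always belongs to the region, a region different from
    \<open>{(0, 0)}\<close> is not empty and contains a nonzero pair.\<close>
  then obtain r where "r \<in> det_cet_region N" "r \<noteq> (0, 0)"
    using zero_in_det_cet_region[OF assms] by auto
  then have "rand_cet_region N \<subseteq> det_cet_region N"
    using rand_subset_det[OF assms, of "fst r" "snd r"] by simp
  then show ?thesis using det_subset_rand[of N] by auto
qed simp

end
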